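(* Let $\emptyset\neq\mathcal D\subseteq\{(i,j)\mid 1\le i<j\le N\}$ be a basic set and let $\Phi:\mathcal D\cap\mathcal P\to\mathbb F_q^*$ be a map. Set $$A=A(\mathcal D,\Phi)=\sum_{(i,j)\in\mathcal D\cap\mathcal P}\Phi(i,j)e_{ij}\in V.$$ If $j\neq\bar i$ for all $(i,j)\in\mathcal D\cap\mathcal P$, then the André–Neto supercharacter $\xi_{\mathcal D,\Phi}$ is afforded by the restriction to $U$ of the $\widetilde U$-orbit module $\mathbb C\widetilde{\mathcal O}_A$. If $(i,\bar i)\in\mathcal D$ for some $1\le i\le n$, then $\xi_{\mathcal D,\Phi}$ is afforded by a direct summand of this restriction. Moreover, $[A]\in\hat V$ is a main separated verge character, and $\widetilde{\mathcal O}_A$ decomposes under the action of $U\le\widetilde U$ into the disjoint union of all $U$-orbits of the form $\mathcal O_B$ with $[B]\in\hat V$ a main separated core character with $\mathrm{verge}(B)=A$. Thus $$\mathrm{Res}^{\widetilde U}_U(\mathbb C\widetilde{\mathcal O}_A)=\mathbb C\mathcal V(A)=\bigoplus_{[B]\in\hat V\text{ core character},\ \mathrm{verge}(B)=A}\mathbb C\mathcal O_B$$ is a direct sum decomposition into $U$-orbit modules of the André–Neto module attached to the supercharacter $\xi_{\mathcal D,\Phi}$, i.e. of the $\mathbb C\widetilde U$-module $\bigotimes_{(i,j)\in\mathcal D\cap\mathcal P}\mathbb C\widetilde{\mathcal O}_{\Phi(i,j)e_{ij}}\cong\mathbb C\widetilde{\mathcal O}_A$ restricted to $U$.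
   Context: Let $p$ be an odd prime, $q$ a power of $p$, $n$ a natural number. Fix one of the types $\mathfrak B_n,\mathfrak C_n,\mathfrak D_n$; set $N=2n+1,\tilde n=n+1$ for $\mathfrak B_n$ and $N=2n,\tilde n=n$ for $\mathfrak C_n,\mathfrak D_n$. Put $\bar i=N+1-i$. Let $S=\sum_{i=1}^n e_{i\bar i}+\sum_{i=n+1}^N\epsilon e_{i\bar i}$, where $e_{ij}$ are the $N\times N$ matrix units, $\epsilon=-1$ for type $\mathfrak C_n$ and $\epsilon=1$ otherwise, $G=\{g\in GL_N(q)\mid g^tSg=S\}$, $\widetilde U=U_N(q)$ the group of upper unitriangular $N\times N$ matrices over $\mathbb F_q$, $U=G\cap\widetilde U$. Let $\mathcal P=\{(i,j)\mid 1\le i<j<\bar i\}$ for types $\mathfrak B_n,\mathfrak D_n$ and $\mathcal P=\{(i,j)\mid 1\le i<j\le\bar i\}$ for type $\mathfrak C_n$. Let $V=\bigoplus_{(i,j)\in\mathcal P}\mathbb F_q e_{ij}$, $\pi:\mathrm{Mat}_{N\times N}(\mathbb F_q)\to V$ the projection setting entries outside $\mathcal P$ to zero, $\kappa(A,B)=\mathrm{tr}(A^tB)$. Fix a nontrivial linear character $\theta$ of $(\mathbb F_q,+)$; for $A\in V$ let $[A]$ be the linear character $B\mapsto\theta(-\kappa(A,B))$ of $(V,+)$, and $\hat V=\{[A]\mid A\in V\}$, a basis of $\mathbb C\hat V=\mathbb C^V$. $\widetilde U$ permutes $\hat V$ by $[A].u=[\pi(Au^{-t})]$, $u^{-t}=(u^{-1})^t$,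 and acts on $\mathbb C\hat V$ from the right by the monomial action $[A]u=\theta(-\kappa(A,u^{-1}))[A].u$. Put $\mathcal O_A=\{[A].u\mid u\in U\}$ and $\widetilde{\mathcal O}_A=\{[A].u\mid u\in\widetilde U\}$; $\mathbb C\mathcal O_A$ and $\mathbb C\widetilde{\mathcal O}_A$ (their spans in $\mathbb C\hat V$) are the $U$-, respectively $\widetilde U$-orbit modules under the monomial action. Root subgroups: for $(i,j)\in\mathcal P$, $X_{ij}=\{x_{ij}(\alpha)\mid\alpha\in\mathbb F_q\}\le U$, where: type $\mathfrak B_n$: $x_{ij}(\alpha)=1+\alpha e_{ij}-\alpha e_{\bar j\,\bar i}$ if $j\ne n+1$, $x_{i,n+1}(\alpha)=1+\alpha e_{i,n+1}-\alpha e_{n+1,\bar i}-\frac12\alpha^2e_{i\bar i}$; type $\mathfrak C_n$: $x_{ij}(\alpha)=1+\alpha e_{ij}-\alpha e_{\bar j\,\bar i}$ if $j\le n$, $1+\alpha e_{ij}+\alpha e_{\bar j\,\bar i}$ if $n<j<\bar i$, and $x_{i\bar i}(\alpha)=1+\alpha e_{i\bar i}$; type $\mathfrak D_n$: $x_{ij}(\alpha)=1+\alpha e_{ij}-\alpha e_{\bar j\,\bar i}$. Elementary characters: for $(i,j)\in\mathcal P$ put $\varrho_{i,j}=\{(i,k)\in\mathcal P\mid i<k<j\}$ if $j\le\tilde n$, and $\varrho_{i,j}=\{(i,k)\in\mathcal P\mid i<k\le n\}\cup\{(\bar j,l)\in\mathcal P\mid\bar j<l\le\tilde n\}$ if $j>\tilde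 n$. Let $U_{i,j}$ be the subgroup of $U$ generated by all $X_{ab}$ with $(a,b)\in\mathcal P\setminus\varrho_{i,j}$. For $0\ne\alpha\in\mathbb F_q$, $\chi^{i,j}_\alpha:U_{i,j}\to\mathbb C^*$, $u\mapsto\theta(\alpha u_{ij})$ is a linear character, and $\xi^{i,j}_\alpha=\mathrm{Ind}_{U_{i,j}}^U(\chi^{i,j}_\alpha)$ is the elementary character associated with $(i,j)$ and $\alpha$. A subset $\mathcal D\subseteq\{(i,j)\mid1\le i<j\le N\}$ is basic if (i) $(i,j)\in\mathcal D$ if and only if $(\bar j,\bar i)\in\mathcal D$, and (ii) each row and each column contains at most one element of $\mathcal D$. For a basic set $\mathcal D\ne\emptyset$ and $\Phi:\mathcal D\cap\mathcal P\to\mathbb F_q^*$ the André–Neto supercharacter is $\xi_{\mathcal D,\Phi}=\prod_{(i,j)\in\mathcal D\cap\mathcal P}\xi^{i,j}_{\Phi(i,j)}$ (an empty product being the trivial character). Main conditions: $(i,j)\in\mathcal P$ is a main condition of $A$ if $A_{ij}$ is the rightmost nonzero entry in row $i$; it is a left main condition if $j\le\tilde n$ and a right main condition if $j>\tilde n$; $\mathrm{main}(A)$ is the set of main conditions. $[A]$ is a staircase character if its main conditions lie in pairwise different columns. For staircase $[A]$: the minor conditions are the positions $(i,\bar j)$ with $(i,j)$ a right main condition (in type $\mathfrak C_n$ the minor condition of $(i,\bar i)$ is the diagonal position $(i,i)\notin\mathcal P$). A supplementary condition is a position $(i,j)\in\mathcal P$ with $j\le\tilde n$ which lies in the same row and to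 the left of some minor condition or some left main condition, lies in the same column as some minor condition, and is itself neither a minor nor a main condition. $\mathrm{core}(A)$ is the union of the sets of main, minor and supplementary conditions for types $\mathfrak B_n,\mathfrak D_n$, and of main and supplementary conditions for type $\mathfrak C_n$. $\mathrm{verge}(A)=\sum_{(i,j)\in\mathrm{main}(A)}A_{ij}e_{ij}$. $[A]$ is a verge character if $A=\mathrm{verge}(A)$, and a core character if $\{(i,j)\mid A_{ij}\ne0\}\subseteq\mathrm{core}(A)$. $\mathcal V(A)=\{[B]\in\hat V\mid\mathrm{verge}(B)=\mathrm{verge}(A)\}$ and $\mathbb C\mathcal V(A)$ is the $\mathbb C U$-module (monomial action) with basis $\mathcal V(A)$. Arms and legs: for $(i,j)$ with $i<j<\bar i$ the arm is $\mathcal A(i,j)=\{(\bar j,a)\in\mathcal P\}$ (all positions of $\mathcal P$ in row $\bar j$); in type $\mathfrak C_n$, $\mathcal A(i,\bar i)=\{(i,a)\mid i<a<\bar i\}$. The leg of $(i,j)\in\mathcal P$ is $\mathcal L(i,j)=\{(a,j)\in\mathcal P\mid a>i\}$. $\mathrm{Limb}(A)=\bigcup_{(i,j)\in\mathrm{main}(A)}(\mathcal L(i,j)\cup\mathcal A(i,j))$. $[A]$ is main separated if $\mathrm{Limb}(A)\cap\mathrm{main}(A)=\emptyset$ (main separated characters are automatically staircase). *)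

theory Defs
  imports
    Complex_Main
    "HOL-Computational_Algebra.Primes"
    "HOL-Library.Function_Algebras"
    "HOL-Library.FuncSet"
    "HOL-Library.Disjoint_Sets"
    "HOL-Algebra.Generated_Groups"
    "Jordan_Normal_Form.Matrix"
begin

section \<open>Right modules of a group inside spaces of complex functions\<close>

definition fscale :: "complex \<Rightarrow> ('b \<Rightarrow> complex) \<Rightarrow> 'b \<Rightarrow> complex"
  where "fscale c f = (\<lambda>x. c * f x)"

global_interpretation cfun: vector_space "fscale :: complex \<Rightarrow> ('b \<Rightarrow> complex) \<Rightarrow> _"
  by unfold_locales (auto simp: fscale_def fun_eq_iff algebra_simps)

text \<open>A right module is given by a group, a subspace \<open>W\<close> and a map \<open>act\<close>, where \<open>act g w\<close> is
  the element written \<open>w g\<close> in right-module notation. Only the values of \<open>act g\<close> on \<open>W\<close> matter;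
  restricting a module to a subgroup means keeping \<open>W\<close> and \<open>act\<close> and changing the group.\<close>

definition right_module ::
  "('g, 'm) monoid_scheme \<Rightarrow> ('b \<Rightarrow> complex) set \<Rightarrow> ('g \<Rightarrow> ('b \<Rightarrow> complex) \<Rightarrow> ('b \<Rightarrow> complex)) \<Rightarrow> bool"
  where "right_module G W act \<longleftrightarrow>
    cfun.subspace W \<and>
    (\<forall>g\<in>carrier G. \<forall>w\<in>W. act g w \<in> W) \<and>
    (\<forall>g\<in>carrier G. \<forall>v\<in>W. \<forall>w\<in>W. act g (v + w) = act g v + act g w) \<and>
    (\<forall>g\<in>carrier G. \<forall>c. \<forall>w\<in>W. act g (fscale c w) = fscale c (act g w)) \<and>
    (\<forall>w\<in>W. act \<one>\<^bsub>G\<^esub> w = w) \<and>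
    (\<forall>g\<in>carrier G. \<forall>h\<in>carrier G. \<forall>w\<in>W. act (g \<otimes>\<^bsub>G\<^esub> h) w = act h (act g w))"

definition right_module_iso ::
  "('g, 'm) monoid_scheme \<Rightarrow> ('b \<Rightarrow> complex) set \<Rightarrow> ('g \<Rightarrow> ('b \<Rightarrow> complex) \<Rightarrow> ('b \<Rightarrow> complex)) \<Rightarrow>
    ('c \<Rightarrow> complex) set \<Rightarrow> ('g \<Rightarrow> ('c \<Rightarrow> complex) \<Rightarrow> ('c \<Rightarrow> complex)) \<Rightarrow> bool"
  where "right_module_iso G W act W' act' \<longleftrightarrow>
    right_module G W act \<and> right_module G W' act' \<and>
    (\<exists>F. bij_betw F W W' \<and>
      (\<forall>v\<in>W. \<forall>w\<in>W. F (v + w) = F v + F w) \<and>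
      (\<forall>c. \<forall>w\<in>W. F (fscale c w) = fscale c (F w)) \<and>
      (\<forall>g\<in>carrier G. \<forall>w\<in>W. F (act g w) = act' g (F w)))"

definition is_basis :: "('b \<Rightarrow> complex) set \<Rightarrow> ('b \<Rightarrow> complex) set \<Rightarrow> bool"
  where "is_basis B W \<longleftrightarrow> B \<subseteq> W \<and> \<not> cfun.dependent B \<and> cfun.span B = W"

text \<open>The trace of \<open>act g\<close> on \<open>W\<close>; it does not depend on the chosen basis.\<close>

definition module_character ::
  "('b \<Rightarrow> complex) set \<Rightarrow> ('g \<Rightarrow> ('b \<Rightarrow> complex) \<Rightarrow> ('b \<Rightarrow> complex)) \<Rightarrow> 'g \<Rightarrow> complex"
  where "module_character W act g =
    (let B = (SOME B. is_basis B W) in \<Sum>b\<in>B. cfun.representation B (act g b) b)"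

definition affords ::
  "('g, 'm) monoid_scheme \<Rightarrow> ('b \<Rightarrow> complex) set \<Rightarrow> ('g \<Rightarrow> ('b \<Rightarrow> complex) \<Rightarrow> ('b \<Rightarrow> complex)) \<Rightarrow>
    ('g \<Rightarrow> complex) \<Rightarrow> bool"
  where "affords G W act \<chi> \<longleftrightarrow>
    right_module G W act \<and> (\<forall>g\<in>carrier G. module_character W act g = \<chi> g)"

definition direct_summand ::
  "('g, 'm) monoid_scheme \<Rightarrow> ('b \<Rightarrow> complex) set \<Rightarrow> ('b \<Rightarrow> complex) set \<Rightarrow>
    ('g \<Rightarrow> ('b \<Rightarrow> complex) \<Rightarrow> ('b \<Rightarrow> complex)) \<Rightarrow> bool"
  where "direct_summand G W1 W act \<longleftrightarrow>
    right_module G W1 act \<and>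
    (\<exists>W2. right_module G W2 act \<and> W = {v + w |v w. v \<in> W1 \<and> w \<in> W2} \<and> W1 \<inter> W2 = {0})"

text \<open>Internal direct sum of finitely many submodules.\<close>

definition direct_sum_decomposition ::
  "('g, 'm) monoid_scheme \<Rightarrow> ('b \<Rightarrow> complex) set \<Rightarrow> ('g \<Rightarrow> ('b \<Rightarrow> complex) \<Rightarrow> ('b \<Rightarrow> complex)) \<Rightarrow>
    'i set \<Rightarrow> ('i \<Rightarrow> ('b \<Rightarrow> complex) set) \<Rightarrow> bool"
  where "direct_sum_decomposition G W act I M \<longleftrightarrow>
    finite I \<and> right_module G W act \<and>
    (\<forall>i\<in>I. right_module G (M i) act \<and> M i \<subseteq> W) \<and>
    (\<forall>w\<in>W. \<exists>!c. c \<in> (\<Pi>\<^sub>E i\<in>I. M i) \<and> w = (\<Sum>i\<in>I. c i))"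

text \<open>For a finite index set \<open>S\<close> and subspaces \<open>W s\<close> of the space of functions \<open>'b \<Rightarrow> complex\<close>, the
  tensor product of the \<open>W s\<close> is realised as a space of functions of the tuple \<open>(x s)\<close>,
  \<open>s \<in> S\<close>; for \<open>S = {}\<close> these are the constants. The group acts diagonally: \<open>tensor_act\<close> is
  unique on \<open>tensor_space\<close>, because the pure tensors span it.\<close>

definition pure_tensor :: "'s set \<Rightarrow> ('s \<Rightarrow> 'b \<Rightarrow> complex) \<Rightarrow> ('s \<Rightarrow> 'b) \<Rightarrow> complex"
  where "pure_tensor S t = (\<lambda>x. \<Prod>s\<in>S. t s (x s))"

definition tensor_space :: "'s set \<Rightarrow> ('s \<Rightarrow> ('b \<Rightarrow> complex) set) \<Rightarrow> (('s \<Rightarrow> 'b) \<Rightarrow> complex) set"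
  where "tensor_space S W = cfun.span (pure_tensor S ` (\<Pi>\<^sub>E s\<in>S. W s))"

definition tensor_act ::
  "'s set \<Rightarrow> ('s \<Rightarrow> ('b \<Rightarrow> complex) set) \<Rightarrow> ('g \<Rightarrow> ('b \<Rightarrow> complex) \<Rightarrow> ('b \<Rightarrow> complex)) \<Rightarrow>
    'g \<Rightarrow> (('s \<Rightarrow> 'b) \<Rightarrow> complex) \<Rightarrow> (('s \<Rightarrow> 'b) \<Rightarrow> complex)"
  where "tensor_act S W act g =
    (SOME L. Vector_Spaces.linear fscale fscale L \<and>
      (\<forall>t\<in>(\<Pi>\<^sub>E s\<in>S. W s). L (pure_tensor S t) = pure_tensor S (\<lambda>s. act g (t s))))"

definition induced_character :: "('g, 'm) monoid_scheme \<Rightarrow> 'g set \<Rightarrow> ('g \<Rightarrow> complex) \<Rightarrow> 'g \<Rightarrow> complex"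
  where "induced_character G H \<chi> g =
    (\<Sum>x\<in>{x \<in> carrier G. x \<otimes>\<^bsub>G\<^esub> g \<otimes>\<^bsub>G\<^esub> inv\<^bsub>G\<^esub> x \<in> H}. \<chi> (x \<otimes>\<^bsub>G\<^esub> g \<otimes>\<^bsub>G\<^esub> inv\<^bsub>G\<^esub> x)) / of_nat (card H)"

section \<open>The groups\<close>

datatype classical_type = TypeB | TypeC | TypeD

definition dimN :: "classical_type \<Rightarrow> nat \<Rightarrow> nat"
  where "dimN T n = (if T = TypeB then 2 * n + 1 else 2 * n)"

definition ntilde :: "classical_type \<Rightarrow> nat \<Rightarrow> nat"
  where "ntilde T n = (if T = TypeB then n + 1 else n)"

definition bar :: "classical_type \<Rightarrow> nat \<Rightarrow> nat \<Rightarrow> nat"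
  where "bar T n i = dimN T n + 1 - i"

text \<open>Rows and columns are numbered \<open>1, ..., N\<close>, whereas library matrices are indexed from \<open>0\<close>.\<close>

definition ent :: "'a mat \<Rightarrow> nat \<Rightarrow> nat \<Rightarrow> 'a"
  where "ent M i j = M $$ (i - 1, j - 1)"

definition mat_of :: "nat \<Rightarrow> (nat \<Rightarrow> nat \<Rightarrow> 'a) \<Rightarrow> 'a mat"
  where "mat_of N f = mat N N (\<lambda>(k, l). f (k + 1) (l + 1))"

definition eunit :: "nat \<Rightarrow> nat \<Rightarrow> nat \<Rightarrow> 'a::zero_neq_one mat"
  where "eunit N i j = mat_of N (\<lambda>k l. if k = i \<and> l = j then 1 else 0)"

definition GL :: "nat \<Rightarrow> 'a::field mat monoid"
  where "GL N = units_of (ring_mat TYPE('a) N ())"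

definition form_mat :: "classical_type \<Rightarrow> nat \<Rightarrow> 'a::field mat"
  where "form_mat T n = mat_of (dimN T n) (\<lambda>i j.
    if j = bar T n i then (if i \<le> n then 1 else if T = TypeC then - 1 else 1) else 0)"

definition isometries :: "classical_type \<Rightarrow> nat \<Rightarrow> 'a::field mat set"
  where "isometries T n =
    {g \<in> carrier (GL (dimN T n)). transpose_mat g * form_mat T n * g = form_mat T n}"

definition unitriangular :: "classical_type \<Rightarrow> nat \<Rightarrow> 'a::field mat set"
  where "unitriangular T n =
    {u \<in> carrier_mat (dimN T n) (dimN T n). upper_triangular u \<and> (\<forall>i<dimN T n. u $$ (i, i) = 1)}"

definition Utilde_grp :: "classical_type \<Rightarrow> nat \<Rightarrow> 'a::field mat monoid"
  where "Utilde_grp T n = GL (dimN T n) \<lparr>carrier := unitriangular T n\<rparr>"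

definition Ugrp :: "classical_type \<Rightarrow> nat \<Rightarrow> 'a::field mat monoid"
  where "Ugrp T n = GL (dimN T n) \<lparr>carrier := isometries T n \<inter> unitriangular T n\<rparr>"

section \<open>The monomial action\<close>

definition Pos :: "classical_type \<Rightarrow> nat \<Rightarrow> (nat \<times> nat) set"
  where "Pos T n = {(i, j). 1 \<le> i \<and> i < j \<and> (if T = TypeC then j \<le> bar T n i else j < bar T n i)}"

definition Vsp :: "classical_type \<Rightarrow> nat \<Rightarrow> 'a::field mat set"
  where "Vsp T n = {A \<in> carrier_mat (dimN T n) (dimN T n).
    \<forall>i\<in>{1..dimN T n}. \<forall>j\<in>{1..dimN T n}. (i, j) \<notin> Pos T n \<longrightarrow> ent A i j = 0}"

definition proj_V :: "classical_type \<Rightarrow> nat \<Rightarrow> 'a::field mat \<Rightarrow> 'a mat"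
  where "proj_V T n A = mat_of (dimN T n) (\<lambda>i j. if (i, j) \<in> Pos T n then ent A i j else 0)"

definition mat_trace :: "'a::comm_monoid_add mat \<Rightarrow> 'a"
  where "mat_trace M = (\<Sum>i<dim_row M. M $$ (i, i))"

definition kappa :: "'a::field mat \<Rightarrow> 'a mat \<Rightarrow> 'a"
  where "kappa A B = mat_trace (transpose_mat A * B)"

definition nontrivial_linear_character :: "('a::field \<Rightarrow> complex) \<Rightarrow> bool"
  where "nontrivial_linear_character \<theta> \<longleftrightarrow>
    (\<forall>x. \<theta> x \<noteq> 0) \<and> (\<forall>x y. \<theta> (x + y) = \<theta> x * \<theta> y) \<and> (\<exists>x. \<theta> x \<noteq> 1)"

text \<open>\<open>chr T n \<theta> A\<close> is the character \<open>[A]\<close> of \<open>V\<close>. Functions on \<open>V\<close> are extended by \<open>0\<close> to the type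
  of all matrices, so that the functions on \<open>V\<close> form a subspace. As \<open>\<theta>\<close> is nontrivial,
  \<open>[A]\<close> determines \<open>A \<in> V\<close>; sets and families of characters are therefore indexed by \<open>A \<in> V\<close> where
  convenient.\<close>

definition chr :: "classical_type \<Rightarrow> nat \<Rightarrow> ('a::field \<Rightarrow> complex) \<Rightarrow> 'a mat \<Rightarrow> 'a mat \<Rightarrow> complex"
  where "chr T n \<theta> A = (\<lambda>B. if B \<in> Vsp T n then \<theta> (- kappa A B) else 0)"

definition Vhat :: "classical_type \<Rightarrow> nat \<Rightarrow> ('a::field \<Rightarrow> complex) \<Rightarrow> ('a mat \<Rightarrow> complex) set"
  where "Vhat T n \<theta> = chr T n \<theta> ` Vsp T n"

definition dot_act :: "classical_type \<Rightarrow> nat \<Rightarrow> 'a::field mat \<Rightarrow> 'a mat \<Rightarrow> 'a mat"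
  where "dot_act T n A u = proj_V T n (A * transpose_mat (inv\<^bsub>GL (dimN T n)\<^esub> u))"

text \<open>The linear extension to the span of \<open>Vhat\<close> of
  \<open>[A] u = \<theta> (- \<kappa> (A, u\<^sup>-\<^sup>1)) [A].u\<close>.\<close>

definition mact :: "classical_type \<Rightarrow> nat \<Rightarrow> ('a::field \<Rightarrow> complex) \<Rightarrow> 'a mat \<Rightarrow>
    ('a mat \<Rightarrow> complex) \<Rightarrow> ('a mat \<Rightarrow> complex)"
  where "mact T n \<theta> u f =
    (\<Sum>A\<in>Vsp T n. fscale (cfun.representation (Vhat T n \<theta>) f (chr T n \<theta> A))
      (fscale (\<theta> (- kappa A (inv\<^bsub>GL (dimN T n)\<^esub> u))) (chr T n \<theta> (dot_act T n A u))))"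

definition U_orbit :: "classical_type \<Rightarrow> nat \<Rightarrow> ('a::field \<Rightarrow> complex) \<Rightarrow> 'a mat \<Rightarrow> ('a mat \<Rightarrow> complex) set"
  where "U_orbit T n \<theta> A = {chr T n \<theta> (dot_act T n A u) |u. u \<in> carrier (Ugrp T n)}"

definition Ut_orbit :: "classical_type \<Rightarrow> nat \<Rightarrow> ('a::field \<Rightarrow> complex) \<Rightarrow> 'a mat \<Rightarrow> ('a mat \<Rightarrow> complex) set"
  where "Ut_orbit T n \<theta> A = {chr T n \<theta> (dot_act T n A u) |u. u \<in> carrier (Utilde_grp T n)}"

definition U_orbit_module ::
    "classical_type \<Rightarrow> nat \<Rightarrow> ('a::field \<Rightarrow> complex) \<Rightarrow> 'a mat \<Rightarrow> ('a mat \<Rightarrow> complex) set"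
  where "U_orbit_module T n \<theta> A = cfun.span (U_orbit T n \<theta> A)"

definition Ut_orbit_module ::
    "classical_type \<Rightarrow> nat \<Rightarrow> ('a::field \<Rightarrow> complex) \<Rightarrow> 'a mat \<Rightarrow> ('a mat \<Rightarrow> complex) set"
  where "Ut_orbit_module T n \<theta> A = cfun.span (Ut_orbit T n \<theta> A)"

section \<open>Andre-Neto supercharacters\<close>

definition root_elem :: "classical_type \<Rightarrow> nat \<Rightarrow> nat \<Rightarrow> nat \<Rightarrow> 'a::field \<Rightarrow> 'a mat"
  where "root_elem T n i j \<alpha> =
    (let N = dimN T n; i' = bar T n i; j' = bar T n j in
     case T of
       TypeB \<Rightarrow>
         if j \<noteq> n + 1 then 1\<^sub>m N + \<alpha> \<cdot>\<^sub>m eunit N i j - \<alpha> \<cdot>\<^sub>m eunit N j' i'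
         else 1\<^sub>m N + \<alpha> \<cdot>\<^sub>m eunit N i (n + 1) - \<alpha> \<cdot>\<^sub>m eunit N (n + 1) i'
              - (1 / 2 * \<alpha>\<^sup>2) \<cdot>\<^sub>m eunit N i i'
     | TypeC \<Rightarrow>
         if j \<le> n then 1\<^sub>m N + \<alpha> \<cdot>\<^sub>m eunit N i j - \<alpha> \<cdot>\<^sub>m eunit N j' i'
         else if j < i' then 1\<^sub>m N + \<alpha> \<cdot>\<^sub>m eunit N i j + \<alpha> \<cdot>\<^sub>m eunit N j' i'
         else 1\<^sub>m N + \<alpha> \<cdot>\<^sub>m eunit N i i'
     | TypeD \<Rightarrow> 1\<^sub>m N + \<alpha> \<cdot>\<^sub>m eunit N i j - \<alpha> \<cdot>\<^sub>m eunit N j' i')"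

definition root_subgroup :: "classical_type \<Rightarrow> nat \<Rightarrow> nat \<times> nat \<Rightarrow> 'a::field mat set"
  where "root_subgroup T n = (\<lambda>(i, j). range (root_elem T n i j))"

definition varrho_set :: "classical_type \<Rightarrow> nat \<Rightarrow> nat \<times> nat \<Rightarrow> (nat \<times> nat) set"
  where "varrho_set T n = (\<lambda>(i, j).
    if j \<le> ntilde T n then {(i, k) |k. (i, k) \<in> Pos T n \<and> i < k \<and> k < j}
    else {(i, k) |k. (i, k) \<in> Pos T n \<and> i < k \<and> k \<le> n} \<union>
      {(bar T n j, l) |l. (bar T n j, l) \<in> Pos T n \<and> bar T n j < l \<and> l \<le> ntilde T n})"

definition U_sub :: "classical_type \<Rightarrow> nat \<Rightarrow> nat \<times> nat \<Rightarrow> 'a::field mat set"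
  where "U_sub T n ij = generate (Ugrp T n) (\<Union>ab\<in>Pos T n - varrho_set T n ij. root_subgroup T n ab)"

definition elementary_character ::
    "classical_type \<Rightarrow> nat \<Rightarrow> ('a::field \<Rightarrow> complex) \<Rightarrow> nat \<times> nat \<Rightarrow> 'a \<Rightarrow> 'a mat \<Rightarrow> complex"
  where "elementary_character T n \<theta> ij \<alpha> =
    induced_character (Ugrp T n) (U_sub T n ij) (\<lambda>u. \<theta> (\<alpha> * ent u (fst ij) (snd ij)))"

definition basic_set :: "classical_type \<Rightarrow> nat \<Rightarrow> (nat \<times> nat) set \<Rightarrow> bool"
  where "basic_set T n D \<longleftrightarrow>
    D \<subseteq> {(i, j). 1 \<le> i \<and> i < j \<and> j \<le> dimN T n} \<and>
    (\<forall>i\<in>{1..dimN T n}. \<forall>j\<in>{1..dimN T n}. (i, j) \<in> D \<longleftrightarrow> (bar T n j, bar T n i) \<in> D) \<and>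
    inj_on fst D \<and> inj_on snd D"

definition supercharacter :: "classical_type \<Rightarrow> nat \<Rightarrow> ('a::field \<Rightarrow> complex) \<Rightarrow> (nat \<times> nat) set \<Rightarrow>
    (nat \<times> nat \<Rightarrow> 'a) \<Rightarrow> 'a mat \<Rightarrow> complex"
  where "supercharacter T n \<theta> D \<Phi> u = (\<Prod>ij\<in>D \<inter> Pos T n. elementary_character T n \<theta> ij (\<Phi> ij) u)"

definition A_of :: "classical_type \<Rightarrow> nat \<Rightarrow> (nat \<times> nat) set \<Rightarrow> (nat \<times> nat \<Rightarrow> 'a::field) \<Rightarrow> 'a mat"
  where "A_of T n D \<Phi> = mat_of (dimN T n) (\<lambda>i j. if (i, j) \<in> D \<inter> Pos T n then \<Phi> (i, j) else 0)"

section \<open>Verge, core and main separated characters\<close>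

text \<open>The predicates and sets below are attached to \<open>[A]\<close> for \<open>A \<in> V\<close>, but are formulated in terms
  of \<open>A\<close>.\<close>

definition main_conds :: "classical_type \<Rightarrow> nat \<Rightarrow> 'a::field mat \<Rightarrow> (nat \<times> nat) set"
  where "main_conds T n A = {(i, j) \<in> Pos T n. ent A i j \<noteq> 0 \<and> (\<forall>k. j < k \<and> k \<le> dimN T n \<longrightarrow> ent A i k = 0)}"

definition staircase :: "classical_type \<Rightarrow> nat \<Rightarrow> 'a::field mat \<Rightarrow> bool"
  where "staircase T n A \<longleftrightarrow> A \<in> Vsp T n \<and> inj_on snd (main_conds T n A)"

text \<open>In type C, this contains the diagonal position \<open>(i, i)\<close> if \<open>(i, bar i)\<close> is a main condition.\<close>

definition minor_conds :: "classical_type \<Rightarrow> nat \<Rightarrow> 'a::field mat \<Rightarrow> (nat \<times> nat) set"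
  where "minor_conds T n A = {(i, bar T n j) |i j. (i, j) \<in> main_conds T n A \<and> j > ntilde T n}"

definition supp_conds :: "classical_type \<Rightarrow> nat \<Rightarrow> 'a::field mat \<Rightarrow> (nat \<times> nat) set"
  where "supp_conds T n A = {(i, j) \<in> Pos T n. j \<le> ntilde T n \<and>
    (\<exists>k>j. (i, k) \<in> minor_conds T n A \<or> ((i, k) \<in> main_conds T n A \<and> k \<le> ntilde T n)) \<and>
    (\<exists>k. (k, j) \<in> minor_conds T n A) \<and>
    (i, j) \<notin> minor_conds T n A \<and> (i, j) \<notin> main_conds T n A}"

definition core_conds :: "classical_type \<Rightarrow> nat \<Rightarrow> 'a::field mat \<Rightarrow> (nat \<times> nat) set"
  where "core_conds T n A = (if T = TypeC then main_conds T n A \<union> supp_conds T n A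
    else main_conds T n A \<union> minor_conds T n A \<union> supp_conds T n A)"

definition verge :: "classical_type \<Rightarrow> nat \<Rightarrow> 'a::field mat \<Rightarrow> 'a mat"
  where "verge T n A = mat_of (dimN T n) (\<lambda>i j. if (i, j) \<in> main_conds T n A then ent A i j else 0)"

definition verge_character :: "classical_type \<Rightarrow> nat \<Rightarrow> 'a::field mat \<Rightarrow> bool"
  where "verge_character T n A \<longleftrightarrow> A \<in> Vsp T n \<and> A = verge T n A"

definition core_character :: "classical_type \<Rightarrow> nat \<Rightarrow> 'a::field mat \<Rightarrow> bool"
  where "core_character T n A \<longleftrightarrow> staircase T n A \<and>
    {(i, j). i \<in> {1..dimN T n} \<and> j \<in> {1..dimN T n} \<and> ent A i j \<noteq> 0} \<subseteq> core_conds T n A"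

definition verge_module ::
    "classical_type \<Rightarrow> nat \<Rightarrow> ('a::field \<Rightarrow> complex) \<Rightarrow> 'a mat \<Rightarrow> ('a mat \<Rightarrow> complex) set"
  where "verge_module T n \<theta> A = cfun.span (chr T n \<theta> ` {B \<in> Vsp T n. verge T n B = verge T n A})"

definition arm_set :: "classical_type \<Rightarrow> nat \<Rightarrow> nat \<times> nat \<Rightarrow> (nat \<times> nat) set"
  where "arm_set T n = (\<lambda>(i, j).
    if j < bar T n i then {(bar T n j, a) |a. (bar T n j, a) \<in> Pos T n}
    else {(i, a) |a. i < a \<and> a < bar T n i})"

definition leg_set :: "classical_type \<Rightarrow> nat \<Rightarrow> nat \<times> nat \<Rightarrow> (nat \<times> nat) set"
  where "leg_set T n = (\<lambda>(i, j). {(a, j) |a. (a, j) \<in> Pos T n \<and> a > i})"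

definition limb_set :: "classical_type \<Rightarrow> nat \<Rightarrow> 'a::field mat \<Rightarrow> (nat \<times> nat) set"
  where "limb_set T n A = (\<Union>ij\<in>main_conds T n A. leg_set T n ij \<union> arm_set T n ij)"

definition main_separated :: "classical_type \<Rightarrow> nat \<Rightarrow> 'a::field mat \<Rightarrow> bool"
  where "main_separated T n A \<longleftrightarrow> A \<in> Vsp T n \<and> limb_set T n A \<inter> main_conds T n A = {}"

end

theory Submission
  imports Defs "Jordan_Normal_Form.Determinant"
begin

text \<open>
  The span of the characters of \<open>V\<close> is a space of functions on \<open>V\<close> on which \<open>u\<close> acts by composition
  with \<open>x \<mapsto> \<pi> ((1 + x) u\<^sup>-\<^sup>1)\<close>. A row of \<open>B\<close> with main condition \<open>(i, c)\<close> is, up to a scalar, a vector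
  in \<open>e\<^sub>c + \<langle>e\<^sub>1, \<dots>, e\<^sub>c\<^sub>-\<^sub>1\<rangle>\<close> modulo \<open>\<langle>e\<^sub>1, \<dots>, e\<^sub>i\<rangle>\<close>, multiplied by \<open>u\<^sup>-\<^sup>1\<close> under the action. Hence the
  orbit of \<open>A\<close> under the full unitriangular group consists of all \<open>[B]\<close> with verge \<open>A\<close>. By a Witt
  extension lemma adapted to the flag, the orbits of the isometries are separated by those values of the
  bilinear form on pairs of rows which are well defined modulo these subspaces, and the core
  characters realise each system of values exactly once.

  For the supercharacter, the basis of characters is replaced by functions that are delta functions in
  the columns up to \<open>n\<close> (left of the main condition) and characters in the remaining columns. The group
  still permutes them up to scalars, row by row. In a single row, the stabiliser of the multiple of the
  main matrix unit is the subgroup from which the elementary character is induced, with the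
  inducing character as scalar. So the trace on the functions all of whose rows lie in the orbits of these
  units is the product of the elementary characters. Those orbits are everything unless some main
  condition is \<open>(i, bar i)\<close>.
\<close>

section \<open>Independent families and monomial modules\<close>

text \<open>The characters themselves do not show the elementary characters. By
  \<open>ginv_mirror\<close>, the stabiliser of a multiple of \<open>eunit N i j\<close> under
  \<open>dot_act\<close> is cut out by conditions on row \<open>br j\<close> of \<open>u\<close>
  alone, while \<open>varrho_set\<close> also asks for zeros in row \<open>i\<close>. Delta
  functions in the columns up to \<open>cut j\<close> move exactly these conditions to row
  \<open>i\<close>. For a right main condition \<open>varrho_set\<close> is made of a piece in row
  \<open>i\<close> and a piece in row \<open>br j\<close>; for \<open>j = br i\<close> the two
  pieces lie in the same row and overlap, so a row orbit can be too small and only a summand is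
  obtained. The actions on labels involve projections and truncations. Their composition laws are
  therefore not computed: functions are moved by plain composition (\<open>translate\<close>), and
  the laws for labels and scalars follow from linear independence. Independence of the new basis is
  in turn a matter of counting. Division by two enters where the norm of a vector is prescribed.
  Such a norm is recorded by a minor condition of types B and D; in type C the form is alternating
  and there is nothing to record.\<close>

lemma fscale_apply: "fscale c f x = c * f x"
  by (simp add: fscale_def)

lemma sum_fun_apply: "(\<Sum>i\<in>I. f i) x = (\<Sum>i\<in>I. f i x)" for f :: "'i \<Rightarrow> 'b \<Rightarrow> complex"
  by (induction I rule: infinite_finite_induct) auto

lemma right_moduleD:
  assumes "right_module G W act"
  shows "cfun.subspace W"
    and "\<And>g w. g \<in> carrier G \<Longrightarrow> w \<in> W \<Longrightarrow> act g w \<in> W"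
    and "\<And>g v w. g \<in> carrier G \<Longrightarrow> v \<in> W \<Longrightarrow> w \<in> W \<Longrightarrow> act g (v + w) = act g v + act g w"
    and "\<And>g c w. g \<in> carrier G \<Longrightarrow> w \<in> W \<Longrightarrow> act g (fscale c w) = fscale c (act g w)"
  using assms unfolding right_module_def by blast+

text \<open>\<open>act g\<close> is additive only on \<open>W\<close>, so partial sums have to be
  kept inside \<open>W\<close>; the value at 0, needed for the empty sum, comes from scaling by
  0.\<close>

lemma right_module_act_sum:
  assumes M: "right_module G W act" and g: "g \<in> carrier G" and v: "\<And>i. i \<in> I \<Longrightarrow> v i \<in> W"
  shows "act g (\<Sum>i\<in>I. fscale (c i) (v i)) = (\<Sum>i\<in>I. fscale (c i) (act g (v i)))"
proof -
  have zero: "act g 0 = 0"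
    using right_moduleD(4)[OF M g cfun.subspace_0[OF right_moduleD(1)[OF M]], of 0]
    unfolding cfun.scale_zero_left .
  show ?thesis using v
proof (induction I rule: infinite_finite_induct)
  case empty
  show ?case unfolding sum.empty by (rule zero)
next
  case (infinite I)
  show ?case unfolding sum.infinite[OF infinite(1)] by (rule zero)
next
  case (insert i I)
  have s: "cfun.subspace W" by (rule right_moduleD(1)[OF M])
  have "(\<Sum>i\<in>I. fscale (c i) (v i)) \<in> W"
    by (rule cfun.subspace_sum[OF s]) (use insert in \<open>auto intro: cfun.subspace_scale[OF s]\<close>)
  moreover have "fscale (c i) (v i) \<in> W" using insert by (auto intro: cfun.subspace_scale[OF s])
  ultimately have "act g (fscale (c i) (v i) + (\<Sum>i\<in>I. fscale (c i) (v i)))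
      = fscale (c i) (act g (v i)) + (\<Sum>i\<in>I. fscale (c i) (act g (v i)))"
    using insert by (subst right_moduleD(3)[OF M g]) (auto simp: right_moduleD(4)[OF M g])
  then show ?case unfolding sum.insert[OF insert(1,2)] .
qed
qed

section \<open>Bases and the trace\<close>

lemma is_basisD:
  assumes "is_basis B W"
  shows "B \<subseteq> W" "cfun.independent B" "cfun.span B = W"
  using assms unfolding is_basis_def by auto

lemma finite_basis:
  assumes "is_basis B W" "is_basis C W" "finite C"
  shows "finite B"
  using cfun.independent_span_bound[OF assms(3) is_basisD(2)[OF assms(1)]]
    is_basisD[OF assms(1)] is_basisD[OF assms(2)] by auto

text \<open>\<open>module_character\<close> chooses its basis by \<open>SOME\<close>, so a
  computation in a convenient basis needs invariance of the trace. Expanding each basis in the other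
  turns both sides into the same double sum of products of coordinates.\<close>

lemma trace_basis_independent:
  assumes M: "right_module G W act" and g: "g \<in> carrier G"
    and B: "is_basis B W" "finite B" and C: "is_basis C W" "finite C"
  shows "(\<Sum>b\<in>B. cfun.representation B (act g b) b) = (\<Sum>v\<in>C. cfun.representation C (act g v) v)"
proof -
  let ?rB = "cfun.representation B" and ?rC = "cfun.representation C"
  note B' = is_basisD[OF B(1)] and C' = is_basisD[OF C(1)]
  have eB: "(\<Sum>b\<in>B. fscale (?rB v b) b) = v" if "v \<in> W" for v
    by (rule cfun.sum_representation_eq) (use that B B' in auto)
  have eC: "(\<Sum>b\<in>C. fscale (?rC v b) b) = v" if "v \<in> W" for v
    by (rule cfun.sum_representation_eq) (use that C C' in auto)
  have actW: "act g v \<in> W" if "v \<in> W" for v using right_moduleD(2)[OF M g that] .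
  have "(\<Sum>b\<in>B. ?rB (act g b) b) = (\<Sum>b\<in>B. \<Sum>v\<in>C. ?rC b v * ?rB (act g v) b)"
  proof (rule sum.cong[OF refl])
    fix b assume b: "b \<in> B"
    then have "act g b = act g (\<Sum>v\<in>C. fscale (?rC b v) v)" using eC[of b] B' by auto
    also have "\<dots> = (\<Sum>v\<in>C. fscale (?rC b v) (act g v))"
      by (rule right_module_act_sum[OF M g]) (use C' in auto)
    finally have "?rB (act g b) = (\<lambda>b'. \<Sum>v\<in>C. ?rB (fscale (?rC b v) (act g v)) b')"
      using actW C'(1) B'(2,3)
      by (subst cfun.representation_sum[symmetric]) (auto intro!: cfun.span_scale)
    then show "?rB (act g b) b = (\<Sum>v\<in>C. ?rC b v * ?rB (act g v) b)"
      using actW C'(1) B'(2,3) by (simp add: cfun.representation_scale subset_eq)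
  qed
  also have "\<dots> = (\<Sum>v\<in>C. \<Sum>b\<in>B. ?rB (act g v) b * ?rC b v)"
    by (subst sum.swap) (simp add: mult.commute)
  also have "\<dots> = (\<Sum>v\<in>C. ?rC (act g v) v)"
  proof (rule sum.cong[OF refl])
    fix v assume v: "v \<in> C"
    then have "?rC (act g v) = ?rC (\<Sum>b\<in>B. fscale (?rB (act g v) b) b)"
      using eB[of "act g v"] actW C' by auto
    also have "\<dots> = (\<lambda>v'. \<Sum>b\<in>B. ?rC (fscale (?rB (act g v) b) b) v')"
      by (rule cfun.representation_sum) (use B' C' in \<open>auto intro: cfun.span_scale\<close>)
    finally show "(\<Sum>b\<in>B. ?rB (act g v) b * ?rC b v) = ?rC (act g v) v"
      using B' C' by (simp add: cfun.representation_scale subset_eq)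
  qed
  finally show ?thesis .
qed

text \<open>Stated for families instead of sets, so that injectivity is part of it and labels can be
  compared in place of functions.\<close>

definition indep_family :: "('i \<Rightarrow> 'b \<Rightarrow> complex) \<Rightarrow> 'i set \<Rightarrow> bool"
  where "indep_family f I \<longleftrightarrow> finite I \<and>
    (\<forall>c. (\<Sum>i\<in>I. fscale (c i) (f i)) = 0 \<longrightarrow> (\<forall>i\<in>I. c i = 0))"

lemma indep_familyD: "indep_family f I \<Longrightarrow> (\<Sum>i\<in>I. fscale (c i) (f i)) = 0 \<Longrightarrow> i \<in> I \<Longrightarrow> c i = 0"
  unfolding indep_family_def by blast

lemma indep_family_finite: "indep_family f I \<Longrightarrow> finite I"
  unfolding indep_family_def by blast

lemma indep_family_inj: 
  assumes "indep_family f I" shows "inj_on f I"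
proof (rule inj_onI, rule ccontr)
  fix i j assume ij: "i \<in> I" "j \<in> I" "f i = f j" "i \<noteq> j"
  let ?c = "\<lambda>k. if k = i then 1 else if k = j then -1 else (0::complex)"
  have "(\<Sum>k\<in>I. fscale (?c k) (f k)) = (\<Sum>k\<in>{i,j}. fscale (?c k) (f k))"
    by (rule sum.mono_neutral_right)
      (use ij indep_family_finite[OF assms] in auto)
  also have "\<dots> = 0" using ij by (auto simp: fun_eq_iff fscale_apply)
  finally show False using indep_familyD[OF assms _ ij(1), of ?c] by simp
qed

lemma indep_family_independent:
  assumes "indep_family f I" shows "cfun.independent (f ` I)"
proof (rule cfun.independent_if_scalars_zero)
  show "finite (f ` I)" using indep_family_finite[OF assms] by simp
  fix c x assume c: "(\<Sum>x\<in>f ` I. fscale (c x) x) = 0" and x: "x \<in> f ` I"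
  have "(\<Sum>i\<in>I. fscale (c (f i)) (f i)) = 0"
    using c by (simp add: sum.reindex[OF indep_family_inj[OF assms]])
  with x show "c x = 0" using indep_familyD[OF assms, of "\<lambda>i. c (f i)"] by auto
qed

lemma indep_familyI:
  assumes "finite I" "inj_on f I" "cfun.independent (f ` I)"
  shows "indep_family f I"
  unfolding indep_family_def
proof (intro conjI allI impI ballI)
  fix c i assume z: "(\<Sum>i\<in>I. fscale (c i) (f i)) = 0" and i: "i \<in> I"
  let ?u = "\<lambda>v. c (inv_into I f v)"
  have "(\<Sum>v\<in>f ` I. fscale (?u v) v) = (\<Sum>i\<in>I. fscale (c i) (f i))"
    using assms(2) by (simp add: sum.reindex)
  with z have "?u (f i) = 0"
    using cfun.independentD[OF assms(3) _ subset_refl, of ?u "f i"] assms(1) i by simp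
  with i assms(2) show "c i = 0" by simp
qed (fact assms(1))

lemma span_family:
  assumes "finite I"
  shows "w \<in> cfun.span (f ` I) \<longleftrightarrow> (\<exists>c. w = (\<Sum>i\<in>I. fscale (c i) (f i)))"
proof
  assume "w \<in> cfun.span (f ` I)"
  then show "\<exists>c. w = (\<Sum>i\<in>I. fscale (c i) (f i))"
  proof (induction rule: cfun.span_induct_alt)
    case base
    then show ?case by (intro exI[of _ "\<lambda>_. 0"]) simp
  next
    case (step c x y)
    then obtain i d where i: "i \<in> I" "x = f i" and d: "y = (\<Sum>i\<in>I. fscale (d i) (f i))" by blast
    have "fscale c x + y = (\<Sum>k\<in>I. fscale ((if k = i then c else 0) + d k) (f k))"
      using assms i
      by (auto simp: fun_eq_iff fscale_apply sum_fun_apply d distrib_right sum.distrib if_distrib[of "\<lambda>z. z * _"]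
          cong: if_cong)
    then show "\<exists>e. fscale c x + y = (\<Sum>i\<in>I. fscale (e i) (f i))"
      by (intro exI[of _ "\<lambda>k. (if k = i then c else 0) + d k"])
  qed
next
  assume "\<exists>c. w = (\<Sum>i\<in>I. fscale (c i) (f i))"
  then show "w \<in> cfun.span (f ` I)"
    by (elim exE ssubst) (intro cfun.span_sum cfun.span_scale cfun.span_base imageI)
qed

text \<open>The device by which composition laws for labels and scalars are deduced from an identity
  between functions.\<close>

lemma indep_family_scaled_eq:
  assumes f: "indep_family f I" "i \<in> I" "j \<in> I" and e: "fscale a (f i) = fscale b (f j)" and a: "a \<noteq> 0"
  shows "i = j \<and> a = b"
proof -
  let ?c = "\<lambda>b i j. (\<lambda>k. (if k = i then a else 0) - (if k = j then b else 0))"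
  have "(\<Sum>k\<in>I. fscale (?c b i j k) (f k)) = fscale a (f i) - fscale b (f j)"
    using f(2,3) indep_family_finite[OF f(1)]
    by (auto simp: fun_eq_iff fscale_apply sum_fun_apply left_diff_distrib sum_subtractf if_distrib[of "\<lambda>z. z * _"] cong: if_cong)
  then have z: "?c b i j k = 0" if "k \<in> I" for k using indep_familyD[OF f(1) _ that, of "?c b i j"] e by simp
  have "i = j" using z[OF f(2)] a by (auto split: if_splits)
  then show ?thesis using z[OF f(2)] by simp
qed

lemma indep_family_subset:
  assumes "indep_family f I" "J \<subseteq> I" shows "indep_family f J"
proof (rule indep_familyI)
  show "finite J" using indep_family_finite[OF assms(1)] assms(2) by (rule finite_subset[rotated])
  show "inj_on f J" by (rule inj_on_subset[OF indep_family_inj[OF assms(1)] assms(2)])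
  show "cfun.independent (f ` J)"
    by (rule cfun.independent_mono[OF indep_family_independent[OF assms(1)] image_mono[OF assms(2)]])
qed

text \<open>Dimension count: the span of \<open>f\<close> contains \<open>card J\<close> independent
  vectors, so its \<open>card I = card J\<close> generators can neither coincide nor be dependent.
  This spares the inverse of a change of basis.\<close>

lemma indep_family_of_span:
  assumes g: "indep_family g J" and I: "finite I" "card I = card J"
    and gf: "\<And>j. j \<in> J \<Longrightarrow> g j \<in> cfun.span (f ` I)"
  shows "indep_family f I" and "cfun.span (f ` I) = cfun.span (g ` J)"
proof -
  have gi: "cfun.independent (g ` J)" by (rule indep_family_independent[OF g])
  have cg: "card (g ` J) = card J" by (rule card_image[OF indep_family_inj[OF g]])
  have bound: "card (g ` J) \<le> card T" if "finite T" "cfun.span T = cfun.span (f ` I)" for T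
    using cfun.independent_span_bound[OF that(1) gi] gf that(2) by auto
  have "card I \<le> card (f ` I)" using bound[of "f ` I"] I cg by simp
  then have inj: "inj_on f I" using I card_image_le[OF I(1), of f] by (simp add: eq_card_imp_inj_on)
  have "cfun.independent (f ` I)"
  proof
    assume "cfun.dependent (f ` I)"
    then obtain a where a: "a \<in> f ` I" "a \<in> cfun.span (f ` I - {a})"
      unfolding cfun.dependent_def by blast
    then have "cfun.span (f ` I - {a}) = cfun.span (f ` I)"
      using cfun.span_redundant[OF a(2)] by (simp add: insert_absorb)
    then have "card (g ` J) \<le> card (f ` I - {a})" using bound I by simp
    with a I cg card_image[OF inj] show False
      by (metis card_Diff1_less finite_imageI not_le)
  qed
  with I inj show "indep_family f I" by (intro indep_familyI)
  have "f ` I \<subseteq> cfun.span (g ` J)"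
  proof
    fix x assume x: "x \<in> f ` I"
    show "x \<in> cfun.span (g ` J)"
    proof (rule ccontr)
      \<comment> \<open>A generator outside the span of \<open>g\<close> would yield
        \<open>card J + 1\<close> independent vectors in a space spanned by \<open>card J\<close>
        vectors.\<close>
      assume nx: "x \<notin> cfun.span (g ` J)"
      then have "cfun.independent (insert x (g ` J))" using gi by (rule cfun.independent_insertI)
      moreover have "insert x (g ` J) \<subseteq> cfun.span (f ` I)" using x gf by (auto intro: cfun.span_base)
      ultimately have "card (insert x (g ` J)) \<le> card (f ` I)"
        using cfun.independent_span_bound[of "f ` I"] I by blast
      moreover have "x \<notin> g ` J" using nx cfun.span_base by blast
      ultimately show False using cg I card_image[OF inj] indep_family_finite[OF g] by simp
    qed
  qed
  then show "cfun.span (f ` I) = cfun.span (g ` J)" using gf by (auto simp: cfun.span_eq)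
qed

lemma family_basis: "indep_family f I \<Longrightarrow> is_basis (f ` I) (cfun.span (f ` I))"
  unfolding is_basis_def using indep_family_independent cfun.span_superset by blast

text \<open>Only basis vectors that are sent to multiples of themselves contribute to the
  diagonal.\<close>

lemma module_character_monomial:
  assumes M: "right_module G W act" and g: "g \<in> carrier G"
    and f: "indep_family f I" "W = cfun.span (f ` I)"
    and mono: "\<And>i. i \<in> I \<Longrightarrow> t i \<in> I \<and> act g (f i) = fscale (c i) (f (t i))"
  shows "module_character W act g = (\<Sum>i\<in>{i\<in>I. t i = i}. c i)"
proof -
  define B where "B = (SOME B. is_basis B W)"
  have C: "is_basis (f ` I) W" using family_basis[OF f(1)] f(2) by simp
  then have B: "is_basis B W" unfolding B_def by (rule someI)
  have finC: "finite (f ` I)" using indep_family_finite[OF f(1)] by simp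
  note inj = indep_family_inj[OF f(1)]
  have "module_character W act g = (\<Sum>b\<in>B. cfun.representation B (act g b) b)"
    unfolding module_character_def Let_def B_def ..
  also have "\<dots> = (\<Sum>v\<in>f ` I. cfun.representation (f ` I) (act g v) v)"
    by (rule trace_basis_independent[OF M g B finite_basis[OF B C finC] C finC])
  also have "\<dots> = (\<Sum>i\<in>I. cfun.representation (f ` I) (act g (f i)) (f i))"
    by (simp add: sum.reindex[OF inj])
  also have "\<dots> = (\<Sum>i\<in>I. if t i = i then c i else 0)"
  proof (rule sum.cong[OF refl])
    fix i assume i: "i \<in> I"
    then have ti: "t i \<in> I" "act g (f i) = fscale (c i) (f (t i))" using mono by auto
    have "cfun.representation (f ` I) (act g (f i)) (f i)
      = c i * (if f i = f (t i) then 1 else 0)"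
      using ti indep_family_independent[OF f(1)]
      by (simp add: cfun.representation_scale cfun.span_base cfun.representation_basis)
    then show "cfun.representation (f ` I) (act g (f i)) (f i) = (if t i = i then c i else 0)"
      using inj_onD[OF inj, of i "t i"] i ti by auto
  qed
  also have "\<dots> = (\<Sum>i\<in>{i\<in>I. t i = i}. c i)"
    using indep_family_finite[OF f(1)] by (simp add: sum.If_cases Int_def)
  finally show ?thesis .
qed

section \<open>Direct sums of spans of subfamilies\<close>

lemma span_Int_disjoint:
  assumes f: "indep_family f I" and "J \<subseteq> I" "K \<subseteq> I" "J \<inter> K = {}"
  shows "cfun.span (f ` J) \<inter> cfun.span (f ` K) = {0}"
proof -
  have fin: "finite I" "finite J" "finite K" using indep_family_finite[OF f] assms finite_subset by auto
  have "w = 0" if w: "w \<in> cfun.span (f ` J)" "w \<in> cfun.span (f ` K)" for w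
  proof -
    from w fin obtain c d where c: "w = (\<Sum>i\<in>J. fscale (c i) (f i))" "w = (\<Sum>i\<in>K. fscale (d i) (f i))"
      unfolding span_family[OF fin(2)] span_family[OF fin(3)] by blast
    let ?e = "\<lambda>i. if i \<in> J then c i else - d i"
    have "(\<Sum>i\<in>J\<union>K. fscale (?e i) (f i)) = (\<Sum>i\<in>J. fscale (?e i) (f i)) + (\<Sum>i\<in>K. fscale (?e i) (f i))"
      using fin assms by (simp add: sum.union_disjoint)
    also have "(\<Sum>i\<in>K. fscale (?e i) (f i)) = (\<Sum>i\<in>K. - fscale (d i) (f i))"
      using assms by (intro sum.cong) (auto simp: fun_eq_iff)
    finally have "(\<Sum>i\<in>J\<union>K. fscale (?e i) (f i)) = 0"
      using c by (simp only: sum_negf if_True right_minus cong: sum.cong)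
    then have c0: "\<forall>i\<in>J. c i = 0"
      using indep_familyD[OF indep_family_subset[OF f, of "J\<union>K"], of ?e] assms by fastforce
    show "w = 0" unfolding c(1) by (intro sum.neutral ballI) (simp only: c0 cfun.scale_zero_left)
  qed
  then show ?thesis by (auto simp: cfun.span_zero)
qed

lemma direct_summand_span:
  assumes f: "indep_family f I" and J: "J \<subseteq> I"
    and M: "right_module G (cfun.span (f ` J)) act" "right_module G (cfun.span (f ` (I - J))) act"
  shows "direct_summand G (cfun.span (f ` J)) (cfun.span (f ` I)) act"
  unfolding direct_summand_def
proof (intro conjI exI)
  show "cfun.span (f ` I) = {v + w |v w. v \<in> cfun.span (f ` J) \<and> w \<in> cfun.span (f ` (I - J))}"
    using J cfun.span_Un[of "f ` J" "f ` (I - J)"] by (simp add: Un_absorb1 flip: image_Un)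
  show "cfun.span (f ` J) \<inter> cfun.span (f ` (I - J)) = {0}"
    using J by (intro span_Int_disjoint[OF f]) auto
qed (use M in auto)

lemma direct_sum_span:
  assumes f: "indep_family f I" and K: "finite K"
    and J: "\<And>k. k \<in> K \<Longrightarrow> J k \<subseteq> I" "I \<subseteq> (\<Union>k\<in>K. J k)" "disjoint_family_on J K"
    and M: "right_module G (cfun.span (f ` I)) act"
      "\<And>k. k \<in> K \<Longrightarrow> right_module G (cfun.span (f ` J k)) act"
  shows "direct_sum_decomposition G (cfun.span (f ` I)) act K (\<lambda>k. cfun.span (f ` J k))"
  unfolding direct_sum_decomposition_def
proof (intro conjI ballI)
  have finI: "finite I" by (rule indep_family_finite[OF f])
  have finJ: "finite (J k)" if "k \<in> K" for k using J(1)[OF that] finI finite_subset by auto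
  have sumI: "(\<Sum>k\<in>K. \<Sum>i\<in>J k. h i) = (\<Sum>i\<in>I. h i)" for h :: "_ \<Rightarrow> _ \<Rightarrow> complex"
  proof -
    have "I = (\<Union>k\<in>K. J k)" using J by auto
    then show ?thesis
      using sum.UNION_disjoint[OF K, of J h] finJ J(3) by (simp add: disjoint_family_on_def)
  qed
  fix w assume "w \<in> cfun.span (f ` I)"
  then obtain c where c: "w = (\<Sum>i\<in>I. fscale (c i) (f i))" using span_family[OF finI] by blast
  \<comment> \<open>\<open>undefined\<close> outside \<open>K\<close> is forced by the extensional
    function space in which the components are unique.\<close>
  let ?C = "\<lambda>k. if k \<in> K then \<Sum>i\<in>J k. fscale (c i) (f i) else undefined"
  show "\<exists>!c. c \<in> (\<Pi>\<^sub>E k\<in>K. cfun.span (f ` J k)) \<and> w = (\<Sum>k\<in>K. c k)"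
  proof (rule ex1I[of _ ?C])
    show "?C \<in> (\<Pi>\<^sub>E k\<in>K. cfun.span (f ` J k)) \<and> w = (\<Sum>k\<in>K. ?C k)"
    proof (intro conjI PiE_I)
      show "w = (\<Sum>k\<in>K. ?C k)" using c by (simp add: sumI)
      fix k assume "k \<in> K"
      then show "?C k \<in> cfun.span (f ` J k)"
        unfolding if_P[OF \<open>k \<in> K\<close>] by (intro cfun.span_sum cfun.span_scale cfun.span_base imageI)
    qed simp
    fix d assume d: "d \<in> (\<Pi>\<^sub>E k\<in>K. cfun.span (f ` J k)) \<and> w = (\<Sum>k\<in>K. d k)"
    then have "\<forall>k\<in>K. \<exists>e. d k = (\<Sum>i\<in>J k. fscale (e i) (f i))"
      using finJ by (auto simp: PiE_iff span_family)
    then obtain e where e: "\<And>k. k \<in> K \<Longrightarrow> d k = (\<Sum>i\<in>J k. fscale (e k i) (f i))" by metis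
    \<comment> \<open>The components of a competing decomposition are merged into one coefficient
      function on \<open>I\<close>; disjointness of the \<open>J k\<close> makes the description
      unique.\<close>
    define E where "E i = e (THE k. k \<in> K \<and> i \<in> J k) i" for i
    have E: "E i = e k i" if "k \<in> K" "i \<in> J k" for k i
    proof -
      have "(THE k. k \<in> K \<and> i \<in> J k) = k"
        using that J(3) by (intro the_equality) (auto simp: disjoint_family_on_def)
      then show ?thesis by (simp add: E_def)
    qed
    have "w = (\<Sum>k\<in>K. \<Sum>i\<in>J k. fscale (E i) (f i))" using d by (simp add: e E)
    then have "w = (\<Sum>i\<in>I. fscale (E i) (f i))" by (simp add: sumI)
    then have "(\<Sum>i\<in>I. fscale (c i - E i) (f i)) = 0"
      unfolding c by (simp add: cfun.scale_left_diff_distrib sum_subtractf)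
    then have ce: "c i = E i" if "i \<in> I" for i
      using indep_familyD[OF f, of "\<lambda>i. c i - E i"] that by simp
    show "d = ?C"
    proof
      fix k show "d k = ?C k"
      proof (cases "k \<in> K")
        case True
        then have "d k = (\<Sum>i\<in>J k. fscale (E i) (f i))" by (simp add: e E)
        also have "\<dots> = (\<Sum>i\<in>J k. fscale (c i) (f i))"
          using J(1)[OF True] ce by (intro sum.cong) auto
        finally show ?thesis using True by simp
      qed (use d in \<open>auto simp: PiE_iff extensional_def\<close>)
    qed
  qed
next
  fix k assume "k \<in> K"
  then show "cfun.span (f ` J k) \<subseteq> cfun.span (f ` I)" by (intro cfun.span_mono image_mono J(1))
qed (use K M in auto)

text \<open>\<open>act\<close> is controlled on the span only. Replacing it there by globally linear
  maps \<open>L g\<close> allows every axiom to be checked on generators and extended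
  linearly.\<close>

lemma right_module_spanI:
  assumes lin: "\<And>g. g \<in> carrier G \<Longrightarrow> Vector_Spaces.linear fscale fscale (L g :: ('b \<Rightarrow> complex) \<Rightarrow> _)"
    and act: "\<And>g w. g \<in> carrier G \<Longrightarrow> w \<in> cfun.span X \<Longrightarrow> act g w = L g w"
    and G: "Group.monoid G"
    and gen: "\<And>g x. g \<in> carrier G \<Longrightarrow> x \<in> X \<Longrightarrow> L g x \<in> cfun.span X"
    and one: "\<And>x. x \<in> X \<Longrightarrow> L \<one>\<^bsub>G\<^esub> x = x"
    and mult: "\<And>g h x. g \<in> carrier G \<Longrightarrow> h \<in> carrier G \<Longrightarrow> x \<in> X \<Longrightarrow> L (g \<otimes>\<^bsub>G\<^esub> h) x = L h (L g x)"
  shows "right_module G (cfun.span X) act"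
proof -
  interpret G: monoid G by (rule G)
  interpret vp: vector_space_pair "fscale :: complex \<Rightarrow> ('b \<Rightarrow> complex) \<Rightarrow> _" "fscale :: complex \<Rightarrow> ('b \<Rightarrow> complex) \<Rightarrow> _"
    by (intro vector_space_pair.intro cfun.vector_space_axioms)
  have closed: "L g w \<in> cfun.span X" if "g \<in> carrier G" "w \<in> cfun.span X" for g w
    using that(2)
  proof (induction rule: cfun.span_induct_alt)
    case base
    show ?case unfolding vp.linear_0[OF lin[OF that(1)]] by (rule cfun.span_zero)
  next
    case (step c x y)
    show ?case
      unfolding vp.linear_add[OF lin[OF that(1)]] vp.linear_scale[OF lin[OF that(1)]]
      by (intro cfun.span_add cfun.span_scale gen[OF that(1)] step)
  qed
  have "L \<one>\<^bsub>G\<^esub> w = w" if "w \<in> cfun.span X" for w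
    using vp.linear_eq_on[OF lin cfun.linear_id that, of "\<one>\<^bsub>G\<^esub>"] one by simp
  moreover have "L (g \<otimes>\<^bsub>G\<^esub> h) w = L h (L g w)"
    if "g \<in> carrier G" "h \<in> carrier G" "w \<in> cfun.span X" for g h w
  proof -
    have "Vector_Spaces.linear fscale fscale (L h \<circ> L g)"
      by (rule Vector_Spaces.linear_compose[OF lin[OF that(1)] lin[OF that(2)]])
    then show ?thesis
      using vp.linear_eq_on[OF lin _ that(3), of "g \<otimes>\<^bsub>G\<^esub> h" "L h \<circ> L g"] mult that by simp
  qed
  ultimately show ?thesis
    unfolding right_module_def
    using act closed vp.linear_add[OF lin] vp.linear_scale[OF lin]
    by (simp add: cfun.span_add cfun.span_scale)
qed

text \<open>A transitive monomial right action affords an induced character: \<open>t\<close> moves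
  the labels and \<open>c\<close> is the multiplier with its cocycle law. A point
  \<open>t x w0\<close> fixed by \<open>g\<close> contributes the value of the inducing character at
  x g x^-1, and every point arises from \<open>card H\<close> elements \<open>x\<close>, which
  cancels the denominator.\<close>

lemma induced_character_orbit:
  assumes G: "Group.group G" "finite (carrier G)"
    and g: "g \<in> carrier G" and w0: "w0 \<in> I"
    and t: "\<And>x i. x \<in> carrier G \<Longrightarrow> i \<in> I \<Longrightarrow> t x i \<in> I"
    and tm: "\<And>x y i. x \<in> carrier G \<Longrightarrow> y \<in> carrier G \<Longrightarrow> i \<in> I \<Longrightarrow> t (x \<otimes>\<^bsub>G\<^esub> y) i = t y (t x i)"
    and t1: "\<And>i. i \<in> I \<Longrightarrow> t \<one>\<^bsub>G\<^esub> i = i"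
    and cm: "\<And>x y i. x \<in> carrier G \<Longrightarrow> y \<in> carrier G \<Longrightarrow> i \<in> I \<Longrightarrow> c (x \<otimes>\<^bsub>G\<^esub> y) i = c x i * c y (t x i)"
    and c1: "\<And>i. i \<in> I \<Longrightarrow> c \<one>\<^bsub>G\<^esub> i = (1::complex)"
    and H: "H = {h \<in> carrier G. t h w0 = w0}"
    and chi: "\<And>h. h \<in> H \<Longrightarrow> \<chi> h = c h w0"
  shows "(\<Sum>i\<in>{i \<in> (\<lambda>x. t x w0) ` carrier G. t g i = i}. c g i) = induced_character G H \<chi> g"
proof -
  interpret G: Group.group G by (rule G(1))
  let ?O = "(\<lambda>x. t x w0) ` carrier G"
  \<comment> \<open>In a right action x g x^-1 first moves \<open>w0\<close> to
    \<open>t x w0\<close>, then applies \<open>g\<close>, then moves back; the multipliers of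
    \<open>x\<close> and of its inverse cancel.\<close>
  have cnj: "(x \<otimes>\<^bsub>G\<^esub> g \<otimes>\<^bsub>G\<^esub> inv\<^bsub>G\<^esub> x \<in> H) = (t g (t x w0) = t x w0)"
    "t g (t x w0) = t x w0 \<Longrightarrow> c (x \<otimes>\<^bsub>G\<^esub> g \<otimes>\<^bsub>G\<^esub> inv\<^bsub>G\<^esub> x) w0 = c g (t x w0)"
    if x: "x \<in> carrier G" for x
  proof -
    have undo: "t (inv\<^bsub>G\<^esub> x) (t x i) = i" if "i \<in> I" for i
      using tm[OF x _ that, of "inv\<^bsub>G\<^esub> x"] x t1 that by simp
    have redo: "t x (t (inv\<^bsub>G\<^esub> x) i) = i" if "i \<in> I" for i
      using tm[OF _ x that, of "inv\<^bsub>G\<^esub> x"] x t1 that by simp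
    have e: "t (x \<otimes>\<^bsub>G\<^esub> g \<otimes>\<^bsub>G\<^esub> inv\<^bsub>G\<^esub> x) w0 = t (inv\<^bsub>G\<^esub> x) (t g (t x w0))"
      using x g w0 t by (simp add: tm)
    show "(x \<otimes>\<^bsub>G\<^esub> g \<otimes>\<^bsub>G\<^esub> inv\<^bsub>G\<^esub> x \<in> H) = (t g (t x w0) = t x w0)"
      using e x g w0 undo[OF w0] redo[of "t g (t x w0)"] t unfolding H by (auto simp del: G.inv_closed)
    assume fixed: "t g (t x w0) = t x w0"
    have "c x w0 * c (inv\<^bsub>G\<^esub> x) (t x w0) = 1"
      using cm[OF x _ w0, of "inv\<^bsub>G\<^esub> x"] x c1 w0 by simp
    then show "c (x \<otimes>\<^bsub>G\<^esub> g \<otimes>\<^bsub>G\<^esub> inv\<^bsub>G\<^esub> x) w0 = c g (t x w0)"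
      using x g w0 t fixed by (simp add: cm tm mult_ac)
  qed
  have HG: "H \<subseteq> carrier G" unfolding H by auto
  have "finite H" using HG G(2) finite_subset by auto
  moreover have "\<one>\<^bsub>G\<^esub> \<in> H" unfolding H using t1 w0 by simp
  ultimately have cH: "card H \<noteq> 0" by auto
  have fiber: "card {x \<in> carrier G. t x w0 = i} = card H" if i: "i \<in> ?O" for i
  proof -
    from i obtain y where y: "y \<in> carrier G" "i = t y w0" by auto
    have yinv: "t (inv\<^bsub>G\<^esub> y) i = w0" using tm[OF y(1) _ w0, of "inv\<^bsub>G\<^esub> y"] y t1 w0 by simp
    have "bij_betw (\<lambda>h. h \<otimes>\<^bsub>G\<^esub> y) H {x \<in> carrier G. t x w0 = i}"
    proof (rule bij_betwI[where g = "\<lambda>x. x \<otimes>\<^bsub>G\<^esub> inv\<^bsub>G\<^esub> y"])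
      show "(\<lambda>h. h \<otimes>\<^bsub>G\<^esub> y) \<in> H \<rightarrow> {x \<in> carrier G. t x w0 = i}"
        using y w0 by (auto simp: H tm)
      show "(\<lambda>x. x \<otimes>\<^bsub>G\<^esub> inv\<^bsub>G\<^esub> y) \<in> {x \<in> carrier G. t x w0 = i} \<rightarrow> H"
        using y w0 yinv by (auto simp: H tm)
    qed (use y HG in \<open>auto simp: G.m_assoc subset_eq\<close>)
    then show ?thesis by (simp add: bij_betw_same_card)
  qed
  have "(\<Sum>x\<in>{x \<in> carrier G. x \<otimes>\<^bsub>G\<^esub> g \<otimes>\<^bsub>G\<^esub> inv\<^bsub>G\<^esub> x \<in> H}. \<chi> (x \<otimes>\<^bsub>G\<^esub> g \<otimes>\<^bsub>G\<^esub> inv\<^bsub>G\<^esub> x))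
    = (\<Sum>x\<in>{x \<in> carrier G. t g (t x w0) = t x w0}. c g (t x w0))"
    by (rule sum.cong) (use cnj chi in auto)
  also have "\<dots> = (\<Sum>i\<in>{i \<in> ?O. t g i = i}. \<Sum>x\<in>{x \<in> {x \<in> carrier G. t g (t x w0) = t x w0}. t x w0 = i}. c g (t x w0))"
    by (rule sum.group[symmetric]) (use G(2) in auto)
  also have "\<dots> = (\<Sum>i\<in>{i \<in> ?O. t g i = i}. of_nat (card H) * c g i)"
  proof (rule sum.cong[OF refl])
    fix i assume i: "i \<in> {i \<in> ?O. t g i = i}"
    then have "{x \<in> {x \<in> carrier G. t g (t x w0) = t x w0}. t x w0 = i} = {x \<in> carrier G. t x w0 = i}"
      by auto
    then have "(\<Sum>x\<in>{x \<in> {x \<in> carrier G. t g (t x w0) = t x w0}. t x w0 = i}. c g (t x w0))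
      = (\<Sum>x\<in>{x \<in> carrier G. t x w0 = i}. c g i)" by simp
    then show "(\<Sum>x\<in>{x \<in> {x \<in> carrier G. t g (t x w0) = t x w0}. t x w0 = i}. c g (t x w0)) = of_nat (card H) * c g i"
      using fiber i by simp
  qed
  also have "\<dots> = of_nat (card H) * (\<Sum>i\<in>{i \<in> ?O. t g i = i}. c g i)" by (simp add: sum_distrib_left)
  finally show ?thesis unfolding induced_character_def using cH by simp
qed

section \<open>Matrices, positions and the groups\<close>

lemma sum_head: "i \<le> m \<Longrightarrow> (\<Sum>k\<in>{i..m}. f k) = f i + (\<Sum>k\<in>{i<..m}. f k)" for f :: "nat \<Rightarrow> 'b::comm_monoid_add"
proof -
  assume "i \<le> m"
  then have "{i..m} = insert i {i<..m}" by auto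
  then show ?thesis by simp
qed

lemma bar_bar: "i \<in> {1..dimN T n} \<Longrightarrow> bar T n (bar T n i) = i"
  by (auto simp: bar_def)

lemma bar_range: "i \<in> {1..dimN T n} \<Longrightarrow> bar T n i \<in> {1..dimN T n}"
  by (auto simp: bar_def)

lemma PosD: "(i, j) \<in> Pos T n \<Longrightarrow> 1 \<le> i \<and> i < j \<and> j \<le> bar T n i \<and> j \<le> dimN T n"
  by (auto simp: Pos_def bar_def split: if_splits)

lemma Pos_range:
  assumes "(i, j) \<in> Pos T n" shows "i \<in> {1..dimN T n}" "j \<in> {1..dimN T n}"
  using PosD[OF assms] by auto

lemma not_Pos: "j \<le> i \<Longrightarrow> (i, j) \<notin> Pos T n"
  using PosD[of i j] by auto

lemma Pos_left: "(i, j) \<in> Pos T n \<Longrightarrow> i < k \<Longrightarrow> k \<le> j \<Longrightarrow> (i, k) \<in> Pos T n"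
  by (auto simp: Pos_def split: if_splits)

lemma finite_Pos: "finite (Pos T n)"
  by (rule finite_subset[of _ "{1..dimN T n} \<times> {1..dimN T n}"]) (use Pos_range in auto)

section \<open>Matrix entries and the trace form\<close>

lemma ent_mat_of: "i \<in> {1..N} \<Longrightarrow> j \<in> {1..N} \<Longrightarrow> ent (mat_of N f) i j = f i j"
  by (auto simp: ent_def mat_of_def)

lemma mat_of_carrier [simp]: "mat_of N f \<in> carrier_mat N N"
  by (simp add: mat_of_def)

lemma ent_eqI:
  assumes "A \<in> carrier_mat N N" "B \<in> carrier_mat N N"
    and "\<And>i j. i \<in> {1..N} \<Longrightarrow> j \<in> {1..N} \<Longrightarrow> ent A i j = ent B i j"
  shows "A = B"
proof (rule eq_matI)
  fix i j assume "i < dim_row B" "j < dim_col B"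
  then show "A $$ (i, j) = B $$ (i, j)" using assms(3)[of "Suc i" "Suc j"] assms(1,2) by (auto simp: ent_def)
qed (use assms in auto)

lemma ent_mult:
  assumes "A \<in> carrier_mat N N" "B \<in> carrier_mat N N" "i \<in> {1..N}" "j \<in> {1..N}"
  shows "ent (A * B) i j = (\<Sum>k=1..N. ent A i k * ent B k j)"
proof -
  have "ent (A * B) i j = (\<Sum>k=0..<N. A $$ (i - 1, k) * B $$ (k, j - 1))"
    using assms by (auto simp: ent_def scalar_prod_def)
  also have "\<dots> = (\<Sum>k=1..N. ent A i k * ent B k j)"
    by (rule sum.reindex_bij_witness[of _ "\<lambda>k. k - 1" Suc]) (auto simp: ent_def)
  finally show ?thesis .
qed

lemma ent_transpose: "A \<in> carrier_mat N N \<Longrightarrow> i \<in> {1..N} \<Longrightarrow> j \<in> {1..N} \<Longrightarrow> ent (transpose_mat A) i j = ent A j i"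
  by (auto simp: ent_def)

lemma ent_one: "i \<in> {1..N} \<Longrightarrow> j \<in> {1..N} \<Longrightarrow> ent (1\<^sub>m N) i j = (if i = j then 1 else 0)"
  by (auto simp: ent_def)

lemma ent_add: "A \<in> carrier_mat N N \<Longrightarrow> B \<in> carrier_mat N N \<Longrightarrow> i \<in> {1..N} \<Longrightarrow> j \<in> {1..N} \<Longrightarrow> ent (A + B) i j = ent A i j + ent B i j"
  by (auto simp: ent_def)

lemma ent_minus: "A \<in> carrier_mat N N \<Longrightarrow> B \<in> carrier_mat N N \<Longrightarrow> i \<in> {1..N} \<Longrightarrow> j \<in> {1..N} \<Longrightarrow> ent (A - B) i j = ent A i j - ent B i j"
  by (auto simp: ent_def)

lemma ent_smult: "A \<in> carrier_mat N N \<Longrightarrow> i \<in> {1..N} \<Longrightarrow> j \<in> {1..N} \<Longrightarrow> ent (c \<cdot>\<^sub>m A) i j = c * ent A i j"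
  by (auto simp: ent_def)

lemma ent_eunit: "k \<in> {1..N} \<Longrightarrow> l \<in> {1..N} \<Longrightarrow> ent (eunit N i j) k l = (if k = i \<and> l = j then 1 else 0)"
  by (simp add: eunit_def ent_mat_of)

lemma eunit_carrier [simp]: "eunit N i j \<in> carrier_mat N N"
  by (simp add: eunit_def)

lemma kappa_eq:
  assumes "A \<in> carrier_mat N N" "B \<in> carrier_mat N N"
  shows "kappa A B = (\<Sum>i=1..N. \<Sum>j=1..N. ent A i j * ent B i j)"
proof -
  have "kappa A B = (\<Sum>j=0..<N. (transpose_mat A * B) $$ (j, j))"
    using assms by (simp add: kappa_def mat_trace_def atLeast0LessThan)
  also have "\<dots> = (\<Sum>j=1..N. ent (transpose_mat A * B) j j)"
    by (rule sum.reindex_bij_witness[of _ "\<lambda>k. k - 1" Suc]) (auto simp: ent_def)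
  also have "\<dots> = (\<Sum>j=1..N. \<Sum>i=1..N. ent A i j * ent B i j)"
    using assms by (intro sum.cong refl) (simp add: ent_mult[of _ N] ent_transpose[of _ N])
  finally show ?thesis by (subst sum.swap)
qed

lemma finite_mats: "finite (carrier_mat N N :: 'a::finite mat set)"
proof (rule finite_subset)
  show "carrier_mat N N \<subseteq> (\<lambda>f. mat_of N (\<lambda>i j. f (i, j))) ` (({1..N} \<times> {1..N}) \<rightarrow>\<^sub>E (UNIV::'a set))"
  proof
    fix A :: "'a mat" assume A: "A \<in> carrier_mat N N"
    let ?f = "restrict (\<lambda>(i, j). ent A i j) ({1..N} \<times> {1..N})"
    have "A = mat_of N (\<lambda>i j. ?f (i, j))" by (rule ent_eqI[OF A]) (auto simp: ent_mat_of)
    then show "A \<in> (\<lambda>f. mat_of N (\<lambda>i j. f (i, j))) ` (({1..N} \<times> {1..N}) \<rightarrow>\<^sub>E (UNIV::'a set))"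
      by (intro image_eqI[of _ _ ?f]) auto
  qed
qed (intro finite_imageI finite_PiE; simp)

lemma VspD:
  assumes "A \<in> Vsp T n"
  shows "A \<in> carrier_mat (dimN T n) (dimN T n)"
    and "\<And>i j. i \<in> {1..dimN T n} \<Longrightarrow> j \<in> {1..dimN T n} \<Longrightarrow> (i, j) \<notin> Pos T n \<Longrightarrow> ent A i j = 0"
  using assms unfolding Vsp_def by auto

lemma finite_Vsp: "finite (Vsp T n :: 'a::{field,finite} mat set)"
  by (rule finite_subset[OF _ finite_mats[of "dimN T n"]]) (auto simp: Vsp_def)

lemma Vsp_eqI:
  assumes "A \<in> Vsp T n" "B \<in> Vsp T n" "\<And>i j. (i, j) \<in> Pos T n \<Longrightarrow> ent A i j = ent B i j"
  shows "A = B"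
proof (rule ent_eqI[OF VspD(1)[OF assms(1)] VspD(1)[OF assms(2)]])
  fix i j assume ij: "i \<in> {1..dimN T n}" "j \<in> {1..dimN T n}"
  show "ent A i j = ent B i j"
  proof (cases "(i, j) \<in> Pos T n")
    case False
    then show ?thesis using VspD(2)[OF assms(1) ij] VspD(2)[OF assms(2) ij] by simp
  qed (rule assms(3))
qed

lemma proj_V_Vsp [simp]: "proj_V T n A \<in> Vsp T n"
  by (auto simp: Vsp_def proj_V_def ent_mat_of)

lemma ent_proj_V: "(i, j) \<in> Pos T n \<Longrightarrow> ent (proj_V T n A) i j = ent A i j"
  unfolding proj_V_def by (subst ent_mat_of[OF Pos_range]) auto

lemma proj_V_id: "A \<in> Vsp T n \<Longrightarrow> proj_V T n A = A"
  by (rule Vsp_eqI) (auto simp: ent_proj_V)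

lemma sum_Pos:
  assumes "A \<in> Vsp T n"
  shows "(\<Sum>i=1..dimN T n. \<Sum>j=1..dimN T n. ent A i j * f i j) = (\<Sum>(i, j)\<in>Pos T n. ent A i j * f i j)"
proof -
  have "(\<Sum>i=1..dimN T n. \<Sum>j=1..dimN T n. ent A i j * f i j)
      = (\<Sum>(i, j)\<in>{1..dimN T n} \<times> {1..dimN T n}. ent A i j * f i j)"
    by (rule sum.cartesian_product)
  also have "\<dots> = (\<Sum>(i, j)\<in>Pos T n. ent A i j * f i j)"
    by (rule sum.mono_neutral_right) (use VspD(2)[OF assms] Pos_range in \<open>auto simp del: atLeastAtMost_iff\<close>)
  finally show ?thesis .
qed

lemma kappa_Pos:
  assumes "A \<in> Vsp T n" "B \<in> carrier_mat (dimN T n) (dimN T n)"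
  shows "kappa A B = (\<Sum>(i, j)\<in>Pos T n. ent A i j * ent B i j)"
  unfolding kappa_eq[OF VspD(1)[OF assms(1)] assms(2)] by (rule sum_Pos[OF assms(1)])

lemma kappa_proj:
  assumes "A \<in> Vsp T n" "B \<in> carrier_mat (dimN T n) (dimN T n)"
  shows "kappa A (proj_V T n B) = kappa A B"
  unfolding kappa_Pos[OF assms] kappa_Pos[OF assms(1) VspD(1)[OF proj_V_Vsp]]
  by (intro sum.cong refl) (auto simp: ent_proj_V)

lemma kappa_sym:
  assumes "A \<in> carrier_mat N N" "B \<in> carrier_mat N N"
  shows "kappa A B = kappa B A"
  unfolding kappa_eq[OF assms] kappa_eq[OF assms(2,1)] by (simp add: mult.commute)

section \<open>Unitriangular matrices and isometries\<close>

lemma unitriangularI: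
  assumes "u \<in> carrier_mat (dimN T n) (dimN T n)"
    and "\<And>i j. i \<in> {1..dimN T n} \<Longrightarrow> j \<in> {1..dimN T n} \<Longrightarrow> j < i \<Longrightarrow> ent u i j = 0"
    and "\<And>i. i \<in> {1..dimN T n} \<Longrightarrow> ent u i i = 1"
  shows "u \<in> unitriangular T n"
  unfolding unitriangular_def upper_triangular_def
  using assms(1) assms(2)[of "Suc _" "Suc _"] assms(3)[of "Suc _"] by (auto simp: ent_def)

lemma unitriangularD:
  assumes "u \<in> unitriangular T n"
  shows "u \<in> carrier_mat (dimN T n) (dimN T n)"
    and "\<And>i j. i \<in> {1..dimN T n} \<Longrightarrow> j \<in> {1..dimN T n} \<Longrightarrow> j < i \<Longrightarrow> ent u i j = 0"
    and "\<And>i. i \<in> {1..dimN T n} \<Longrightarrow> ent u i i = 1"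
  using assms unfolding unitriangular_def upper_triangular_def by (auto simp: ent_def)

lemma unitriangular_mult:
  assumes u: "u \<in> unitriangular T n" and v: "v \<in> unitriangular T n"
  shows "u * v \<in> unitriangular T n"
proof (rule unitriangularI)
  note U = unitriangularD[OF u] and V = unitriangularD[OF v]
  show "u * v \<in> carrier_mat (dimN T n) (dimN T n)" using U(1) V(1) by simp
  fix i assume i: "i \<in> {1..dimN T n}"
  { fix j assume j: "j \<in> {1..dimN T n}" "j < i"
    have "ent u i k * ent v k j = 0" if k: "k \<in> {1..dimN T n}" for k
      using U(2)[OF i k] V(2)[OF k j(1)] j(2) by (cases "k < i") auto
    then show "ent (u * v) i j = 0" unfolding ent_mult[OF U(1) V(1) i j(1)] by (intro sum.neutral) simp }
  have "ent u i k * ent v k i = (if k = i then 1 else 0)" if k: "k \<in> {1..dimN T n}" for k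
    using U(2)[OF i k] V(2)[OF k i] U(3)[OF i] V(3)[OF i] by (cases "k < i"; cases "k = i") auto
  then have "ent (u * v) i i = (\<Sum>k=1..dimN T n. if k = i then 1 else 0)"
    unfolding ent_mult[OF U(1) V(1) i i] by (intro sum.cong) auto
  then show "ent (u * v) i i = 1" using i by simp
qed

lemma one_unitriangular: "1\<^sub>m (dimN T n) \<in> unitriangular T n"
  by (rule unitriangularI) (auto simp: ent_one)

lemma unitriangular_add_Vsp: "x \<in> Vsp T n \<Longrightarrow> 1\<^sub>m (dimN T n) + x \<in> unitriangular T n"
proof (rule unitriangularI)
  assume x: "x \<in> Vsp T n"
  note c = VspD(1)[OF x]
  show "1\<^sub>m (dimN T n) + x \<in> carrier_mat (dimN T n) (dimN T n)" using c by simp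
  have z: "ent x i j = 0" if "i \<in> {1..dimN T n}" "j \<in> {1..dimN T n}" "j \<le> i" for i j
    by (rule VspD(2)[OF x that(1,2) not_Pos[OF that(3)]])
  fix i assume i: "i \<in> {1..dimN T n}"
  show "ent (1\<^sub>m (dimN T n) + x) i i = 1"
    using ent_add[OF one_carrier_mat c i i] z[OF i i] i by (simp add: ent_one)
  fix j assume j: "j \<in> {1..dimN T n}" "j < i"
  show "ent (1\<^sub>m (dimN T n) + x) i j = 0"
    using ent_add[OF one_carrier_mat c i j(1)] z[OF i j(1)] i j by (simp add: ent_one)
qed

lemma GL_simps: "x \<otimes>\<^bsub>GL N\<^esub> y = x * y" "\<one>\<^bsub>GL N\<^esub> = 1\<^sub>m N"
  by (simp_all add: GL_def units_of_def ring_mat_def)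

lemma GL_carrier: "carrier (GL N) \<subseteq> carrier_mat N N"
  by (auto simp: GL_def units_of_def ring_mat_def Units_def)

lemma GL_group: "Group.group (GL N :: 'a::field mat monoid)"
proof -
  interpret ring "ring_mat TYPE('a) N ()" by (rule ring_mat)
  show ?thesis unfolding GL_def by (rule units_group)
qed

lemma unitriangular_GL: "(u :: 'a::field mat) \<in> unitriangular T n \<Longrightarrow> u \<in> carrier (GL (dimN T n))"
proof -
  assume u: "u \<in> unitriangular T n"
  then have c: "u \<in> carrier_mat (dimN T n) (dimN T n)" "upper_triangular u"
    and d: "\<And>i. i < dimN T n \<Longrightarrow> u $$ (i, i) = 1"
    unfolding unitriangular_def by auto
  have "det u = prod_list (diag_mat u)" by (rule det_upper_triangular[OF c(2,1)])
  also have "diag_mat u = replicate (dimN T n) 1"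
    using c(1) d by (intro nth_equalityI) (auto simp: diag_mat_def)
  finally have "det u \<noteq> 0" by simp
  from det_non_zero_imp_unit[OF c(1) this]
  show ?thesis by (simp add: GL_def units_of_carrier)
qed

text \<open>Left multiplication by \<open>x\<close> is injective, hence surjective on the finite
  set, and the preimage of the unit is the inverse. So inverses of isometries and of unitriangular
  matrices need no separate treatment.\<close>

lemma finite_subset_subgroup:
  assumes G: "Group.group G" and H: "finite H" "H \<subseteq> carrier G" "\<one>\<^bsub>G\<^esub> \<in> H"
    and mult: "\<And>x y. x \<in> H \<Longrightarrow> y \<in> H \<Longrightarrow> x \<otimes>\<^bsub>G\<^esub> y \<in> H"
  shows "subgroup H G"
proof -
  interpret Group.group G by (rule G)
  have inv: "inv\<^bsub>G\<^esub> x \<in> H" if x: "x \<in> H" for x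
  proof -
    have "inj_on (\<lambda>y. x \<otimes>\<^bsub>G\<^esub> y) H"
      by (rule inj_onI) (use x H(2) in \<open>auto simp: subset_eq\<close>)
    then have "(\<lambda>y. x \<otimes>\<^bsub>G\<^esub> y) ` H = H" by (intro endo_inj_surj[OF H(1)]) (use mult x in auto)
    then obtain y where y: "y \<in> H" "x \<otimes>\<^bsub>G\<^esub> y = \<one>\<^bsub>G\<^esub>" using H(3) by (metis imageE)
    then have "inv\<^bsub>G\<^esub> x = y" using x H(2) by (intro inv_equality) (auto simp: inv_comm subset_eq)
    then show ?thesis using y by simp
  qed
  show ?thesis by (rule subgroupI) (use H mult inv in auto)
qed

lemma finite_unitriangular: "finite (unitriangular T n :: 'a::{field,finite} mat set)"
  by (rule finite_subset[OF _ finite_mats[of "dimN T n"]]) (use unitriangularD(1) in blast)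

lemma unitriangular_subgroup: "subgroup (unitriangular T n :: 'a::{field,finite} mat set) (GL (dimN T n))"
proof (rule finite_subset_subgroup[OF GL_group])
  show "finite (unitriangular T n :: 'a mat set)" by (rule finite_unitriangular)
qed (use unitriangular_GL in \<open>auto simp: GL_simps unitriangular_mult one_unitriangular\<close>)

lemma isometries_mult:
  assumes g: "(g :: 'a::field mat) \<in> isometries T n" and h: "h \<in> isometries T n"
  shows "g * h \<in> isometries T n"
proof -
  interpret GL: Group.group "GL (dimN T n) :: 'a mat monoid" by (rule GL_group)
  let ?N = "dimN T n" and ?S = "form_mat T n :: 'a mat"
  have S: "?S \<in> carrier_mat ?N ?N" by (simp add: form_mat_def)
  from g h have c: "g \<in> carrier (GL ?N)" "h \<in> carrier (GL ?N)"
    and e: "transpose_mat g * ?S * g = ?S" "transpose_mat h * ?S * h = ?S" unfolding isometries_def by auto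
  then have m: "g \<in> carrier_mat ?N ?N" "h \<in> carrier_mat ?N ?N" using GL_carrier by auto
  have "transpose_mat (g * h) * ?S * (g * h) = transpose_mat h * (transpose_mat g * ?S * g) * h"
    using m S by (simp add: assoc_mult_mat[of _ ?N ?N _ ?N _ ?N] transpose_mult[of _ ?N ?N _ ?N])
  also have "\<dots> = ?S" using e by simp
  finally show ?thesis using GL.m_closed[OF c] by (simp add: isometries_def GL_simps)
qed

lemma one_isometries: "(1\<^sub>m (dimN T n) :: 'a::field mat) \<in> isometries T n"
proof -
  interpret GL: Group.group "GL (dimN T n) :: 'a mat monoid" by (rule GL_group)
  have "(form_mat T n :: 'a mat) \<in> carrier_mat (dimN T n) (dimN T n)" by (simp add: form_mat_def)
  then show ?thesis using GL.one_closed by (simp add: isometries_def GL_simps)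
qed

lemma isometries_unitriangular_subgroup:
  "subgroup (isometries T n \<inter> unitriangular T n :: 'a::{field,finite} mat set) (GL (dimN T n))"
proof (rule finite_subset_subgroup[OF GL_group])
  show "finite (isometries T n \<inter> unitriangular T n :: 'a mat set)" by (rule finite_Int[OF disjI2[OF finite_unitriangular]])
qed (use unitriangular_GL in \<open>auto simp: GL_simps unitriangular_mult one_unitriangular isometries_mult one_isometries\<close>)

lemma Utilde_simps:
  "carrier (Utilde_grp T n) = unitriangular T n"
  "x \<otimes>\<^bsub>Utilde_grp T n\<^esub> y = x * y" "\<one>\<^bsub>Utilde_grp T n\<^esub> = 1\<^sub>m (dimN T n)"
  using GL_simps by (auto simp: Utilde_grp_def)

lemma Ugrp_simps:
  "carrier (Ugrp T n) = isometries T n \<inter> unitriangular T n"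
  "x \<otimes>\<^bsub>Ugrp T n\<^esub> y = x * y" "\<one>\<^bsub>Ugrp T n\<^esub> = 1\<^sub>m (dimN T n)"
  using GL_simps by (auto simp: Ugrp_def)

lemma Utilde_group: "Group.group (Utilde_grp T n :: 'a::{field,finite} mat monoid)"
  unfolding Utilde_grp_def by (rule subgroup.subgroup_is_group[OF unitriangular_subgroup GL_group])

lemma Ugrp_group: "Group.group (Ugrp T n :: 'a::{field,finite} mat monoid)"
  unfolding Ugrp_def by (rule subgroup.subgroup_is_group[OF isometries_unitriangular_subgroup GL_group])

lemma Ugrp_finite: "finite (carrier (Ugrp T n :: 'a::{field,finite} mat monoid))"
  unfolding Ugrp_simps by (rule finite_Int[OF disjI2[OF finite_unitriangular]])

lemma Ugrp_subset: "carrier (Ugrp T n) \<subseteq> unitriangular T n"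
  by (simp add: Ugrp_simps)

lemma Ugrp_inv: "u \<in> carrier (Ugrp T n) \<Longrightarrow> inv\<^bsub>Ugrp T n\<^esub> u = inv\<^bsub>GL (dimN T n)\<^esub> (u :: 'a::{field,finite} mat)"
  unfolding Ugrp_def using Group.group.m_inv_consistent[OF GL_group isometries_unitriangular_subgroup, of u] by simp

lemma GL_inv_unitriangular:
  assumes "(u :: 'a::{field,finite} mat) \<in> unitriangular T n"
  shows "inv\<^bsub>GL (dimN T n)\<^esub> u \<in> unitriangular T n"
    and "u * inv\<^bsub>GL (dimN T n)\<^esub> u = 1\<^sub>m (dimN T n)" and "inv\<^bsub>GL (dimN T n)\<^esub> u * u = 1\<^sub>m (dimN T n)"
proof -
  interpret GL: Group.group "GL (dimN T n) :: 'a mat monoid" by (rule GL_group)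
  show "inv\<^bsub>GL (dimN T n)\<^esub> u \<in> unitriangular T n"
    by (rule subgroup.m_inv_closed[OF unitriangular_subgroup assms])
  show "u * inv\<^bsub>GL (dimN T n)\<^esub> u = 1\<^sub>m (dimN T n)" "inv\<^bsub>GL (dimN T n)\<^esub> u * u = 1\<^sub>m (dimN T n)"
    using GL.r_inv[OF unitriangular_GL[OF assms]] GL.l_inv[OF unitriangular_GL[OF assms]]
    by (simp_all add: GL_simps)
qed

lemma GL_inv_inv:
  assumes "(u :: 'a::{field,finite} mat) \<in> unitriangular T n"
  shows "inv\<^bsub>GL (dimN T n)\<^esub> (inv\<^bsub>GL (dimN T n)\<^esub> u) = u"
  by (rule Group.group.inv_inv[OF GL_group unitriangular_GL[OF assms]])

lemma Ugrp_inv_closed: "u \<in> carrier (Ugrp T n) \<Longrightarrow> inv\<^bsub>GL (dimN T n)\<^esub> (u :: 'a::{field,finite} mat) \<in> carrier (Ugrp T n)"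
  using Group.group.inv_closed[OF Ugrp_group, of u] Ugrp_inv[of u] by simp

section \<open>The monomial action as a translation of functions\<close>

locale monomial_setting =
  fixes T :: classical_type and n :: nat and \<theta> :: "'a::{field,finite} \<Rightarrow> complex"
  assumes nontrivial: "nontrivial_linear_character \<theta>"
begin

abbreviation "N \<equiv> dimN T n"
abbreviation "V \<equiv> Vsp T n :: 'a mat set"
abbreviation ginv :: "'a mat \<Rightarrow> 'a mat" where "ginv u \<equiv> inv\<^bsub>GL (dimN T n)\<^esub> u"

lemma theta_add: "\<theta> (x + y) = \<theta> x * \<theta> y"
  and theta_nonzero: "\<theta> x \<noteq> 0"
  using nontrivial unfolding nontrivial_linear_character_def by auto

lemma theta_zero: "\<theta> 0 = 1"
  using theta_add[of 0 0] theta_nonzero[of 0] by simp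

lemma theta_minus: "\<theta> (- x) * \<theta> x = 1" "\<theta> x * \<theta> (- x) = 1"
  using theta_add[of "- x" x] theta_add[of x "- x"] theta_zero by auto

lemma theta_diff: "\<theta> (x - y) = \<theta> x * \<theta> (- y)"
  using theta_add[of x "- y"] by simp

lemma theta_sum: "\<theta> (\<Sum>i\<in>I. f i) = (\<Prod>i\<in>I. \<theta> (f i))"
  by (induction I rule: infinite_finite_induct) (auto simp: theta_zero theta_add)

lemma theta_scaled_nontrivial: "d \<noteq> 0 \<Longrightarrow> \<exists>t. \<theta> (d * t) \<noteq> 1"
proof -
  assume d: "d \<noteq> 0"
  obtain s where "\<theta> s \<noteq> 1" using nontrivial unfolding nontrivial_linear_character_def by auto
  with d show ?thesis by (intro exI[of _ "s / d"]) simp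
qed

lemma Vsp_add: "x \<in> V \<Longrightarrow> y \<in> V \<Longrightarrow> x + y \<in> V"
  using ent_add[of x N y] unfolding Vsp_def by auto

lemma Vsp_diff: "x \<in> V \<Longrightarrow> y \<in> V \<Longrightarrow> x - y \<in> V"
  using ent_minus[of x N y] unfolding Vsp_def by (auto intro!: minus_carrier_mat)

lemma kappa_add:
  assumes "A \<in> V" "x \<in> carrier_mat N N" "y \<in> carrier_mat N N"
  shows "kappa A (x + y) = kappa A x + kappa A y"
  unfolding kappa_Pos[OF assms(1,2)] kappa_Pos[OF assms(1,3)] kappa_Pos[OF assms(1) add_carrier_mat[OF assms(3)]]
    sum.distrib[symmetric]
  by (intro sum.cong refl) (use assms Pos_range in \<open>auto simp: ent_add[of _ N] distrib_left simp del: atLeastAtMost_iff\<close>)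

lemma chr_apply: "x \<in> V \<Longrightarrow> chr T n \<theta> A x = \<theta> (- kappa A x)"
  by (simp add: chr_def)

lemma chr_outside: "x \<notin> V \<Longrightarrow> chr T n \<theta> A x = 0"
  by (simp add: chr_def)

text \<open>Translating the summation variable by a suitable \<open>y\<close> multiplies the sum by
  \<open>h y\<close>, which differs from 1.\<close>

lemma chr_orthogonal:
  assumes A: "A \<in> V" and B: "B \<in> V" and ne: "A \<noteq> B"
  shows "(\<Sum>x\<in>V. chr T n \<theta> A x * \<theta> (kappa B x)) = 0"
proof -
  define h where "h x = \<theta> (- kappa A x) * \<theta> (kappa B x)" for x
  obtain i j where ij: "(i, j) \<in> Pos T n" "ent A i j \<noteq> ent B i j"
    using Vsp_eqI[OF A B] ne by blast
  obtain t where t: "\<theta> ((ent B i j - ent A i j) * t) \<noteq> 1"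
    using theta_scaled_nontrivial[of "ent B i j - ent A i j"] ij by auto
  \<comment> \<open>A multiple of the matrix unit at a position where \<open>A\<close> and
    \<open>B\<close> differ; \<open>t\<close> makes \<open>\<theta>\<close> nontrivial there, and
    the projection only makes membership in \<open>V\<close> immediate.\<close>
  define y where "y = proj_V T n (t \<cdot>\<^sub>m eunit N i j)"
  have y: "y \<in> V" unfolding y_def by simp
  have ky: "kappa C y = ent C i j * t" if C: "C \<in> V" for C
  proof -
    have "kappa C y = kappa C (t \<cdot>\<^sub>m eunit N i j)"
      unfolding y_def by (rule kappa_proj[OF C]) simp
    also have "\<dots> = (\<Sum>p\<in>Pos T n. if p = (i, j) then ent C i j * t else 0)"
      unfolding kappa_Pos[OF C smult_carrier_mat[OF eunit_carrier]]
    proof (intro sum.cong refl)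
      fix p assume "p \<in> Pos T n"
      then obtain a b where p: "p = (a, b)" "a \<in> {1..N}" "b \<in> {1..N}" using Pos_range by (cases p) blast
      show "(case p of (a, b) \<Rightarrow> ent C a b * ent (t \<cdot>\<^sub>m eunit N i j) a b) = (if p = (i, j) then ent C i j * t else 0)"
        unfolding p(1) prod.case ent_smult[OF eunit_carrier p(2,3)] ent_eunit[OF p(2,3)] by simp
    qed
    finally show ?thesis using ij(1) finite_Pos by simp
  qed
  have hxy: "h (x + y) = h y * h x" if x: "x \<in> V" for x
    using kappa_add[OF A VspD(1)[OF x] VspD(1)[OF y]] kappa_add[OF B VspD(1)[OF x] VspD(1)[OF y]]
    by (simp add: h_def theta_add theta_diff mult_ac)
  have "h y = \<theta> ((ent B i j - ent A i j) * t)"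
    unfolding h_def ky[OF A] ky[OF B] theta_add[symmetric] by (simp add: algebra_simps)
  then have hy: "h y \<noteq> 1" using t by simp
  have "(\<Sum>x\<in>V. h x) = (\<Sum>x\<in>V. h (x + y))"
  proof (rule sum.reindex_bij_witness[where i = "\<lambda>x. x + y" and j = "\<lambda>x. x - y"])
    fix x assume x: "x \<in> V"
    note c = VspD(1)[OF x] VspD(1)[OF y]
    show "x - y + y = x" "x + y - y = x" using c by (auto intro!: eq_matI)
    then show "h (x - y + y) = h x" by simp
  qed (use y in \<open>auto intro: Vsp_add Vsp_diff\<close>)
  also have "\<dots> = h y * (\<Sum>x\<in>V. h x)" by (simp add: hxy sum_distrib_left)
  finally have "(\<Sum>x\<in>V. h x) = 0" using hy by simp
  then show ?thesis by (simp add: h_def chr_apply)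
qed

lemma chr_indep: "indep_family (chr T n \<theta>) V"
  unfolding indep_family_def
proof (intro conjI allI impI ballI)
  show "finite V" by (rule finite_Vsp)
  fix c :: "'a mat \<Rightarrow> complex" and B assume z: "(\<Sum>A\<in>V. fscale (c A) (chr T n \<theta> A)) = 0" and B: "B \<in> V"
  have z': "(\<Sum>A\<in>V. c A * chr T n \<theta> A x) = 0" for x
    using fun_cong[OF z, of x] unfolding sum_fun_apply by (simp add: fscale_apply)
  have "0 = (\<Sum>x\<in>V. (\<Sum>A\<in>V. c A * chr T n \<theta> A x) * \<theta> (kappa B x))" by (simp add: z')
  also have "\<dots> = (\<Sum>A\<in>V. \<Sum>x\<in>V. c A * (chr T n \<theta> A x * \<theta> (kappa B x)))"
    unfolding sum_distrib_right by (subst sum.swap) (simp add: mult.assoc)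
  also have "\<dots> = (\<Sum>A\<in>V. if A = B then c B * of_nat (card V) else 0)"
  proof (rule sum.cong[OF refl])
    fix A assume A: "A \<in> V"
    show "(\<Sum>x\<in>V. c A * (chr T n \<theta> A x * \<theta> (kappa B x))) = (if A = B then c B * of_nat (card V) else 0)"
    proof (cases "A = B")
      case True
      then show ?thesis by (simp add: chr_apply theta_minus)
    qed (simp add: sum_distrib_left[symmetric] chr_orthogonal[OF A B])
  qed
  also have "\<dots> = c B * of_nat (card V)" unfolding sum.delta[OF finite_Vsp] using B by simp
  finally show "c B = 0" using B finite_Vsp[where 'a='a] by auto
qed

lemma chr_inj: "inj_on (chr T n \<theta>) V"
  by (rule indep_family_inj[OF chr_indep])

text \<open>With \<open>x\<close> in \<open>V\<close> read as the unitriangular matrix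
  \<open>1 + x\<close>, up to entries above the diagonal outside \<open>Pos\<close>, this is right
  multiplication by the inverse of \<open>u\<close>.\<close>

definition shift :: "'a mat \<Rightarrow> 'a mat \<Rightarrow> 'a mat"
  where "shift u x = proj_V T n ((1\<^sub>m N + x) * ginv u)"

text \<open>The default 0 off \<open>V\<close> is the one of \<open>chr\<close>, so identities hold
  between functions on all matrices.\<close>

definition translate :: "'a mat \<Rightarrow> ('a mat \<Rightarrow> complex) \<Rightarrow> 'a mat \<Rightarrow> complex"
  where "translate u f = (\<lambda>x. if x \<in> V then f (shift u x) else 0)"

lemma shift_Vsp [simp]: "shift u x \<in> V"
  by (simp add: shift_def)

lemma linear_translate: "Vector_Spaces.linear fscale fscale (translate u)"
  by (auto simp: Vector_Spaces.linear_iff translate_def fun_eq_iff fscale_apply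
      intro: cfun.vector_space_axioms)

lemma ent_dot_act:
  assumes A: "A \<in> V" and u: "u \<in> unitriangular T n" and ij: "(i, j) \<in> Pos T n"
  shows "ent (dot_act T n A u) i j = (\<Sum>k=1..N. ent A i k * ent (ginv u) j k)"
  unfolding dot_act_def ent_proj_V[OF ij]
  using ent_mult[OF VspD(1)[OF A], of "transpose_mat (ginv u)" i j] Pos_range[OF ij]
    unitriangularD(1)[OF GL_inv_unitriangular(1)[OF u]]
  by (auto simp: ent_transpose[of _ N] simp del: atLeastAtMost_iff intro!: sum.cong)

lemma dot_act_Vsp [simp]: "dot_act T n A u \<in> V"
  by (simp add: dot_act_def)

text \<open>The two summands of \<open>1 + x\<close> separate: the identity matrix yields the scalar
  of the monomial action, and \<open>x\<close> yields the new character once u^-1 is moved to the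
  other argument of the trace form.\<close>

lemma chr_shift:
  assumes A: "A \<in> V" and u: "u \<in> unitriangular T n" and x: "x \<in> V"
  shows "chr T n \<theta> A (shift u x) = \<theta> (- kappa A (ginv u)) * chr T n \<theta> (dot_act T n A u) x"
proof -
  let ?w = "ginv u"
  have w: "?w \<in> carrier_mat N N" by (rule unitriangularD(1)[OF GL_inv_unitriangular(1)[OF u]])
  note c = VspD(1)[OF A] VspD(1)[OF x]
  have "kappa A (shift u x) = kappa A ((1\<^sub>m N + x) * ?w)"
    unfolding shift_def by (rule kappa_proj[OF A]) (use w c in auto)
  also have "(1\<^sub>m N + x) * ?w = ?w + x * ?w"
    using w c by (simp add: add_mult_distrib_mat[of _ N N])
  also have "kappa A (?w + x * ?w) = kappa A ?w + kappa A (x * ?w)"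
    by (rule kappa_add[OF A]) (use w c in auto)
  also have "kappa A (x * ?w) = (\<Sum>i=1..N. \<Sum>j=1..N. ent A i j * (\<Sum>k=1..N. ent x i k * ent ?w k j))"
    using w c by (subst kappa_eq[of _ N]) (auto simp: ent_mult[of _ N] simp del: atLeastAtMost_iff intro!: sum.cong)
  also have "\<dots> = (\<Sum>i=1..N. \<Sum>k=1..N. ent x i k * (\<Sum>j=1..N. ent A i j * ent ?w k j))"
    unfolding sum_distrib_left by (rule sum.cong[OF refl], subst sum.swap) (simp add: mult_ac)
  also have "\<dots> = kappa x (A * transpose_mat ?w)"
    using w c by (subst kappa_eq[of _ N])
      (auto simp: ent_mult[of _ N] ent_transpose[of _ N] simp del: atLeastAtMost_iff intro!: sum.cong)
  also have "\<dots> = kappa x (dot_act T n A u)"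
    unfolding dot_act_def by (rule kappa_proj[OF x, symmetric]) (use w c in auto)
  also have "\<dots> = kappa (dot_act T n A u) x"
    by (rule kappa_sym[OF c(2) VspD(1)[OF dot_act_Vsp]])
  finally show ?thesis using x by (simp add: chr_apply theta_diff)
qed

lemma translate_chr:
  assumes "A \<in> V" "u \<in> unitriangular T n"
  shows "translate u (chr T n \<theta> A) = fscale (\<theta> (- kappa A (ginv u))) (chr T n \<theta> (dot_act T n A u))"
  unfolding translate_def fun_eq_iff fscale_apply by (auto simp: chr_shift[OF assms] chr_outside)

lemma span_Vhat: "f \<in> cfun.span (Vhat T n \<theta>) \<Longrightarrow>
  f = (\<Sum>A\<in>V. fscale (cfun.representation (Vhat T n \<theta>) f (chr T n \<theta> A)) (chr T n \<theta> A))"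
  using cfun.sum_representation_eq[OF indep_family_independent[OF chr_indep], of f "Vhat T n \<theta>"] finite_Vsp[where 'a='a]
  unfolding Vhat_def by (simp add: sum.reindex[OF chr_inj])

lemma mact_translate:
  assumes "f \<in> cfun.span (Vhat T n \<theta>)" and u: "u \<in> unitriangular T n"
  shows "mact T n \<theta> u f = translate u f"
proof -
  interpret vp: vector_space_pair "fscale :: complex \<Rightarrow> ('a mat \<Rightarrow> complex) \<Rightarrow> _" "fscale :: complex \<Rightarrow> ('a mat \<Rightarrow> complex) \<Rightarrow> _"
    by (intro vector_space_pair.intro cfun.vector_space_axioms)
  let ?r = "cfun.representation (Vhat T n \<theta>) f"
  have "translate u f = translate u (\<Sum>A\<in>V. fscale (?r (chr T n \<theta> A)) (chr T n \<theta> A))"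
    by (subst span_Vhat[OF assms(1)]) (rule refl)
  also have "\<dots> = (\<Sum>A\<in>V. fscale (?r (chr T n \<theta> A)) (translate u (chr T n \<theta> A)))"
    by (simp only: vp.linear_sum[OF linear_translate] vp.linear_scale[OF linear_translate])
  also have "\<dots> = mact T n \<theta> u f"
    unfolding mact_def by (intro sum.cong refl) (simp only: translate_chr[OF _ u])
  finally show ?thesis ..
qed

lemma span_Vhat_outside: "f \<in> cfun.span (Vhat T n \<theta>) \<Longrightarrow> x \<notin> V \<Longrightarrow> f x = 0"
  by (subst span_Vhat) (auto simp: sum_fun_apply fscale_apply chr_outside)

text \<open>In each row \<open>Pos\<close> is an interval that starts right after the diagonal, and
  an entry of \<open>M * w\<close> in column \<open>k\<close> uses only columns
  \<open>l \<le> k\<close> of \<open>M\<close>, because \<open>w\<close> is upper triangular. So the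
  entries discarded by the inner projection are never seen. This is why \<open>shift\<close> is an
  action.\<close>

lemma proj_mult_left:
  assumes M: "M \<in> unitriangular T n" and w: "w \<in> unitriangular T n"
  shows "proj_V T n ((1\<^sub>m N + proj_V T n M) * w) = proj_V T n (M * w :: 'a mat)"
proof (rule Vsp_eqI[OF proj_V_Vsp proj_V_Vsp])
  fix i k assume p: "(i, k) \<in> Pos T n"
  note ik = Pos_range[OF p]
  note M' = unitriangularD[OF M] and w' = unitriangularD[OF w]
  have c: "1\<^sub>m N + proj_V T n M \<in> carrier_mat N N" using VspD(1)[OF proj_V_Vsp] by (intro add_carrier_mat) auto
  have "ent (1\<^sub>m N + proj_V T n M) i l * ent w l k = ent M i l * ent w l k" if l: "l \<in> {1..N}" for l
  proof -
    have e: "ent (1\<^sub>m N + proj_V T n M) i l = (if i = l then 1 else 0) + ent (proj_V T n M) i l"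
      unfolding ent_add[OF one_carrier_mat VspD(1)[OF proj_V_Vsp] ik(1) l] ent_one[OF ik(1) l] ..
    consider "l < i" | "l = i" | "i < l" "l \<le> k" | "k < l" by linarith
    then show ?thesis
    proof cases
      case 1
      then show ?thesis
        using e M'(2)[OF ik(1) l] VspD(2)[OF proj_V_Vsp[of T n M] ik(1) l not_Pos] by simp
    next
      case 2
      then show ?thesis using e M'(3)[OF l] VspD(2)[OF proj_V_Vsp[of T n M] l l not_Pos] by simp
    next
      case 3
      then show ?thesis using e ent_proj_V[OF Pos_left[OF p 3], of M] by simp
    next
      case 4
      then show ?thesis using w'(2)[OF l ik(2)] by simp
    qed
  qed
  then show "ent (proj_V T n ((1\<^sub>m N + proj_V T n M) * w)) i k = ent (proj_V T n (M * w)) i k"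
    unfolding ent_proj_V[OF p] ent_mult[OF c w'(1) ik] ent_mult[OF M'(1) w'(1) ik] by (rule sum.cong[OF refl])
qed

lemma shift_mult:
  assumes g: "g \<in> unitriangular T n" and h: "h \<in> unitriangular T n" and x: "x \<in> V"
  shows "shift (g * h) x = shift g (shift h x)"
proof -
  interpret GL: Group.group "GL (dimN T n) :: 'a mat monoid" by (rule GL_group)
  note gi = GL_inv_unitriangular(1)[OF g] and hi = GL_inv_unitriangular(1)[OF h] and x1 = unitriangular_add_Vsp[OF x]
  have "ginv (g * h) = ginv h * ginv g"
    using GL.inv_mult_group[OF unitriangular_GL[OF g] unitriangular_GL[OF h]] by (simp add: GL_simps)
  then show ?thesis
    unfolding shift_def
    using proj_mult_left[OF unitriangular_mult[OF x1 hi] gi]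
      unitriangularD(1)[OF gi] unitriangularD(1)[OF hi] unitriangularD(1)[OF x1]
    by (simp add: assoc_mult_mat[of _ N N _ N _ N])
qed

lemma shift_one: "x \<in> V \<Longrightarrow> shift (1\<^sub>m N) x = x"
proof -
  assume x: "x \<in> V"
  interpret GL: Group.group "GL (dimN T n) :: 'a mat monoid" by (rule GL_group)
  have "ginv (1\<^sub>m N) = 1\<^sub>m N"
    using GL.inv_one by (simp add: GL_simps)
  then have "shift (1\<^sub>m N) x = proj_V T n (1\<^sub>m N + x)"
    unfolding shift_def using VspD(1)[OF x] by simp
  also have "\<dots> = x"
  proof (rule Vsp_eqI[OF proj_V_Vsp x])
    fix i j assume p: "(i, j) \<in> Pos T n"
    then show "ent (proj_V T n (1\<^sub>m N + x)) i j = ent x i j"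
      unfolding ent_proj_V[OF p] ent_add[OF one_carrier_mat VspD(1)[OF x] Pos_range[OF p]] ent_one[OF Pos_range[OF p]]
      using PosD[OF p] by simp
  qed
  finally show ?thesis .
qed

text \<open>On the span of \<open>Vhat\<close> the coordinate definition of \<open>mact\<close> is
  composition with \<open>shift\<close>, so stability of the generators is all that has to be
  supplied later.\<close>

lemma right_module_span:
  assumes G: "Group.monoid G" "carrier G \<subseteq> unitriangular T n" "\<And>x y. x \<otimes>\<^bsub>G\<^esub> y = x * y" "\<one>\<^bsub>G\<^esub> = 1\<^sub>m N"
    and X: "X \<subseteq> cfun.span (Vhat T n \<theta>)"
    and inv: "\<And>u f. u \<in> carrier G \<Longrightarrow> f \<in> X \<Longrightarrow> translate u f \<in> cfun.span X"
  shows "right_module G (cfun.span X) (mact T n \<theta>)"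
proof (rule right_module_spanI[of G translate, OF linear_translate _ G(1) inv])
  fix g f assume "g \<in> carrier G" "f \<in> cfun.span X"
  moreover have "cfun.span X \<subseteq> cfun.span (Vhat T n \<theta>)"
    by (rule cfun.span_minimal[OF X cfun.subspace_span])
  ultimately show "mact T n \<theta> g f = translate g f" using G(2) mact_translate by blast
next
  fix f assume f: "f \<in> X"
  then show "translate \<one>\<^bsub>G\<^esub> f = f"
    unfolding translate_def G(4) using span_Vhat_outside[of f] X by (auto simp: fun_eq_iff shift_one)
next
  fix g h f assume "g \<in> carrier G" "h \<in> carrier G" "f \<in> X"
  then show "translate (g \<otimes>\<^bsub>G\<^esub> h) f = translate h (translate g f)"
    unfolding translate_def G(3) using shift_mult[OF subsetD[OF G(2)] subsetD[OF G(2)]] by (auto simp: fun_eq_iff)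
qed

lemmas Ugrp_module = right_module_span[OF Group.group.is_monoid[OF Ugrp_group] Ugrp_subset Ugrp_simps(2,3)]
lemmas Utilde_module = right_module_span[OF Group.group.is_monoid[OF Utilde_group] equalityD1[OF Utilde_simps(1)] Utilde_simps(2,3)]

lemma dot_act_one: "A \<in> V \<Longrightarrow> dot_act T n A (1\<^sub>m N) = A"
proof -
  assume A: "A \<in> V"
  interpret GL: Group.group "GL (dimN T n) :: 'a mat monoid" by (rule GL_group)
  have "ginv (1\<^sub>m N) = 1\<^sub>m N" using GL.inv_one by (simp add: GL_simps)
  then show ?thesis unfolding dot_act_def using VspD(1)[OF A] proj_V_id[OF A] by simp
qed

text \<open>Composing the projections directly is avoided: moving the character by
  \<open>translate\<close> in one or in two steps gives nonzero multiples of two characters, and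
  orthogonality forces their labels to agree.\<close>

lemma dot_act_mult:
  assumes g: "g \<in> unitriangular T n" and h: "h \<in> unitriangular T n" and A: "A \<in> V"
  shows "dot_act T n A (g * h) = dot_act T n (dot_act T n A g) h"
proof -
  have gh: "g * h \<in> unitriangular T n" by (rule unitriangular_mult[OF g h])
  have t: "translate (g * h) (chr T n \<theta> A) = translate h (translate g (chr T n \<theta> A))"
    unfolding translate_def using shift_mult[OF g h] by (auto simp: fun_eq_iff)
  interpret vp: vector_space_pair "fscale :: complex \<Rightarrow> ('a mat \<Rightarrow> complex) \<Rightarrow> _" "fscale :: complex \<Rightarrow> ('a mat \<Rightarrow> complex) \<Rightarrow> _"
    by (intro vector_space_pair.intro cfun.vector_space_axioms)
  let ?B = "dot_act T n A (g * h)" and ?C = "dot_act T n (dot_act T n A g) h"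
  let ?b = "\<theta> (- kappa A (ginv (g * h)))"
  let ?c = "\<theta> (- kappa A (ginv g)) * \<theta> (- kappa (dot_act T n A g) (ginv h))"
  have e: "fscale ?b (chr T n \<theta> ?B) = fscale ?c (chr T n \<theta> ?C)"
    using t unfolding translate_chr[OF A gh] translate_chr[OF A g] vp.linear_scale[OF linear_translate]
      translate_chr[OF dot_act_Vsp h] cfun.scale_scale .
  show ?thesis
  proof (rule ccontr)
    assume ne: "?B \<noteq> ?C"
    have "(\<Sum>x\<in>V. ?b * (chr T n \<theta> ?B x * \<theta> (kappa ?C x))) = (\<Sum>x\<in>V. ?c * (chr T n \<theta> ?C x * \<theta> (kappa ?C x)))"
      using fun_cong[OF e] by (simp add: fscale_apply mult.assoc[symmetric])
    then have "?c * of_nat (card V) = 0"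
      using chr_orthogonal[OF dot_act_Vsp dot_act_Vsp ne]
      by (auto simp: sum_distrib_left[symmetric] chr_apply theta_minus)
    moreover have "card V \<noteq> 0" using A finite_Vsp[where 'a='a, of T n] by (auto simp: card_eq_0_iff)
    ultimately show False by (simp only: mult_eq_0_iff theta_nonzero of_nat_eq_0_iff) blast
  qed
qed

section \<open>The bilinear form and a Witt extension lemma\<close>

abbreviation br :: "nat \<Rightarrow> nat" where "br \<equiv> bar T n"

definition sgn_at :: "nat \<Rightarrow> 'a"
  where "sgn_at k = (if k \<le> n then 1 else if T = TypeC then - 1 else 1)"

definition form :: "(nat \<Rightarrow> 'a) \<Rightarrow> (nat \<Rightarrow> 'a) \<Rightarrow> 'a"
  where "form x y = (\<Sum>k=1..N. x k * sgn_at k * y (br k))"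

definition basis_vec :: "nat \<Rightarrow> nat \<Rightarrow> 'a"
  where "basis_vec c = (\<lambda>k. if k = c then 1 else 0)"

definition mat_vec :: "'a mat \<Rightarrow> (nat \<Rightarrow> 'a) \<Rightarrow> nat \<Rightarrow> 'a"
  where "mat_vec u x = (\<lambda>k. \<Sum>l=1..N. ent u k l * x l)"

text \<open>One such vector for each \<open>c\<close> supplies the columns of a unitriangular
  matrix.\<close>

definition leads :: "nat \<Rightarrow> (nat \<Rightarrow> 'a) \<Rightarrow> bool"
  where "leads c x \<longleftrightarrow> x c = 1 \<and> (\<forall>k>c. x k = 0)"

lemma sgn_at_square [simp]: "sgn_at k * sgn_at k = 1" "sgn_at k * (sgn_at k * x) = x"
  by (auto simp: sgn_at_def)

lemma sgn_at_br: "k \<in> {1..N} \<Longrightarrow> sgn_at (br k) = (if T = TypeC then - 1 else 1) * sgn_at k"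
  by (auto simp: sgn_at_def bar_def dimN_def)

lemma form_sym: "form y x = (if T = TypeC then - 1 else 1) * form x y"
proof -
  have "form y x = (\<Sum>k=1..N. y (br k) * sgn_at (br k) * x (br (br k)))"
    unfolding form_def
    by (rule sum.reindex_bij_witness[of _ br br]) (use bar_range[of _ T n] bar_bar[of _ T n] in auto)
  also have "\<dots> = (\<Sum>k=1..N. (if T = TypeC then - 1 else 1) * (x k * sgn_at k * y (br k)))"
    by (rule sum.cong[OF refl]) (simp add: sgn_at_br bar_bar del: atLeastAtMost_iff)
  finally show ?thesis unfolding form_def sum_distrib_left .
qed

lemma form_add: "form (x + y) z = form x z + form y z" "form z (x + y) = form z x + form z y"
  unfolding form_def by (simp_all add: algebra_simps sum.distrib)

lemma form_scale: "form (\<lambda>k. t * x k) z = t * form x z" "form z (\<lambda>k. t * x k) = t * form z x"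
  unfolding form_def sum_distrib_left by (simp_all add: mult_ac)

lemma form_basis_left: "c \<in> {1..N} \<Longrightarrow> form (basis_vec c) y = sgn_at c * y (br c)"
proof -
  assume c: "c \<in> {1..N}"
  have "form (basis_vec c) y = (\<Sum>k=1..N. if k = c then sgn_at c * y (br c) else 0)"
    unfolding form_def basis_vec_def by (intro sum.cong) auto
  then show ?thesis using c by simp
qed

lemma form_basis_right: "c \<in> {1..N} \<Longrightarrow> form x (basis_vec c) = x (br c) * sgn_at (br c)"
proof -
  assume c: "c \<in> {1..N}"
  have "form x (basis_vec c) = (\<Sum>k=1..N. if k = br c then x (br c) * sgn_at (br c) else 0)"
    unfolding form_def basis_vec_def
    by (intro sum.cong) (use c bar_bar[of _ T n] bar_bar[OF c] in auto)
  then show ?thesis using bar_range[OF c] by simp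
qed

text \<open>Index \<open>k\<close> is paired with \<open>br k\<close> only, so the spans of the
  first \<open>c\<close> and of the first \<open>d\<close> unit vectors are orthogonal as soon as
  \<open>c + d \<le> N\<close>.\<close>

lemma form_eq_0:
  assumes "\<And>k. k \<in> {1..N} \<Longrightarrow> c < k \<Longrightarrow> x k = 0" "\<And>k. k \<in> {1..N} \<Longrightarrow> d < k \<Longrightarrow> y k = 0"
    and "d \<in> {1..N}" "c < br d"
  shows "form x y = 0"
  unfolding form_def
proof (rule sum.neutral, rule ballI)
  fix k assume k: "k \<in> {1..N}"
  show "x k * sgn_at k * y (br k) = 0"
  proof (cases "c < k")
    case False
    then have "d < br k" using assms(3,4) k by (auto simp: bar_def)
    then show ?thesis using assms(2)[OF bar_range[OF k]] by simp
  qed (use assms(1)[OF k] in simp)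
qed

text \<open>Here the two supports meet in just one pair of indices, that of the top entries.\<close>

lemma form_leading:
  assumes x: "\<And>k. k \<in> {1..N} \<Longrightarrow> br d < k \<Longrightarrow> x k = 0" and y: "\<And>k. k \<in> {1..N} \<Longrightarrow> d < k \<Longrightarrow> y k = 0"
    and d: "d \<in> {1..N}"
  shows "form x y = x (br d) * sgn_at (br d) * y d"
proof -
  have "form x y = (\<Sum>k=1..N. if k = br d then x (br d) * sgn_at (br d) * y d else 0)"
    unfolding form_def
  proof (rule sum.cong[OF refl])
    fix k assume k: "k \<in> {1..N}"
    show "x k * sgn_at k * y (br k) = (if k = br d then x (br d) * sgn_at (br d) * y d else 0)"
    proof (cases "br d < k \<or> k = br d")
      case False
      then have "d < br k" using d k by (auto simp: bar_def)
      then show ?thesis using y[OF bar_range[OF k]] False by simp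
    qed (use x[OF k] bar_bar[OF d] in auto)
  qed
  then show ?thesis using bar_range[OF d] by simp
qed

lemma ent_form_mat: "k \<in> {1..N} \<Longrightarrow> l \<in> {1..N} \<Longrightarrow> ent (form_mat T n :: 'a mat) k l = (if l = br k then sgn_at k else 0)"
  by (simp add: form_mat_def ent_mat_of sgn_at_def)

lemma form_mat_carrier: "(form_mat T n :: 'a mat) \<in> carrier_mat N N"
  by (simp add: form_mat_def)

lemma form_mat_sum: "form x y = (\<Sum>k=1..N. \<Sum>l=1..N. x k * ent (form_mat T n) k l * y l)"
  unfolding form_def
proof (rule sum.cong[OF refl])
  fix k assume k: "k \<in> {1..N}"
  have "(\<Sum>l=1..N. x k * ent (form_mat T n) k l * y l) = (\<Sum>l=1..N. if l = br k then x k * sgn_at k * y (br k) else 0)"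
    by (rule sum.cong[OF refl]) (simp add: ent_form_mat[OF k] del: atLeastAtMost_iff)
  then show "x k * sgn_at k * y (br k) = (\<Sum>l=1..N. x k * ent (form_mat T n) k l * y l)"
    using bar_range[OF k] by simp
qed

lemma ent_gram:
  assumes M: "M \<in> carrier_mat N N" and c: "c \<in> {1..N}" and d: "d \<in> {1..N}"
  shows "ent (transpose_mat M * form_mat T n * M) c d = form (\<lambda>k. ent M k c) (\<lambda>k. ent M k d)"
proof -
  have "ent (transpose_mat M * form_mat T n * M) c d
     = (\<Sum>l=1..N. (\<Sum>k=1..N. ent M k c * ent (form_mat T n) k l) * ent M l d)"
    unfolding ent_mult[OF mult_carrier_mat[OF iffD2[OF transpose_carrier_mat M] form_mat_carrier] M c d]
  proof (rule sum.cong[OF refl])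
    fix l assume l: "l \<in> {1..N}"
    have "ent (transpose_mat M * form_mat T n) c l = (\<Sum>k=1..N. ent M k c * ent (form_mat T n) k l)"
      unfolding ent_mult[OF iffD2[OF transpose_carrier_mat M] form_mat_carrier c l]
      by (rule sum.cong[OF refl]) (simp only: ent_transpose[OF M c])
    then show "ent (transpose_mat M * form_mat T n) c l * ent M l d
      = (\<Sum>k=1..N. ent M k c * ent (form_mat T n) k l) * ent M l d" by simp
  qed
  also have "\<dots> = form (\<lambda>k. ent M k c) (\<lambda>k. ent M k d)"
    unfolding form_mat_sum sum_distrib_right by (rule sum.swap)
  finally show ?thesis .
qed

lemma form_basis_basis: "c \<in> {1..N} \<Longrightarrow> d \<in> {1..N} \<Longrightarrow> form (basis_vec c) (basis_vec d) = ent (form_mat T n) c d"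
  by (simp add: form_basis_left ent_form_mat del: atLeastAtMost_iff) (auto simp: basis_vec_def)

lemma isometry_iff:
  assumes u: "u \<in> unitriangular T n"
  shows "u \<in> carrier (Ugrp T n) \<longleftrightarrow> (\<forall>c\<in>{1..N}. \<forall>d\<in>{1..N}.
    form (\<lambda>k. ent u k c) (\<lambda>k. ent u k d) = form (basis_vec c) (basis_vec d))" (is "_ \<longleftrightarrow> ?R")
proof -
  note c = unitriangularD(1)[OF u]
  have m: "transpose_mat u * form_mat T n * u \<in> carrier_mat N N" using c form_mat_carrier by auto
  have "u \<in> carrier (Ugrp T n) \<longleftrightarrow> transpose_mat u * form_mat T n * u = form_mat T n"
    using u unitriangular_GL[OF u] by (simp add: Ugrp_simps isometries_def)
  also have "\<dots> \<longleftrightarrow> ?R"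
  proof
    assume "transpose_mat u * form_mat T n * u = form_mat T n"
    then show ?R using ent_gram[OF c] form_basis_basis by metis
  next
    assume R: ?R
    show "transpose_mat u * form_mat T n * u = form_mat T n"
      by (rule ent_eqI[OF m form_mat_carrier]) (use R ent_gram[OF c] form_basis_basis in metis)
  qed
  finally show ?thesis .
qed

lemma form_mat_vec:
  assumes u: "u \<in> carrier (Ugrp T n)"
  shows "form (mat_vec u x) (mat_vec u y) = form x y"
proof -
  have uu: "u \<in> unitriangular T n" using u Ugrp_subset by blast
  let ?S = "ent (form_mat T n :: 'a mat)" and ?u = "ent u"
  have "form (mat_vec u x) (mat_vec u y)
      = (\<Sum>k=1..N. \<Sum>l=1..N. \<Sum>c=1..N. \<Sum>d=1..N. x c * (?u k c * ?S k l * ?u l d) * y d)"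
    unfolding form_mat_sum mat_vec_def sum_distrib_left sum_distrib_right
    by (rule sum.cong[OF refl], rule sum.cong[OF refl], subst sum.swap) (simp add: mult_ac)
  also have "\<dots> = (\<Sum>k=1..N. \<Sum>c=1..N. \<Sum>l=1..N. \<Sum>d=1..N. x c * (?u k c * ?S k l * ?u l d) * y d)"
    by (intro sum.cong refl sum.swap)
  also have "\<dots> = (\<Sum>c=1..N. \<Sum>k=1..N. \<Sum>l=1..N. \<Sum>d=1..N. x c * (?u k c * ?S k l * ?u l d) * y d)"
    by (rule sum.swap)
  also have "\<dots> = (\<Sum>c=1..N. \<Sum>k=1..N. \<Sum>d=1..N. \<Sum>l=1..N. x c * (?u k c * ?S k l * ?u l d) * y d)"
    by (rule sum.cong[OF refl], rule sum.cong[OF refl], rule sum.swap)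
  also have "\<dots> = (\<Sum>c=1..N. \<Sum>d=1..N. \<Sum>k=1..N. \<Sum>l=1..N. x c * (?u k c * ?S k l * ?u l d) * y d)"
    by (rule sum.cong[OF refl], rule sum.swap)
  also have "\<dots> = (\<Sum>c=1..N. \<Sum>d=1..N. x c * form (\<lambda>k. ?u k c) (\<lambda>k. ?u k d) * y d)"
    unfolding form_mat_sum sum_distrib_left sum_distrib_right ..
  also have "\<dots> = (\<Sum>c=1..N. \<Sum>d=1..N. x c * ?S c d * y d)"
    using u isometry_iff[OF uu] form_basis_basis by (intro sum.cong refl) metis
  finally show ?thesis unfolding form_mat_sum .
qed

lemma mat_vec_mult:
  assumes "u \<in> carrier_mat N N" "v \<in> carrier_mat N N" "k \<in> {1..N}"
  shows "mat_vec (u * v) x k = mat_vec u (mat_vec v x) k"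
proof -
  have "mat_vec (u * v) x k = (\<Sum>l=1..N. \<Sum>m=1..N. ent u k m * ent v m l * x l)"
    unfolding mat_vec_def sum_distrib_right[symmetric]
    by (rule sum.cong[OF refl]) (simp only: ent_mult[OF assms])
  also have "\<dots> = mat_vec u (mat_vec v x) k"
    unfolding mat_vec_def sum_distrib_left by (subst sum.swap) (simp add: mult.assoc)
  finally show ?thesis .
qed

lemma mat_vec_basis: "c \<in> {1..N} \<Longrightarrow> mat_vec u (basis_vec c) k = ent u k c"
  unfolding mat_vec_def basis_vec_def by (simp add: if_distrib cong: if_cong)

lemma mat_vec_one: "k \<in> {1..N} \<Longrightarrow> mat_vec (1\<^sub>m N) x k = x k"
proof -
  assume k: "k \<in> {1..N}"
  have "mat_vec (1\<^sub>m N) x k = (\<Sum>l=1..N. if l = k then x k else 0)"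
    unfolding mat_vec_def by (rule sum.cong[OF refl]) (auto simp: ent_one[OF k] simp del: atLeastAtMost_iff)
  then show ?thesis using k by simp
qed

lemma form_cong:
  assumes "\<And>k. k \<in> {1..N} \<Longrightarrow> x k = x' k" "\<And>k. k \<in> {1..N} \<Longrightarrow> y k = y' k"
  shows "form x y = form x' y'"
  unfolding form_def
proof (rule sum.cong[OF refl])
  fix k assume k: "k \<in> {1..N}"
  show "x k * sgn_at k * y (br k) = x' k * sgn_at k * y' (br k)"
    using assms(1)[OF k] assms(2)[OF bar_range[OF k]] by simp
qed

text \<open>The identity u^-1 = S^-1 u^t S, read entrywise for the matrix S of the form: inverting
  an isometry is reflection in the antidiagonal up to signs. It exchanges conditions on column
  \<open>j\<close> of the inverse with conditions on row \<open>br j\<close> of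
  \<open>u\<close>.\<close>

lemma ginv_mirror:
  assumes u: "u \<in> carrier (Ugrp T n)" and k: "k \<in> {1..N}" and l: "l \<in> {1..N}"
  shows "ent (ginv u) k l = sgn_at (br k) * sgn_at (br l) * ent u (br l) (br k)"
proof -
  have uu: "u \<in> unitriangular T n" using u Ugrp_subset by blast
  note i = GL_inv_unitriangular[OF uu]
  let ?a = "br k"
  have a: "?a \<in> {1..N}" by (rule bar_range[OF k])
  have id: "mat_vec u (mat_vec (ginv u) (basis_vec l)) m = basis_vec l m" if m: "m \<in> {1..N}" for m
    using mat_vec_mult[OF unitriangularD(1)[OF uu] unitriangularD(1)[OF i(1)] m, of "basis_vec l"]
    unfolding i(2) mat_vec_one[OF m] ..
  \<comment> \<open>Adjointness: pairing u e_a with e_l equals pairing e_a with u^-1 e_l, and for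
    \<open>a = br k\<close> both pairings are single entries up to sign.\<close>
  have "form (mat_vec u (basis_vec ?a)) (basis_vec l) = form (mat_vec u (basis_vec ?a)) (mat_vec u (mat_vec (ginv u) (basis_vec l)))"
    by (rule form_cong) (simp_all only: id)
  also have "\<dots> = form (basis_vec ?a) (mat_vec (ginv u) (basis_vec l))" by (rule form_mat_vec[OF u])
  finally have "ent u (br l) ?a * sgn_at (br l) = sgn_at ?a * ent (ginv u) k l"
    by (simp only: form_basis_right[OF l] form_basis_left[OF a] mat_vec_basis[OF a] mat_vec_basis[OF l] bar_bar[OF k])
  then have "sgn_at ?a * (ent u (br l) ?a * sgn_at (br l)) = ent (ginv u) k l" by simp
  then show ?thesis by (simp add: mult_ac)
qed

end

locale odd_setting = monomial_setting T n \<theta>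
  for T :: classical_type and n :: nat and \<theta> :: "'a::{field,finite} \<Rightarrow> complex" +
  assumes two: "(2::'a) \<noteq> 0"
begin

lemma form_alternating: "T = TypeC \<Longrightarrow> form x x = 0"
proof -
  assume "T = TypeC"
  then have "2 * form x x = 0" using form_sym[of x x] by (simp add: eq_neg_iff_add_eq_0)
  then show ?thesis using two by simp
qed

text \<open>The entry \<open>y d'\<close> with \<open>d' = br d\<close> is determined by the condition for \<open>d\<close>; the conditions are
  met in increasing order of \<open>d\<close>, since \<open>basis_vec (br d)\<close> is orthogonal to every vector
  supported on positions below \<open>d\<close>.\<close>

lemma witt_step:
  assumes c: "c \<in> {1..N}" and fc: "f < c" and v: "\<And>d. d \<in> {1..N} \<Longrightarrow> leads d (v d)"
    and g: "T = TypeC \<Longrightarrow> g c = 0"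
  shows "\<exists>y. (\<forall>k>f. y k = 0) \<and> (\<forall>d\<in>{1..N}. br d \<le> f \<and> d < m \<longrightarrow>
    form (v c + y) (if d = c then v c + y else v d) = g d)"
proof (induction m)
  case 0
  show ?case by (rule exI[of _ 0]) simp
next
  case (Suc m)
  then obtain y where y: "\<forall>k>f. y k = 0"
    and gd: "\<And>d. d \<in> {1..N} \<Longrightarrow> br d \<le> f \<Longrightarrow> d < m \<Longrightarrow> form (v c + y) (if d = c then v c + y else v d) = g d" by blast
  show ?case
  proof (cases "m \<in> {1..N} \<and> br m \<le> f")
    case False
    then have "d < m" if "d \<in> {1..N}" "br d \<le> f" "d < Suc m" for d
      using that by (cases "d = m") auto
    then show ?thesis using y gd by blast
  next
    case True
    then have m: "m \<in> {1..N}" "br m \<le> f" by auto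
    define x where "x = v c + y"
    have xc: "leads c x" using v[OF c] y fc unfolding leads_def x_def by auto
    have bm: "br m \<in> {1..N}" by (rule bar_range[OF m(1)])
    let ?e = "\<lambda>t. (\<lambda>k. t * basis_vec (br m) k)"
    have fe: "form (x + ?e t) z = form x z + t * (sgn_at (br m) * z m)" for t z
      unfolding form_add form_scale form_basis_left[OF bm] bar_bar[OF m(1)] ..
    have fe': "form z (x + ?e t) = form z x + t * (z m * sgn_at m)" for t z
      unfolding form_add form_scale form_basis_right[OF bm] bar_bar[OF m(1)] ..
    have ex: "\<exists>t. form (x + ?e t) (if m = c then x + ?e t else v m) = g m"
    proof (cases "m = c")
      case False
      let ?t = "(g m - form x (v m)) * sgn_at (br m)"
      have "form (x + ?e ?t) (v m) = form x (v m) + ?t * sgn_at (br m)"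
        using v[OF m(1)] unfolding fe leads_def by simp
      also have "\<dots> = g m" by (simp add: mult.assoc)
      finally show ?thesis using False by (intro exI[of _ ?t]) (simp only: if_False)
    next
      case mc: True
      show ?thesis
      proof (cases "T = TypeC")
        case True
        then show ?thesis using mc g form_alternating by auto
      next
        case False
        then have s: "sgn_at k = 1" for k by (simp add: sgn_at_def)
        \<comment> \<open>Since \<open>br m \<le> f < c = m\<close>, the added unit vector is
          isotropic and pairs to 1 with the leading entry of \<open>x\<close>, so the norm grows by
          \<open>2 * t\<close>; this is where division by two is needed.\<close>
        have "br m \<noteq> m" using m fc mc by auto
        define t where "t = (g m - form x x) / 2"
        have "form (x + ?e t) (x + ?e t) = form x x + 2 * t"
          using xc mc \<open>br m \<noteq> m\<close> unfolding fe fe' leads_def by (simp add: s basis_vec_def)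
        also have "\<dots> = form x x + (g m - form x x)"
          unfolding t_def times_divide_eq_right nonzero_mult_div_cancel_left[OF two] ..
        also have "\<dots> = g m" by simp
        finally show ?thesis using mc by (intro exI[of _ t]) (simp only: if_True simp_thms)
      qed
    qed
    then obtain t where t: "form (x + ?e t) (if m = c then x + ?e t else v m) = g m" by blast
    have keep: "form (x + ?e t) (if d = c then x + ?e t else v d) = g d"
      if d: "d \<in> {1..N}" "br d \<le> f" "d < m" for d
    proof -
      have old: "form x (if d = c then x else v d) = g d" using gd[OF d] unfolding x_def .
      show ?thesis
      proof (cases "d = c")
        case False
        then show ?thesis using old v[OF d(1)] d(3) unfolding fe leads_def by simp
      next
        case True
        then have "x m = 0" using xc d(3) unfolding leads_def by simp
        moreover have "br m \<noteq> m" using m fc True d(3) by auto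
        ultimately have "form (x + ?e t) (x + ?e t) = form x x"
          unfolding fe fe' by (simp add: basis_vec_def)
        then show ?thesis using old True by (simp only: if_True simp_thms)
      qed
    qed
    have eq: "v c + (y + ?e t) = x + ?e t" unfolding x_def by (simp add: add.assoc)
    show ?thesis
    proof (rule exI[of _ "y + ?e t"], intro conjI allI impI ballI)
      fix k assume "k > f"
      then show "(y + ?e t) k = 0" using y m(2) by (simp add: basis_vec_def)
    next
      fix d assume "d \<in> {1..N}" "br d \<le> f \<and> d < Suc m"
      then show "form (v c + (y + ?e t)) (if d = c then v c + (y + ?e t) else v d) = g d"
        unfolding eq using t keep by (cases "d = m") auto
    qed
  qed
qed

text \<open>The pairs with \<open>f c < br d\<close> and \<open>f d < br c\<close> are those whose
  form does not feel changes of the vectors at indices up to their levels, so they must agree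
  beforehand. Any other pair has \<open>br d \<le> f c\<close> or \<open>br c \<le> f d\<close> and
  is repaired when \<open>c\<close>, respectively \<open>d\<close>, is processed; \<open>m\<close>
  counts the processed vectors.\<close>

lemma witt_induct:
  assumes v: "\<And>c. c \<in> {1..N} \<Longrightarrow> leads c (v c)" and t: "\<And>c. c \<in> {1..N} \<Longrightarrow> leads c (t c)"
    and f: "\<And>c. c \<in> {1..N} \<Longrightarrow> f c < c"
    and eq: "\<And>c d. c \<in> {1..N} \<Longrightarrow> d \<in> {1..N} \<Longrightarrow> f c < br d \<Longrightarrow> f d < br c \<Longrightarrow> form (v c) (v d) = form (t c) (t d)"
  shows "\<exists>v'. (\<forall>c\<in>{1..N}. leads c (v' c) \<and> (\<forall>k>f c. v' c k = v c k)) \<and>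
    (\<forall>c\<in>{1..N}. \<forall>d\<in>{1..N}. f c < br d \<and> f d < br c \<or> c < m \<and> br d \<le> f c \<or> d < m \<and> br c \<le> f d \<longrightarrow>
      form (v' c) (v' d) = form (t c) (t d))"
proof (induction m)
  case 0
  show ?case by (rule exI[of _ v]) (use v eq in auto)
next
  case (Suc m)
  then obtain v' where v': "\<And>c. c \<in> {1..N} \<Longrightarrow> leads c (v' c)" "\<And>c k. c \<in> {1..N} \<Longrightarrow> f c < k \<Longrightarrow> v' c k = v c k"
    and eq': "\<And>c d. c \<in> {1..N} \<Longrightarrow> d \<in> {1..N} \<Longrightarrow> f c < br d \<and> f d < br c \<or> c < m \<and> br d \<le> f c \<or> d < m \<and> br c \<le> f d \<Longrightarrow>
      form (v' c) (v' d) = form (t c) (t d)" by blast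
  show ?case
  proof (cases "m \<in> {1..N}")
    case False
    then have "c < Suc m \<longleftrightarrow> c < m" if "c \<in> {1..N}" for c using that by (cases "c = m") auto
    then show ?thesis using v' eq' by (intro exI[of _ v']) simp
  next
    case m: True
    have "T = TypeC \<Longrightarrow> form (t m) (t m) = 0" by (rule form_alternating)
    \<comment> \<open>The bound \<open>Suc N\<close> makes \<open>witt_step\<close> meet the
      conditions for all \<open>d\<close> in one go.\<close>
    from witt_step[OF m f[OF m] v'(1), of "\<lambda>d. form (t m) (t d)" "Suc N"] this
    obtain y where y: "\<And>k. k > f m \<Longrightarrow> y k = 0"
      and g': "\<forall>d\<in>{1..N}. br d \<le> f m \<and> d < Suc N \<longrightarrow> form (v' m + y) (if d = m then v' m + y else v' d) = form (t m) (t d)"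
      by blast
    have g: "form (v' m + y) (if d = m then v' m + y else v' d) = form (t m) (t d)"
      if "d \<in> {1..N}" "br d \<le> f m" for d
      using g'[rule_format, OF that(1)] that by simp
    define w where "w = v'(m := v' m + y)"
    have fN: "f m < m" using f[OF m] .
    \<comment> \<open>The correction \<open>y\<close> is supported up to \<open>f m\<close>, hence
      orthogonal to every vector \<open>v' d\<close> with \<open>f m < br d\<close>.\<close>
    have unch: "form (w m) (w d) = form (v' m) (v' d)" if d: "d \<in> {1..N}" "f m < br d" for d
    proof -
      have vd: "v' d k = 0" if "d < k" for k using v'(1)[OF d(1)] that unfolding leads_def by simp
      have z: "form y (v' d) = 0" by (rule form_eq_0[of "f m" _ d]) (use y vd d in auto)
      show ?thesis
      proof (cases "d = m")
        case False
        then show ?thesis unfolding w_def by (simp add: form_add z)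
      next
        case True
        have "form y y = 0"
          by (rule form_eq_0[of "f m" _ m]) (use y fN d True in auto)
        then show ?thesis using z form_sym[of "v' m" y] True unfolding w_def by (simp add: form_add)
      qed
    qed
    \<comment> \<open>A pair settled at an earlier stage is either untouched by the correction or is
      among the conditions just imposed again.\<close>
    have pair_m: "form (w m) (w d) = form (t m) (t d)"
      if d: "d \<in> {1..N}" and cond: "f m < br d \<and> f d < br m \<or> br d \<le> f m \<or> d < Suc m \<and> br m \<le> f d" for d
    proof (cases "br d \<le> f m")
      case True
      then show ?thesis using g[OF d] unfolding w_def by auto
    next
      case False
      then have "f m < br d" by simp
      moreover have "f d < br m \<or> d < m \<and> br m \<le> f d" using cond False by (cases "d = m") auto
      ultimately show ?thesis using unch[OF d] eq'[OF m d] by auto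
    qed
    show ?thesis
    proof (rule exI[of _ w], intro conjI ballI allI impI)
      fix c assume c: "c \<in> {1..N}"
      show "leads c (w c)" using v'(1)[OF c] y fN unfolding w_def leads_def by auto
      fix k assume "f c < k"
      then show "w c k = v c k" using v'(2)[OF c] y unfolding w_def by auto
    next
      fix c d assume c: "c \<in> {1..N}" and d: "d \<in> {1..N}"
        and cond: "f c < br d \<and> f d < br c \<or> c < Suc m \<and> br d \<le> f c \<or> d < Suc m \<and> br c \<le> f d"
      consider "c = m" | "d = m" | "c \<noteq> m" "d \<noteq> m" by blast
      then show "form (w c) (w d) = form (t c) (t d)"
      proof cases
        case 1
        then show ?thesis using pair_m[OF d] cond by auto
      next
        case 2
        then have "form (w d) (w c) = form (t d) (t c)" using pair_m[OF c] cond by auto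
        then show ?thesis using form_sym[of "w c" "w d"] form_sym[of "t c" "t d"] by simp
      next
        case 3
        then show ?thesis using eq'[OF c d] cond unfolding w_def by auto
      qed
    qed
  qed
qed

text \<open>\<open>f c\<close> is the level up to which the image of \<open>t c\<close> is left
  free. After the corrections the matrices with columns \<open>t c\<close> and \<open>v' c\<close>
  have the same Gram matrix, so the quotient of the second by the first is an isometry, and it is
  unitriangular as both matrices are.\<close>

lemma witt:
  assumes v: "\<And>c. c \<in> {1..N} \<Longrightarrow> leads c (v c)" and t: "\<And>c. c \<in> {1..N} \<Longrightarrow> leads c (t c)"
    and f: "\<And>c. c \<in> {1..N} \<Longrightarrow> f c < c"
    and eq: "\<And>c d. c \<in> {1..N} \<Longrightarrow> d \<in> {1..N} \<Longrightarrow> f c < br d \<Longrightarrow> f d < br c \<Longrightarrow> form (v c) (v d) = form (t c) (t d)"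
  shows "\<exists>w\<in>carrier (Ugrp T n). \<forall>c\<in>{1..N}. \<forall>k\<in>{1..N}. f c < k \<longrightarrow> mat_vec w (t c) k = v c k"
proof -
  from witt_induct[OF v t f eq, where m = "Suc N"]
  obtain v' where v'': "\<forall>c\<in>{1..N}. leads c (v' c) \<and> (\<forall>k>f c. v' c k = v c k)"
    and eq'': "\<forall>c\<in>{1..N}. \<forall>d\<in>{1..N}. f c < br d \<and> f d < br c \<or> c < Suc N \<and> br d \<le> f c \<or> d < Suc N \<and> br c \<le> f d \<longrightarrow>
      form (v' c) (v' d) = form (t c) (t d)" by blast
  have v': "leads c (v' c)" "f c < k \<Longrightarrow> v' c k = v c k" if "c \<in> {1..N}" for c k using v'' that by blast+
  have eq': "form (v' c) (v' d) = form (t c) (t d)" if cd: "c \<in> {1..N}" "d \<in> {1..N}" for c d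
  proof (rule eq''[rule_format, OF cd])
    show "f c < br d \<and> f d < br c \<or> c < Suc N \<and> br d \<le> f c \<or> d < Suc N \<and> br c \<le> f d"
      using cd by (cases "br d \<le> f c"; cases "br c \<le> f d") auto
  qed
  let ?S = "form_mat T n :: 'a mat"
  define M M' where "M = mat_of N (\<lambda>k c. t c k)" and "M' = mat_of N (\<lambda>k c. v' c k)"
  have M: "M \<in> unitriangular T n" unfolding M_def
    by (rule unitriangularI) (use t in \<open>auto simp: ent_mat_of leads_def\<close>)
  have M': "M' \<in> unitriangular T n" unfolding M'_def
    by (rule unitriangularI) (use v'(1) in \<open>auto simp: ent_mat_of leads_def\<close>)
  note MI = GL_inv_unitriangular[OF M]
  have car: "M \<in> carrier_mat N N" "M' \<in> carrier_mat N N" "ginv M \<in> carrier_mat N N"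
    using unitriangularD(1) M M' MI(1) by auto
  have gram: "transpose_mat M' * ?S * M' = transpose_mat M * ?S * M"
  proof (rule ent_eqI)
    fix c d assume cd: "c \<in> {1..N}" "d \<in> {1..N}"
    have "form (\<lambda>k. ent M' k c) (\<lambda>k. ent M' k d) = form (v' c) (v' d)"
      by (rule form_cong) (use cd in \<open>simp_all add: M'_def ent_mat_of\<close>)
    moreover have "form (\<lambda>k. ent M k c) (\<lambda>k. ent M k d) = form (t c) (t d)"
      by (rule form_cong) (use cd in \<open>simp_all add: M_def ent_mat_of\<close>)
    ultimately show "ent (transpose_mat M' * ?S * M') c d = ent (transpose_mat M * ?S * M) c d"
      unfolding ent_gram[OF car(1) cd] ent_gram[OF car(2) cd] using eq'[OF cd] by simp
  qed (use car form_mat_carrier in auto)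
  define w where "w = M' * ginv M"
  have wu: "w \<in> unitriangular T n" unfolding w_def by (rule unitriangular_mult[OF M' MI(1)])
  note as = assoc_mult_mat[of _ N N _ N _ N]
  have "transpose_mat w * ?S * w = transpose_mat (ginv M) * (transpose_mat M' * ?S * M') * ginv M"
    unfolding w_def using car form_mat_carrier by (simp add: as transpose_mult[of _ N N _ N])
  also have "\<dots> = transpose_mat (M * ginv M) * ?S * (M * ginv M)"
    unfolding gram using car form_mat_carrier by (simp add: as transpose_mult[of _ N N _ N])
  also have "\<dots> = ?S" unfolding MI(2) using form_mat_carrier by simp
  finally have wU: "w \<in> carrier (Ugrp T n)"
    using wu unitriangular_GL[OF wu] by (simp add: Ugrp_simps isometries_def)
  have wM: "w * M = M'" unfolding w_def using car MI(3) by (simp add: as)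
  have "mat_vec w (t c) k = v c k" if c: "c \<in> {1..N}" and k: "k \<in> {1..N}" and fk: "f c < k" for c k
  proof -
    have "mat_vec w (t c) k = ent (w * M) k c"
      unfolding mat_vec_def ent_mult[OF unitriangularD(1)[OF wu] car(1) k c]
      by (rule sum.cong[OF refl]) (use c in \<open>simp add: M_def ent_mat_of\<close>)
    also have "\<dots> = v' c k" unfolding wM M'_def by (rule ent_mat_of[OF k c])
    finally show ?thesis using v'(2)[OF c fk] by simp
  qed
  then show ?thesis using wU by blast
qed

end

section \<open>Characters with the verge of a basic set\<close>

locale basic_setting = odd_setting T n \<theta>
  for T :: classical_type and n :: nat and \<theta> :: "'a::{field,finite} \<Rightarrow> complex" +
  fixes D :: "(nat \<times> nat) set" and \<Phi> :: "nat \<times> nat \<Rightarrow> 'a"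
  assumes basic: "basic_set T n D" and Phi: "\<forall>ij\<in>D \<inter> Pos T n. \<Phi> ij \<noteq> 0"
begin

abbreviation "S \<equiv> D \<inter> Pos T n"
abbreviation "A0 \<equiv> A_of T n D \<Phi>"

lemma S_Pos: "(i, j) \<in> S \<Longrightarrow> (i, j) \<in> Pos T n"
  by simp

lemma S_Phi: "(i, j) \<in> S \<Longrightarrow> \<Phi> (i, j) \<noteq> 0"
  using Phi by blast

lemma S_range:
  assumes "(i, j) \<in> S" shows "i \<in> {1..N}" "j \<in> {1..N}" "i < j"
  using Pos_range[OF S_Pos[OF assms]] PosD[OF S_Pos[OF assms]] by auto

lemma D_row: "(i, j) \<in> D \<Longrightarrow> (i, k) \<in> D \<Longrightarrow> j = k"
  using basic inj_onD[of fst D "(i, j)" "(i, k)"] unfolding basic_set_def by simp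

lemma S_row: "(i, j) \<in> S \<Longrightarrow> (i, k) \<in> S \<Longrightarrow> j = k"
  using D_row by blast

lemma S_col: "(i, j) \<in> S \<Longrightarrow> (h, j) \<in> S \<Longrightarrow> i = h"
  using basic inj_onD[of snd D "(i, j)" "(h, j)"] unfolding basic_set_def by simp

lemma finite_S: "finite S"
  using finite_Pos by auto

text \<open>Row \<open>br j\<close> of the basic set is occupied by the mirror image of
  \<open>(i, j)\<close>. If that row also meets \<open>Pos\<close>, the mirror image itself lies in
  \<open>Pos\<close>, which happens only on the antidiagonal. This keeps main conditions out of
  arms.\<close>

lemma S_mirror_row:
  assumes ij: "(i, j) \<in> S" and hk: "(br j, k) \<in> S"
  shows "j = br i"
proof -
  have "(br j, br i) \<in> D"
    using ij basic S_range[OF ij] unfolding basic_set_def by blast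
  then have "k = br i" using hk D_row by blast
  then have "br i \<le> br (br j)" using PosD[OF S_Pos[OF hk]] by simp
  then have "br i \<le> j" using bar_bar[OF S_range(2)[OF ij]] by simp
  then show ?thesis using PosD[OF S_Pos[OF ij]] by simp
qed

lemma A0_Vsp: "A0 \<in> V"
  unfolding Vsp_def A_of_def by (auto simp: ent_mat_of)

lemma ent_A0: "i \<in> {1..N} \<Longrightarrow> j \<in> {1..N} \<Longrightarrow> ent A0 i j = (if (i, j) \<in> S then \<Phi> (i, j) else 0)"
  unfolding A_of_def by (rule ent_mat_of)

text \<open>Having verge \<open>A0\<close>, expressed row by row without mention of rightmost
  entries; in this form it is easily seen to persist under the action.\<close>

definition shape :: "'a mat \<Rightarrow> bool"
  where "shape B \<longleftrightarrow> (\<forall>i j. (i, j) \<in> S \<longrightarrow> ent B i j = \<Phi> (i, j)) \<and>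
    (\<forall>i k. (i, k) \<in> Pos T n \<longrightarrow> ent B i k \<noteq> 0 \<longrightarrow> (\<exists>j\<ge>k. (i, j) \<in> S))"

lemma main_conds_Vsp:
  assumes B: "B \<in> V" and p: "(i, k) \<in> Pos T n" "ent B i k \<noteq> 0"
  shows "\<exists>j\<ge>k. (i, j) \<in> main_conds T n B"
proof -
  let ?K = "{j. (i, j) \<in> Pos T n \<and> ent B i j \<noteq> 0}"
  have fin: "finite ?K" by (rule finite_subset[of _ "{1..N}"]) (use Pos_range in auto)
  define j where "j = Max ?K"
  have j: "j \<in> ?K" unfolding j_def by (rule Max_in[OF fin]) (use p in auto)
  have "ent B i l = 0" if l: "j < l" "l \<le> N" for l
  proof (rule ccontr)
    assume nz: "ent B i l \<noteq> 0"
    have "(i, l) \<in> Pos T n"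
      by (rule ccontr) (use nz VspD(2)[OF B, of i l] Pos_range(1)[OF p(1)] l in auto)
    then show False using Max_ge[OF fin, of l] nz l unfolding j_def by auto
  qed
  moreover have "k \<le> j" unfolding j_def by (rule Max_ge[OF fin]) (use p in auto)
  ultimately show ?thesis using j unfolding main_conds_def by auto
qed

lemma shape_main_conds:
  assumes B: "B \<in> V" and s: "shape B"
  shows "main_conds T n B = S"
proof (intro equalityI subrelI)
  fix i j assume ij: "(i, j) \<in> main_conds T n B"
  then have p: "(i, j) \<in> Pos T n" and nz: "ent B i j \<noteq> 0"
    and z: "\<And>k. j < k \<Longrightarrow> k \<le> N \<Longrightarrow> ent B i k = 0" unfolding main_conds_def by auto
  from s p nz obtain k where k: "k \<ge> j" "(i, k) \<in> S" unfolding shape_def by blast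
  have "ent B i k \<noteq> 0" using s k(2) S_Phi[OF k(2)] unfolding shape_def by auto
  then have "k = j" using z[of k] k S_range(2)[OF k(2)] by fastforce
  then show "(i, j) \<in> S" using k by simp
next
  fix i j assume ij: "(i, j) \<in> S"
  have "ent B i k = 0" if k: "j < k" "k \<le> N" for k
  proof (rule ccontr)
    assume nz: "ent B i k \<noteq> 0"
    have "(i, k) \<in> Pos T n"
      by (rule ccontr) (use nz VspD(2)[OF B, of i k] S_range[OF ij] k in auto)
    then obtain l where "l \<ge> k" "(i, l) \<in> S" using s nz unfolding shape_def by blast
    then show False using S_row[OF ij] k by auto
  qed
  then show "(i, j) \<in> main_conds T n B"
    using ij s S_Phi[OF ij] unfolding main_conds_def shape_def by auto
qed

lemma verge_iff:
  assumes B: "B \<in> V"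
  shows "verge T n B = A0 \<longleftrightarrow> shape B"
proof
  assume v: "verge T n B = A0"
  have e: "(if (i, j) \<in> main_conds T n B then ent B i j else 0) = (if (i, j) \<in> S then \<Phi> (i, j) else 0)"
    if "i \<in> {1..N}" "j \<in> {1..N}" for i j
    using arg_cong[OF v, of "\<lambda>M. ent M i j"] ent_A0[OF that] that by (simp add: verge_def ent_mat_of)
  show "shape B" unfolding shape_def
  proof (intro conjI allI impI)
    fix i j assume ij: "(i, j) \<in> S"
    show "ent B i j = \<Phi> (i, j)" using e[OF S_range(1,2)[OF ij]] ij S_Phi[OF ij] by (simp split: if_splits)
  next
    fix i k assume p: "(i, k) \<in> Pos T n" "ent B i k \<noteq> 0"
    from main_conds_Vsp[OF B p] obtain j where j: "j \<ge> k" "(i, j) \<in> main_conds T n B" by blast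
    then have "(i, j) \<in> Pos T n" "ent B i j \<noteq> 0" unfolding main_conds_def by auto
    then have "(i, j) \<in> S" using e[of i j] j Pos_range by (metis (full_types))
    then show "\<exists>j\<ge>k. (i, j) \<in> S" using j by blast
  qed
next
  assume s: "shape B"
  show "verge T n B = A0"
    unfolding verge_def shape_main_conds[OF B s]
    by (rule ent_eqI[OF _ VspD(1)[OF A0_Vsp]])
      (use s in \<open>auto simp: ent_mat_of ent_A0 shape_def simp del: atLeastAtMost_iff\<close>)
qed

abbreviation "VA \<equiv> {B \<in> V. verge T n B = A0}"

lemma VAD:
  assumes "B \<in> VA"
  shows "B \<in> V" "shape B" "main_conds T n B = S"
  using assms verge_iff shape_main_conds by auto

lemma VAI: "B \<in> V \<Longrightarrow> shape B \<Longrightarrow> B \<in> VA"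
  using verge_iff by auto

lemma A0_VA: "A0 \<in> VA"
proof (rule VAI[OF A0_Vsp])
  show "shape A0"
    unfolding shape_def using ent_A0 Pos_range by (metis order_refl S_Pos)
qed

lemma VA_ent_main: "B \<in> VA \<Longrightarrow> (i, j) \<in> S \<Longrightarrow> ent B i j = \<Phi> (i, j)"
  using VAD(2) unfolding shape_def by blast

lemma VA_ent_zero:
  assumes B: "B \<in> VA" and r: "i \<in> {1..N}" "k \<in> {1..N}"
    and z: "\<And>j. (i, j) \<in> S \<Longrightarrow> \<not> (i < k \<and> k \<le> j)"
  shows "ent B i k = 0"
proof (cases "(i, k) \<in> Pos T n")
  case True
  then have "i < k" using PosD by blast
  then show ?thesis using VAD(2)[OF B] True z unfolding shape_def by blast
qed (rule VspD(2)[OF VAD(1)[OF B] r])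

lemma VA_eqI:
  assumes B: "B \<in> VA" and C: "C \<in> VA"
    and e: "\<And>i j k. (i, j) \<in> S \<Longrightarrow> i < k \<Longrightarrow> k \<le> j \<Longrightarrow> ent B i k = ent C i k"
  shows "B = C"
proof (rule Vsp_eqI[OF VAD(1)[OF B] VAD(1)[OF C]])
  fix i k assume "(i, k) \<in> Pos T n"
  then have r: "i \<in> {1..N}" "k \<in> {1..N}" using Pos_range by blast+
  show "ent B i k = ent C i k"
  proof (cases "\<exists>j. (i, j) \<in> S \<and> i < k \<and> k \<le> j")
    case False
    then show ?thesis using VA_ent_zero[OF B r] VA_ent_zero[OF C r] by auto
  qed (use e in blast)
qed

text \<open>Limbs depend on the main conditions only, and these are \<open>S\<close> throughout
  \<open>VA\<close>. Legs are handled by distinct columns, arms by \<open>S_mirror_row\<close>, and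
  the arm of an antidiagonal position by distinct rows.\<close>

lemma VA_main_separated: "B \<in> VA \<Longrightarrow> main_separated T n B"
proof -
  assume B: "B \<in> VA"
  have "x \<notin> S" if ij: "(i, j) \<in> S" and x: "x \<in> leg_set T n (i, j) \<union> arm_set T n (i, j)" for i j x
  proof
    assume xS: "x \<in> S"
    show False
    proof (cases "x \<in> leg_set T n (i, j)")
      case True
      then show False using xS S_col[OF ij] unfolding leg_set_def by auto
    next
      case False
      then have arm: "x \<in> arm_set T n (i, j)" using x by simp
      show False
      proof (cases "j < br i")
        case True
        then obtain a where "x = (br j, a)" using arm unfolding arm_set_def by auto
        then show False using S_mirror_row[OF ij] xS True by auto
      next
        case False
        then obtain a where "x = (i, a)" "a < br i" using arm unfolding arm_set_def by auto
        then show False using S_row[OF ij] xS False by auto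
      qed
    qed
  qed
  then show ?thesis using VAD[OF B] unfolding main_separated_def limb_set_def by auto
qed

lemma VA_staircase: "B \<in> VA \<Longrightarrow> staircase T n B"
proof -
  assume B: "B \<in> VA"
  have "inj_on snd S"
  proof (rule inj_onI)
    fix x y assume xy: "x \<in> S" "y \<in> S" "snd x = snd y"
    obtain i j h k where e: "x = (i, j)" "y = (h, k)" by (cases x; cases y)
    show "x = y" using S_col[of i j h] xy unfolding e by simp
  qed
  then show ?thesis using VAD[OF B] unfolding staircase_def by simp
qed

lemma A0_verge_character: "verge_character T n A0"
  using A0_VA unfolding verge_character_def by auto

section \<open>Rows of characters as vectors modulo a flag\<close>

definition is_col :: "nat \<Rightarrow> bool" where "is_col c \<longleftrightarrow> (\<exists>i. (i, c) \<in> S)"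
definition row_of :: "nat \<Rightarrow> nat" where "row_of c = (THE i. (i, c) \<in> S)"
text \<open>The default \<open>c - 1\<close> for a column without main condition prescribes nothing
  beyond the leading entry.\<close>

definition lev :: "nat \<Rightarrow> nat" where "lev c = (if is_col c then row_of c else c - 1)"

text \<open>Row \<open>i\<close> of \<open>B\<close> with main condition \<open>(i, c)\<close>, read as a column vector modulo the span of the
  first \<open>lev c = i\<close> unit vectors: the action of \<open>u\<close> on \<open>B\<close> is multiplication by \<open>u\<^sup>-\<^sup>1\<close>.\<close>

definition row_vec :: "'a mat \<Rightarrow> nat \<Rightarrow> nat \<Rightarrow> 'a"
  where "row_vec B c = (if is_col c then (\<lambda>k. if row_of c < k \<and> k \<le> c then ent B (row_of c) k / \<Phi> (row_of c, c) else 0)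
    else basis_vec c)"

lemma row_of: "(i, c) \<in> S \<Longrightarrow> is_col c \<and> row_of c = i \<and> lev c = i"
proof -
  assume ic: "(i, c) \<in> S"
  then have "row_of c = i" unfolding row_of_def using S_col by blast
  then show ?thesis using ic unfolding lev_def is_col_def by auto
qed

lemma row_vec_S: "(i, c) \<in> S \<Longrightarrow> row_vec B c k = (if i < k \<and> k \<le> c then ent B i k / \<Phi> (i, c) else 0)"
  using row_of unfolding row_vec_def by simp

lemma lev_less: "c \<in> {1..N} \<Longrightarrow> lev c < c"
  unfolding lev_def is_col_def using row_of S_range(3) by (auto simp: lev_def)

lemma row_vec_leads: "B \<in> VA \<Longrightarrow> leads c (row_vec B c)"
proof (cases "is_col c")
  case True
  assume B: "B \<in> VA"
  from True obtain i where ic: "(i, c) \<in> S" unfolding is_col_def by blast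
  then show ?thesis using S_range(3)[OF ic] VA_ent_main[OF B ic] S_Phi[OF ic] by (simp add: leads_def row_vec_S)
qed (auto simp: row_vec_def leads_def basis_vec_def)

lemma ent_row_vec:
  assumes B: "B \<in> VA" and ij: "(i, j) \<in> S" and l: "l \<in> {1..N}"
  shows "ent B i l = \<Phi> (i, j) * row_vec B j l"
proof (cases "i < l \<and> l \<le> j")
  case False
  then show ?thesis using VA_ent_zero[OF B S_range(1)[OF ij] l] S_row[OF ij] by (auto simp: row_vec_S[OF ij])
qed (use S_Phi[OF ij] in \<open>simp add: row_vec_S[OF ij]\<close>)

lemma dot_act_row:
  assumes B: "B \<in> VA" and u: "u \<in> unitriangular T n" and ij: "(i, j) \<in> S" and k: "i < k" "k \<le> j"
  shows "ent (dot_act T n B u) i k = \<Phi> (i, j) * mat_vec (ginv u) (row_vec B j) k"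
  unfolding ent_dot_act[OF VAD(1)[OF B] u Pos_left[OF S_Pos[OF ij] k]] mat_vec_def sum_distrib_left
  by (rule sum.cong[OF refl]) (simp only: ent_row_vec[OF B ij] mult_ac)

lemma mat_vec_leads:
  assumes u: "u \<in> unitriangular T n" and c: "c \<in> {1..N}" and x: "leads c x"
  shows "mat_vec u x c = 1"
proof -
  have "mat_vec u x c = (\<Sum>l=1..N. if l = c then 1 else 0)"
    unfolding mat_vec_def
  proof (rule sum.cong[OF refl])
    fix l assume l: "l \<in> {1..N}"
    show "ent u c l * x l = (if l = c then 1 else 0)"
      using unitriangularD(2)[OF u c l] unitriangularD(3)[OF u c] x unfolding leads_def
      by (cases l c rule: linorder_cases) auto
  qed
  then show ?thesis using c by simp
qed

text \<open>Multiplication by the unitriangular matrix u^-1 keeps the leading entry of each row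
  vector and creates nothing beyond it.\<close>

lemma dot_act_VA:
  assumes B: "B \<in> VA" and u: "u \<in> unitriangular T n"
  shows "dot_act T n B u \<in> VA"
proof (rule VAI[OF dot_act_Vsp])
  note w = GL_inv_unitriangular(1)[OF u]
  show "shape (dot_act T n B u)" unfolding shape_def
  proof (intro conjI allI impI)
    fix i j assume ij: "(i, j) \<in> S"
    show "ent (dot_act T n B u) i j = \<Phi> (i, j)"
      using dot_act_row[OF B u ij S_range(3)[OF ij] order_refl] mat_vec_leads[OF w S_range(2)[OF ij] row_vec_leads[OF B]]
      by simp
  next
    fix i k assume p: "(i, k) \<in> Pos T n" and nz: "ent (dot_act T n B u) i k \<noteq> 0"
    then obtain l where l: "l \<in> {1..N}" "ent B i l * ent (ginv u) k l \<noteq> 0"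
      unfolding ent_dot_act[OF VAD(1)[OF B] u p] by (meson sum.neutral)
    then have kl: "k \<le> l" using unitriangularD(2)[OF w Pos_range(2)[OF p] l(1)] by (cases "l < k") auto
    have "\<exists>j. (i, j) \<in> S \<and> i < l \<and> l \<le> j"
      using VA_ent_zero[OF B Pos_range(1)[OF p] l(1)] l(2) by fastforce
    then show "\<exists>j\<ge>k. (i, j) \<in> S" using kl by (meson order_trans)
  qed
qed

text \<open>The reformulation to which \<open>witt\<close> applies: moving one character to another
  means mapping vectors to vectors modulo the flag.\<close>

lemma dot_act_eq_iff:
  assumes B: "B \<in> VA" and C: "C \<in> VA" and u: "u \<in> unitriangular T n"
  shows "dot_act T n B u = C \<longleftrightarrow>
    (\<forall>i j k. (i, j) \<in> S \<longrightarrow> i < k \<longrightarrow> k \<le> j \<longrightarrow> mat_vec (ginv u) (row_vec B j) k = row_vec C j k)" (is "_ \<longleftrightarrow> ?R")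
proof
  assume e: "dot_act T n B u = C"
  show ?R
  proof (intro allI impI)
    fix i j k assume ij: "(i, j) \<in> S" and k: "i < k" "k \<le> j"
    show "mat_vec (ginv u) (row_vec B j) k = row_vec C j k"
      using dot_act_row[OF B u ij k] S_Phi[OF ij] k by (simp add: e row_vec_S[OF ij])
  qed
next
  assume R: ?R
  show "dot_act T n B u = C"
  proof (rule VA_eqI[OF dot_act_VA[OF B u] C])
    fix i j k assume ij: "(i, j) \<in> S" and k: "i < k" "k \<le> j"
    then show "ent (dot_act T n B u) i k = ent C i k"
      using dot_act_row[OF B u ij k] S_Phi[OF ij] R by (simp add: row_vec_S[OF ij])
  qed
qed

text \<open>Without a form to preserve, the columns of u^-1 may be chosen freely; the row vectors of
  \<open>C\<close> are taken.\<close>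

lemma Ut_transitive:
  assumes C: "C \<in> VA"
  shows "\<exists>u\<in>unitriangular T n. dot_act T n A0 u = C"
proof -
  define w where "w = mat_of N (\<lambda>k c. row_vec C c k)"
  have w: "w \<in> unitriangular T n" unfolding w_def
    by (rule unitriangularI) (use row_vec_leads[OF C] in \<open>auto simp: ent_mat_of leads_def\<close>)
  note u = GL_inv_unitriangular(1)[OF w]
  have "dot_act T n A0 (ginv w) = C"
    unfolding dot_act_eq_iff[OF A0_VA C u] GL_inv_inv[OF w]
  proof (intro allI impI)
    fix i j k assume ij: "(i, j) \<in> S" and k: "i < k" "k \<le> j"
    note r = S_range[OF ij]
    have kN: "k \<in> {1..N}" using r k by auto
    have "row_vec A0 j l = basis_vec j l" if "l \<in> {1..N}" for l
    proof (cases "l = j")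
      case True
      then show ?thesis using VA_ent_main[OF A0_VA ij] S_Phi[OF ij] r(3) by (simp add: row_vec_S[OF ij] basis_vec_def)
    next
      case False
      then have "(i, l) \<notin> S" using S_row[OF ij] by blast
      then have "ent A0 i l = 0" using ent_A0[OF r(1) that] by (simp only: if_False)
      then show ?thesis using False unfolding row_vec_S[OF ij] basis_vec_def by simp
    qed
    then have "mat_vec w (row_vec A0 j) k = mat_vec w (basis_vec j) k"
      unfolding mat_vec_def by (intro sum.cong refl) simp
    also have "\<dots> = row_vec C j k" unfolding mat_vec_basis[OF r(2)] unfolding w_def by (rule ent_mat_of[OF kN r(2)])
    finally show "mat_vec w (row_vec A0 j) k = row_vec C j k" .
  qed
  then show ?thesis using u by blast
qed

lemma Ut_orbit_VA: "Ut_orbit T n \<theta> A0 = chr T n \<theta> ` VA"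
  unfolding Ut_orbit_def Utilde_simps using Ut_transitive dot_act_VA[OF A0_VA] by auto

lemma Ut_orbit_module_verge: "Ut_orbit_module T n \<theta> A0 = verge_module T n \<theta> A0"
proof -
  have "verge T n A0 = A0" using A0_VA by simp
  then show ?thesis unfolding Ut_orbit_module_def verge_module_def Ut_orbit_VA by simp
qed

lemma VA_chr_indep: "indep_family (chr T n \<theta>) VA"
  by (rule indep_family_subset[OF chr_indep]) auto

section \<open>Orbits of the isometry group and core characters\<close>

text \<open>\<open>witt\<close> with levels \<open>lev\<close>. Among the pairs it asks about, those
  with \<open>c < br d\<close> are orthogonal and those with \<open>c = br d\<close> have a value
  fixed by the leading entries. If \<open>br d < c\<close>, then \<open>lev c < br d\<close> rules
  out the default level, and likewise for \<open>d\<close>, so both are columns of main conditions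
  and \<open>eq\<close> applies.\<close>

lemma forms_imp_same_orbit:
  assumes B: "B \<in> VA" and C: "C \<in> VA"
    and eq: "\<And>i c h d. (i, c) \<in> S \<Longrightarrow> (h, d) \<in> S \<Longrightarrow> i < br d \<Longrightarrow> h < br c \<Longrightarrow> br d < c \<Longrightarrow>
      form (row_vec C c) (row_vec C d) = form (row_vec B c) (row_vec B d)"
  shows "\<exists>u\<in>carrier (Ugrp T n). dot_act T n B u = C"
proof -
  have "\<exists>w\<in>carrier (Ugrp T n). \<forall>c\<in>{1..N}. \<forall>k\<in>{1..N}. lev c < k \<longrightarrow> mat_vec w (row_vec B c) k = row_vec C c k"
  proof (rule witt)
    fix c d assume c: "c \<in> {1..N}" and d: "d \<in> {1..N}" and l: "lev c < br d" "lev d < br c"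
    have z: "row_vec M c' k = 0" if "M \<in> VA" "c' < k" for M c' k
      using row_vec_leads[OF that(1)] that(2) unfolding leads_def by blast
    consider "br d < c" | "c < br d" | "c = br d" by linarith
    then show "form (row_vec C c) (row_vec C d) = form (row_vec B c) (row_vec B d)"
    proof cases
      case 1
      then have "br c < d" using c d by (auto simp: bar_def)
      then obtain i h where ih: "(i, c) \<in> S" "(h, d) \<in> S"
        using 1 l unfolding lev_def is_col_def by (auto split: if_splits)
      then show ?thesis using eq[OF ih] l 1 row_of by metis
    next
      case 2
      then show ?thesis using form_eq_0[of c _ d] z[OF B] z[OF C] d by (metis (no_types, lifting))
    next
      case 3
      have "form (row_vec M c) (row_vec M d) = sgn_at (br d)" if M: "M \<in> VA" for M
        using form_leading[of d "row_vec M c" "row_vec M d", OF z[OF M] z[OF M] d]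
          row_vec_leads[OF M] 3 unfolding leads_def by simp
      then show ?thesis using B C by simp
    qed
  qed (use row_vec_leads B C lev_less in auto)
  then obtain w where w: "w \<in> carrier (Ugrp T n)"
    and e: "\<And>c k. c \<in> {1..N} \<Longrightarrow> k \<in> {1..N} \<Longrightarrow> lev c < k \<Longrightarrow> mat_vec w (row_vec B c) k = row_vec C c k" by blast
  have wu: "w \<in> unitriangular T n" using w Ugrp_subset by blast
  have "dot_act T n B (ginv w) = C"
    unfolding dot_act_eq_iff[OF B C GL_inv_unitriangular(1)[OF wu]] GL_inv_inv[OF wu]
  proof (intro allI impI)
    fix i j k assume ij: "(i, j) \<in> S" and k: "i < k" "k \<le> j"
    show "mat_vec w (row_vec B j) k = row_vec C j k"
      by (rule e[OF S_range(2)[OF ij]]) (use S_range[OF ij] k row_of[OF ij] in auto)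
  qed
  then show ?thesis using Ugrp_inv_closed[OF w] by blast
qed

text \<open>The new row vectors are the old ones multiplied by u^-1, up to errors \<open>r c\<close>
  supported at indices up to the row numbers. The isometry preserves the form, and
  \<open>i < br d\<close> and \<open>h < br c\<close> make all terms with an error vanish.\<close>

lemma orbit_invariant:
  assumes B: "B \<in> VA" and u: "u \<in> carrier (Ugrp T n)"
    and ic: "(i, c) \<in> S" and hd: "(h, d) \<in> S" and l: "i < br d" "h < br c"
  shows "form (row_vec (dot_act T n B u) c) (row_vec (dot_act T n B u) d) = form (row_vec B c) (row_vec B d)"
proof -
  let ?C = "dot_act T n B u"
  have uu: "u \<in> unitriangular T n" using u Ugrp_subset by blast
  have C: "?C \<in> VA" by (rule dot_act_VA[OF B uu])
  note w = GL_inv_unitriangular(1)[OF uu]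
  define r where "r c = (\<lambda>k. mat_vec (ginv u) (row_vec B c) k - row_vec ?C c k)" for c
  have r: "mat_vec (ginv u) (row_vec B c) = row_vec ?C c + r c" for c
    unfolding r_def by (simp add: fun_eq_iff)
  have rz: "r c k = 0" if ic: "(i, c) \<in> S" and k: "k \<in> {1..N}" "i < k" for i c k
  proof (cases "k \<le> c")
    case True
    then show ?thesis using dot_act_eq_iff[OF B C uu] ic k unfolding r_def by simp
  next
    case False
    have "ent (ginv u) k l * row_vec B c l = 0" if l: "l \<in> {1..N}" for l
      using unitriangularD(2)[OF w k(1) l] row_vec_leads[OF B, of c] False unfolding leads_def
      by (cases "l < k") auto
    then have "mat_vec (ginv u) (row_vec B c) k = 0" unfolding mat_vec_def by (intro sum.neutral ballI)
    then show ?thesis using row_vec_leads[OF C, of c] False unfolding r_def leads_def by simp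
  qed
  have cz: "row_vec ?C c k = 0" if "c < k" for c k
    using row_vec_leads[OF C] that unfolding leads_def by blast
  have "form (row_vec B c) (row_vec B d) = form (row_vec ?C c + r c) (row_vec ?C d + r d)"
    using form_mat_vec[OF Ugrp_inv_closed[OF u]] r by metis
  also have "\<dots> = form (row_vec ?C c) (row_vec ?C d) + form (r c) (row_vec ?C d)
      + (form (row_vec ?C c) (r d) + form (r c) (r d))"
    by (simp add: form_add)
  also have "form (r c) (row_vec ?C d) = 0"
    by (rule form_eq_0[of i _ d]) (use rz[OF ic] cz l S_range[OF hd] in auto)
  also have "form (row_vec ?C c) (r d) = 0"
  proof -
    have "form (r d) (row_vec ?C c) = 0"
      by (rule form_eq_0[of h _ c]) (use rz[OF hd] cz l S_range[OF ic] in auto)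
    then show ?thesis using form_sym[of "row_vec ?C c" "r d"] by simp
  qed
  also have "form (r c) (r d) = 0"
    by (rule form_eq_0[of i _ d]) (use rz[OF ic] rz[OF hd] l S_range[OF hd] in auto)
  finally show ?thesis by simp
qed

text \<open>\<open>link i c h d\<close> says that \<open>(h, br c)\<close> is a supplementary condition: it lies in the column of the
  minor condition \<open>(i, br c)\<close>, to the left of the minor or left main condition of row \<open>h\<close>.\<close>

definition link :: "nat \<Rightarrow> nat \<Rightarrow> nat \<Rightarrow> nat \<Rightarrow> bool"
  where "link i c h d \<longleftrightarrow> (i, c) \<in> S \<and> (h, d) \<in> S \<and> br c < c \<and> h < br c \<and>
    (if br d < d then br c < br d else br c < d)"

text \<open>Right main conditions lie strictly beyond the middle; in type B the middle column is its
  own mirror image and counts as left.\<close>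

lemma ntilde_iff: "k \<in> {1..N} \<Longrightarrow> ntilde T n < k \<longleftrightarrow> br k < k"
  by (auto simp: ntilde_def bar_def dimN_def)

lemma br_low: "k \<in> {1..N} \<Longrightarrow> br k < k \<Longrightarrow> br k \<le> n \<and> n < k"
  by (auto simp: bar_def dimN_def split: if_splits)

lemma low_br: "k \<in> {1..N} \<Longrightarrow> k \<le> n \<Longrightarrow> n < br k"
  by (auto simp: bar_def dimN_def split: if_splits)

lemma minor_iff: "B \<in> VA \<Longrightarrow> (i, k) \<in> minor_conds T n B \<longleftrightarrow> (\<exists>c. (i, c) \<in> S \<and> br c < c \<and> k = br c)"
  unfolding minor_conds_def using VAD(3) ntilde_iff S_range(2) by blast

text \<open>Besides locating the position, it puts a linked pair among those to which
  \<open>orbit_invariant\<close> and \<open>forms_imp_same_orbit\<close> apply.\<close>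

lemma link_left:
  assumes l: "link i c h d"
  shows "br c < d" "(h, br c) \<in> Pos T n" "(h, br c) \<notin> S" "i < br d" "br d < c"
proof -
  from l have ic: "(i, c) \<in> S" and hd: "(h, d) \<in> S" and c: "br c < c" and h: "h < br c"
    and dd: "if br d < d then br c < br d else br c < d" unfolding link_def by auto
  note rc = S_range[OF ic] and rd = S_range[OF hd]
  show lt: "br c < d" using dd by (auto split: if_splits)
  show "(h, br c) \<in> Pos T n" by (rule Pos_left[OF S_Pos[OF hd] h]) (use lt in simp)
  show "(h, br c) \<notin> S" using S_row[OF hd] lt by blast
  have "i \<le> br c" using PosD[OF S_Pos[OF ic]] rc by (auto simp: bar_def)
  then show "i < br d" using dd lt by (auto split: if_splits)
  show "br d < c" using lt rc rd by (auto simp: bar_def)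
qed

text \<open>The two cases in \<open>link\<close> reflect what bounds the supplementary condition on
  the right: the minor condition in column \<open>br d\<close>, or the left main condition in column
  \<open>d\<close>.\<close>

lemma supp_iff:
  assumes B: "B \<in> VA"
  shows "(h, k) \<in> supp_conds T n B \<longleftrightarrow> (\<exists>i c d. link i c h d \<and> k = br c)"
proof
  assume "(h, k) \<in> supp_conds T n B"
  then have p: "(h, k) \<in> Pos T n" and ex: "\<exists>k'>k. (h, k') \<in> minor_conds T n B \<or> (h, k') \<in> S \<and> k' \<le> ntilde T n"
    and col: "\<exists>i. (i, k) \<in> minor_conds T n B"
    unfolding supp_conds_def VAD(3)[OF B] by auto
  from col obtain i c where ic: "(i, c) \<in> S" "br c < c" "k = br c" unfolding minor_iff[OF B] by blast
  from ex obtain k' where k': "k < k'" "(h, k') \<in> minor_conds T n B \<or> (h, k') \<in> S \<and> k' \<le> ntilde T n" by blast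
  have "\<exists>d. link i c h d"
    using k'(2)
  proof
    assume "(h, k') \<in> minor_conds T n B"
    then obtain d where "(h, d) \<in> S" "br d < d" "k' = br d" unfolding minor_iff[OF B] by blast
    then show ?thesis using ic k' PosD[OF p] unfolding link_def by (intro exI[of _ d]) auto
  next
    assume "(h, k') \<in> S \<and> k' \<le> ntilde T n"
    then have "(h, k') \<in> S" "\<not> br k' < k'" using ntilde_iff[of k'] S_range(2)[of h k'] by auto
    then show ?thesis using ic k' PosD[OF p] unfolding link_def by (intro exI[of _ k']) auto
  qed
  then show "\<exists>i c d. link i c h d \<and> k = br c" using ic(3) by blast
next
  assume "\<exists>i c d. link i c h d \<and> k = br c"
  then obtain i c d where l: "link i c h d" and k: "k = br c" by blast
  from l have ic: "(i, c) \<in> S" and hd: "(h, d) \<in> S" and c: "br c < c" and h: "h < br c"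
    and dd: "if br d < d then br c < br d else br c < d" unfolding link_def by auto
  have kr: "k \<in> {1..N}" unfolding k by (rule bar_range[OF S_range(2)[OF ic]])
  have "\<not> br k < k" unfolding k bar_bar[OF S_range(2)[OF ic]] using c by simp
  then have "k \<le> ntilde T n" using ntilde_iff[OF kr] by simp
  moreover have "\<exists>k'>k. (h, k') \<in> minor_conds T n B \<or> (h, k') \<in> S \<and> k' \<le> ntilde T n"
  proof (cases "br d < d")
    case True
    then show ?thesis using dd hd k unfolding minor_iff[OF B] by (intro exI[of _ "br d"]) auto
  next
    case False
    then show ?thesis using dd hd k ntilde_iff[OF S_range(2)[OF hd]] by (intro exI[of _ d]) auto
  qed
  moreover have "\<exists>i. (i, k) \<in> minor_conds T n B" unfolding minor_iff[OF B] using ic c k by blast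
  moreover have "(h, k) \<notin> minor_conds T n B"
  proof
    assume "(h, k) \<in> minor_conds T n B"
    then obtain e where e: "(h, e) \<in> S" "br e < e" "k = br e" unfolding minor_iff[OF B] by blast
    then have "e = d" using S_row[OF hd] by blast
    then show False using dd e k by simp
  qed
  ultimately show "(h, k) \<in> supp_conds T n B"
    using link_left(2,3)[OF l] k unfolding supp_conds_def VAD(3)[OF B] by auto
qed

lemma core_iff:
  assumes B: "B \<in> VA"
  shows "core_character T n B \<longleftrightarrow> (\<forall>h k. (h, k) \<in> Pos T n \<longrightarrow> ent B h k \<noteq> 0 \<longrightarrow>
    (h, k) \<in> S \<or> (\<exists>i c d. link i c h d \<and> k = br c) \<or> T \<noteq> TypeC \<and> (\<exists>c. (h, c) \<in> S \<and> br c < c \<and> k = br c))" (is "_ \<longleftrightarrow> ?R")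
proof -
  have c: "(h, k) \<in> core_conds T n B \<longleftrightarrow> (h, k) \<in> S \<or> (\<exists>i c d. link i c h d \<and> k = br c) \<or>
      T \<noteq> TypeC \<and> (\<exists>c. (h, c) \<in> S \<and> br c < c \<and> k = br c)" for h k
    unfolding core_conds_def VAD(3)[OF B] using supp_iff[OF B, of h k] minor_iff[OF B, of h k] by auto
  have "{(i, j). i \<in> {1..N} \<and> j \<in> {1..N} \<and> ent B i j \<noteq> 0} = {(i, j). (i, j) \<in> Pos T n \<and> ent B i j \<noteq> 0}"
    using VspD(2)[OF VAD(1)[OF B]] Pos_range by blast
  then have "core_character T n B \<longleftrightarrow> (\<forall>h k. (h, k) \<in> Pos T n \<longrightarrow> ent B h k \<noteq> 0 \<longrightarrow> (h, k) \<in> core_conds T n B)"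
    unfolding core_character_def using VA_staircase[OF B] by blast
  then show ?thesis unfolding c .
qed

abbreviation "cores \<equiv> {B \<in> V. core_character T n B \<and> verge T n B = A0}"

text \<open>All these columns are of the form \<open>br c\<close> with \<open>br c < c\<close>, so
  they do not exceed \<open>n\<close>; in particular the middle column of type B does not
  occur.\<close>

lemma core_support:
  assumes B: "B \<in> cores" and hd: "(h, d) \<in> S" and nz: "row_vec B d k \<noteq> 0" and k: "k \<noteq> d"
  shows "k \<le> n" and "(\<exists>i c. link i c h d \<and> k = br c) \<or> T \<noteq> TypeC \<and> br d < d \<and> k = br d"
proof -
  have hk: "h < k" "k \<le> d" "ent B h k \<noteq> 0" using nz by (auto simp: row_vec_S[OF hd] split: if_splits)
  have p: "(h, k) \<in> Pos T n" by (rule Pos_left[OF S_Pos[OF hd] hk(1,2)])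
  have "(h, k) \<notin> S" using S_row[OF hd] k by blast
  then have "(\<exists>i c d'. link i c h d' \<and> k = br c) \<or> T \<noteq> TypeC \<and> (\<exists>c. (h, c) \<in> S \<and> br c < c \<and> k = br c)"
    using B core_iff[of B] p hk(3) by blast
  then show **: "(\<exists>i c. link i c h d \<and> k = br c) \<or> T \<noteq> TypeC \<and> br d < d \<and> k = br d"
    using S_row[OF hd] unfolding link_def by metis
  then show "k \<le> n"
    using br_low[OF S_range(2)] hd unfolding link_def by metis
qed

text \<open>Apart from the leading entry, the vectors of a core character are supported on the totally
  isotropic span of the first \<open>n\<close> unit vectors.\<close>

lemma core_form:
  assumes B: "B \<in> cores" and ic: "(i, c) \<in> S" and hd: "(h, d) \<in> S" and ne: "c \<noteq> br d"
  shows "form (row_vec B c) (row_vec B d) = sgn_at c * row_vec B d (br c) + sgn_at (br d) * row_vec B c (br d)"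
proof -
  note rc = S_range(2)[OF ic] and rd = S_range(2)[OF hd]
  have l: "row_vec B c c = 1" "row_vec B d d = 1" using row_vec_leads B unfolding leads_def by auto
  have "form (row_vec B c) (row_vec B d) = (\<Sum>k\<in>{c, br d}. row_vec B c k * sgn_at k * row_vec B d (br k))"
    unfolding form_def
  proof (rule sum.mono_neutral_right)
    show "{c, br d} \<subseteq> {1..N}" using rc bar_range[OF rd] by blast
    show "\<forall>k\<in>{1..N} - {c, br d}. row_vec B c k * sgn_at k * row_vec B d (br k) = 0"
    proof (rule ballI, rule ccontr)
      fix k assume k: "k \<in> {1..N} - {c, br d}" and "row_vec B c k * sgn_at k * row_vec B d (br k) \<noteq> 0"
      then have nz: "row_vec B c k \<noteq> 0" "row_vec B d (br k) \<noteq> 0" by auto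
      have "br k \<noteq> d" using k bar_bar[of k T n] by auto
      then have "k \<le> n" "br k \<le> n" using core_support(1)[OF B ic nz(1)] core_support(1)[OF B hd nz(2)] k by auto
      then show False using low_br[of k] k by auto
    qed
  qed simp
  also have "\<dots> = sgn_at c * row_vec B d (br c) + sgn_at (br d) * row_vec B c (br d)"
    using ne l bar_bar[OF rd] by (simp add: mult_ac)
  finally show ?thesis .
qed

text \<open>Of the two entries in \<open>core_form\<close>, the second could be nonzero only if the
  link also held in the opposite direction, and the order of \<open>br c\<close> and
  \<open>br d\<close> forbids that. Hence the form reveals the supplementary entry.\<close>

lemma core_form_link:
  assumes B: "B \<in> cores" and l: "link i c h d"
  shows "form (row_vec B c) (row_vec B d) = sgn_at c * row_vec B d (br c)"
proof -
  from l have ic: "(i, c) \<in> S" and hd: "(h, d) \<in> S" and c: "br c < c" and h: "h < br c"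
    and dd: "if br d < d then br c < br d else br c < d" unfolding link_def by auto
  have ne: "c \<noteq> br d" using link_left(5)[OF l] by simp
  have bi: "br e = br f \<Longrightarrow> e = f" if "e \<in> {1..N}" "f \<in> {1..N}" for e f
    using bar_bar[OF that(1)] bar_bar[OF that(2)] by metis
  have "row_vec B c (br d) = 0"
  proof (rule ccontr)
    assume nz: "row_vec B c (br d) \<noteq> 0"
    have "(\<exists>i' c'. link i' c' i c \<and> br d = br c') \<or> T \<noteq> TypeC \<and> br c < c \<and> br d = br c"
      by (rule core_support(2)[OF B ic nz]) (use ne in simp)
    then show False
    proof
      assume "\<exists>i' c'. link i' c' i c \<and> br d = br c'"
      then obtain i' c' where l': "link i' c' i c" "br d = br c'" by blast
      then have "c' = d" using bi[of d c'] S_range(2)[OF hd] S_range(2)[of i' c'] unfolding link_def by auto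
      moreover have "br c' < c'" "br c' < br c" using l'(1) c unfolding link_def by simp_all
      ultimately have "br d < d" "br d < br c" by blast+
      then show False using dd by (simp only: if_True)
    next
      assume "T \<noteq> TypeC \<and> br c < c \<and> br d = br c"
      then have "d = c" using bi[OF S_range(2)[OF hd] S_range(2)[OF ic]] by blast
      then show False using dd c by simp
    qed
  qed
  then show ?thesis using core_form[OF B ic hd ne] by simp
qed

text \<open>Every free entry of a core can be read off from an orbit invariant: a supplementary
  entry from the form of a linked pair, a minor entry (types B and D) from the norm of its row
  vector, which is twice that entry.\<close>

lemma core_unique:
  assumes B: "B \<in> cores" and u: "u \<in> carrier (Ugrp T n)" and C: "dot_act T n B u \<in> cores"
  shows "dot_act T n B u = B"
proof (rule VA_eqI)
  let ?C = "dot_act T n B u"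
  have BV: "B \<in> VA" and CV: "?C \<in> VA" using B C by auto
  then show "?C \<in> VA" "B \<in> VA" by auto
  fix h d k assume hd: "(h, d) \<in> S" and k: "h < k" "k \<le> d"
  have "row_vec ?C d k = row_vec B d k"
  proof (cases "(\<exists>i c. link i c h d \<and> k = br c) \<or> T \<noteq> TypeC \<and> br d < d \<and> k = br d")
    case False
    then show ?thesis
      using core_support(2)[OF B hd] core_support(2)[OF C hd] row_vec_leads[OF BV, of d] row_vec_leads[OF CV, of d]
      unfolding leads_def by metis
  next
    case True
    then show ?thesis
    proof
      assume "\<exists>i c. link i c h d \<and> k = br c"
      then obtain i c where l: "link i c h d" and kc: "k = br c" by blast
      then have "(i, c) \<in> S" "h < br c" unfolding link_def by auto
      from orbit_invariant[OF BV u this(1) hd link_left(4)[OF l] this(2)]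
      have "sgn_at c * row_vec ?C d k = sgn_at c * row_vec B d k"
        unfolding core_form_link[OF B l] core_form_link[OF C l] kc .
      then have "sgn_at c * (sgn_at c * row_vec ?C d k) = sgn_at c * (sgn_at c * row_vec B d k)" by (rule arg_cong)
      then show ?thesis by (simp only: sgn_at_square)
    next
      assume m: "T \<noteq> TypeC \<and> br d < d \<and> k = br d"
      then have s: "sgn_at j = 1" for j unfolding sgn_at_def by simp
      have "h < br d" using m k by simp
      from orbit_invariant[OF BV u hd hd this this]
      have "2 * row_vec ?C d k = 2 * row_vec B d k"
        using core_form[OF B hd hd] core_form[OF C hd hd] m by (simp add: s)
      then show ?thesis using two by simp
    qed
  qed
  then show "ent ?C h k = ent B h k" using S_Phi[OF hd] k by (simp add: row_vec_S[OF hd])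
qed

text \<open>The columns \<open>br c\<close> and \<open>br d\<close> are distinct, and the one
  further left is the supplementary column. So each invariant of two different rows corresponds to a
  supplementary position.\<close>

lemma linked_pair:
  assumes ic: "(i, c) \<in> S" and hd: "(h, d) \<in> S" and v: "i < br d" "h < br c" "br d < c" and ne: "c \<noteq> d"
  shows "link i c h d \<or> link h d i c"
proof -
  note rc = S_range(2)[OF ic] and rd = S_range(2)[OF hd]
  have "br c < d" using v(3) rc rd by (auto simp: bar_def)
  moreover have "br c \<noteq> br d" using ne bar_bar[OF rc] bar_bar[OF rd] by metis
  ultimately show ?thesis using ic hd v unfolding link_def by (auto split: if_splits)
qed

text \<open>\<open>core_unique\<close> run backwards: the forms of \<open>B\<close> dictate the
  entries of a core \<open>C\<close>, and \<open>forms_imp_same_orbit\<close> puts \<open>C\<close>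
  into the orbit of \<open>B\<close>.\<close>

lemma core_exists:
  assumes B: "B \<in> VA"
  shows "\<exists>C\<in>cores. \<exists>u\<in>carrier (Ugrp T n). dot_act T n B u = C"
proof -
  let ?F = "\<lambda>c d. form (row_vec B c) (row_vec B d)"
  define col where "col h = (THE d. (h, d) \<in> S)" for h
  have col: "col h = d" if "(h, d) \<in> S" for h d unfolding col_def using that S_row by blast
  \<comment> \<open>The second value solves \<open>core_form_link\<close> with
    \<open>c = br k\<close>. The third is half the norm, because the minor entry occurs twice in
    \<open>core_form\<close>. The factors \<open>\<Phi>\<close> undo the normalisation in
    \<open>row_vec\<close>.\<close>
  define C where "C = mat_of N (\<lambda>h k. if (h, k) \<in> S then \<Phi> (h, k)
    else if \<exists>i c d. link i c h d \<and> k = br c then \<Phi> (h, col h) * (sgn_at (br k) * ?F (br k) (col h))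
    else if T \<noteq> TypeC \<and> (\<exists>c. (h, c) \<in> S \<and> br c < c \<and> k = br c) then \<Phi> (h, col h) * (?F (col h) (col h) / 2)
    else 0)"
  have entC: "ent C h k = (if (h, k) \<in> S then \<Phi> (h, k)
    else if \<exists>i c d. link i c h d \<and> k = br c then \<Phi> (h, col h) * (sgn_at (br k) * ?F (br k) (col h))
    else if T \<noteq> TypeC \<and> (\<exists>c. (h, c) \<in> S \<and> br c < c \<and> k = br c) then \<Phi> (h, col h) * (?F (col h) (col h) / 2)
    else 0)" if "h \<in> {1..N}" "k \<in> {1..N}" for h k
    unfolding C_def by (rule ent_mat_of[OF that])
  have minorP: "(h, br c) \<in> Pos T n \<and> h < br c" if "(h, c) \<in> S" "br c < c" "T \<noteq> TypeC" for h c
  proof -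
    have "h < br c" using S_Pos[OF that(1)] that(3) S_range[OF that(1)] by (auto simp: Pos_def bar_def)
    then show ?thesis using Pos_left[OF S_Pos[OF that(1)]] that(2) by simp
  qed
  have CP: "(h, k) \<in> Pos T n \<and> ((h, k) \<in> S \<or> (\<exists>i c d. link i c h d \<and> k = br c) \<or> T \<noteq> TypeC \<and> (\<exists>c. (h, c) \<in> S \<and> br c < c \<and> k = br c))
      \<and> (\<exists>j\<ge>k. (h, j) \<in> S)"
    if r: "h \<in> {1..N}" "k \<in> {1..N}" and nz: "ent C h k \<noteq> 0" for h k
  proof -
    consider "(h, k) \<in> S" | i c d where "link i c h d" "k = br c"
      | c where "T \<noteq> TypeC" "(h, c) \<in> S" "br c < c" "k = br c"
      using nz unfolding entC[OF r] by (auto split: if_splits)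
    then show ?thesis
    proof cases
      case 1
      then show ?thesis by auto
    next
      case 2
      moreover have "(h, d) \<in> S" "k \<le> d" using 2 link_left(1)[OF 2(1)] unfolding link_def by auto
      ultimately show ?thesis using link_left(2)[OF 2(1)] by blast
    next
      case 3
      then show ?thesis using minorP[OF 3(2,3,1)] less_imp_le by blast
    qed
  qed
  have CV: "C \<in> V" unfolding Vsp_def
  proof (intro CollectI conjI ballI impI)
    show "C \<in> carrier_mat N N" unfolding C_def by simp
    fix i j assume "i \<in> {1..N}" "j \<in> {1..N}" "(i, j) \<notin> Pos T n"
    then show "ent C i j = 0" using CP[of i j] by blast
  qed
  have "shape C" unfolding shape_def
  proof (intro conjI allI impI)
    fix i j assume ij: "(i, j) \<in> S"
    then show "ent C i j = \<Phi> (i, j)" using entC[OF S_range(1,2)[OF ij]] by simp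
  next
    fix i k assume p: "(i, k) \<in> Pos T n" and "ent C i k \<noteq> 0"
    then show "\<exists>j\<ge>k. (i, j) \<in> S" using CP[OF Pos_range[OF p]] by blast
  qed
  then have CVA: "C \<in> VA" by (rule VAI[OF CV])
  have "core_character T n C"
    unfolding core_iff[OF CVA] using CP Pos_range by blast
  then have core: "C \<in> cores" using CVA by simp
  have linkC: "form (row_vec C c) (row_vec C d) = ?F c d" if l: "link i c h d" for i c h d
  proof -
    from l have ic: "(i, c) \<in> S" and hd: "(h, d) \<in> S" and h: "h < br c" unfolding link_def by auto
    have r: "h \<in> {1..N}" "br c \<in> {1..N}" using Pos_range[OF link_left(2)[OF l]] by auto
    have "ent C h (br c) = \<Phi> (h, d) * (sgn_at c * ?F c d)"
    proof -
      have ex: "\<exists>i' c' d'. link i' c' h d' \<and> br c = br c'" using l by blast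
      show ?thesis
        unfolding entC[OF r] if_not_P[OF link_left(3)[OF l]] if_P[OF ex] col[OF hd] bar_bar[OF S_range(2)[OF ic]] ..
    qed
    then have "row_vec C d (br c) = sgn_at c * ?F c d"
      using h link_left(1)[OF l] S_Phi[OF hd] by (simp add: row_vec_S[OF hd])
    then show ?thesis using core_form_link[OF core l] by simp
  qed
  have "\<exists>u\<in>carrier (Ugrp T n). dot_act T n B u = C"
  proof (rule forms_imp_same_orbit[OF B CVA])
    fix i c h d assume ic: "(i, c) \<in> S" and hd: "(h, d) \<in> S" and v: "i < br d" "h < br c" "br d < c"
    show "form (row_vec C c) (row_vec C d) = ?F c d"
    proof (cases "c = d")
      case False
      from linked_pair[OF ic hd v False] show ?thesis
      proof
        assume "link h d i c"
        then have "form (row_vec C d) (row_vec C c) = ?F d c" by (rule linkC)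
        then show ?thesis using form_sym[of "row_vec C c"] form_sym[of "row_vec B c"] by simp
      qed (rule linkC)
    next
      case cd: True
      then have ih: "h = i" using S_col[OF ic] hd by blast
      show ?thesis
      proof (cases "T = TypeC")
        case True
        then show ?thesis using form_alternating cd by simp
      next
        case False
        then have s: "sgn_at j = 1" for j unfolding sgn_at_def by simp
        have bc: "br c < c" using v(3) cd by simp
        have p: "(i, br c) \<in> Pos T n" "i < br c" using minorP[OF ic bc False] by auto
        have nl: "\<not> (\<exists>i' c' d'. link i' c' i d' \<and> br c = br c')"
        proof
          assume "\<exists>i' c' d'. link i' c' i d' \<and> br c = br c'"
          then obtain i' c' d' where l: "link i' c' i d'" "br c = br c'" by blast
          then have "d' = c" using S_row[OF ic] unfolding link_def by blast
          then show False using l bc unfolding link_def by simp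
        qed
        have nS: "(i, br c) \<notin> S" using S_row[OF ic, of "br c"] bc by auto
        have m: "T \<noteq> TypeC \<and> (\<exists>c'. (i, c') \<in> S \<and> br c' < c' \<and> br c = br c')" using False ic bc by blast
        have "ent C i (br c) = \<Phi> (i, c) * (?F c c / 2)"
          unfolding entC[OF Pos_range[OF p(1)]] if_not_P[OF nS] if_not_P[OF nl] if_P[OF m] col[OF ic] ..
        then have "row_vec C c (br c) = ?F c c / 2"
          using p(2) bc S_Phi[OF ic] by (simp add: row_vec_S[OF ic])
        moreover have "form (row_vec C c) (row_vec C c) = row_vec C c (br c) + row_vec C c (br c)"
          using core_form[OF core ic ic] bc by (simp add: s)
        ultimately have "form (row_vec C c) (row_vec C c) = ?F c c / 2 + ?F c c / 2" by (simp only:)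
        also have "\<dots> = ?F c c"
          unfolding mult_2[symmetric] times_divide_eq_right by (rule nonzero_mult_div_cancel_left[OF two])
        finally show ?thesis using cd by simp
      qed
    qed
  qed
  then show ?thesis using core by blast
qed

section \<open>The orbit decomposition\<close>

lemma U_orbit_eq: "U_orbit T n \<theta> B = chr T n \<theta> ` (dot_act T n B ` carrier (Ugrp T n))"
  unfolding U_orbit_def by auto

lemma Ut_orbit_union: "Ut_orbit T n \<theta> A0 = (\<Union>B\<in>cores. U_orbit T n \<theta> B)"
proof -
  have "VA = (\<Union>B\<in>cores. dot_act T n B ` carrier (Ugrp T n))"
  proof (intro equalityI subsetI)
    fix B assume B: "B \<in> VA"
    from core_exists[OF B] obtain C u where C: "C \<in> cores" and u: "u \<in> carrier (Ugrp T n)" "dot_act T n B u = C" by blast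
    have uu: "u \<in> unitriangular T n" using u Ugrp_subset by blast
    have "dot_act T n C (ginv u) = dot_act T n B (1\<^sub>m N)"
      using dot_act_mult[OF uu GL_inv_unitriangular(1)[OF uu] VAD(1)[OF B]] u(2)
      by (simp add: GL_inv_unitriangular(2)[OF uu])
    also have "\<dots> = B" by (rule dot_act_one[OF VAD(1)[OF B]])
    finally show "B \<in> (\<Union>B\<in>cores. dot_act T n B ` carrier (Ugrp T n))"
      using C Ugrp_inv_closed[OF u(1)] by (intro UN_I[OF C] image_eqI[of _ _ "ginv u"]) auto
  next
    fix B assume "B \<in> (\<Union>B\<in>cores. dot_act T n B ` carrier (Ugrp T n))"
    then obtain C u where "C \<in> VA" "u \<in> unitriangular T n" "B = dot_act T n C u"
      using Ugrp_subset by blast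
    then show "B \<in> VA" using dot_act_VA[of C u] by simp
  qed
  then show ?thesis unfolding Ut_orbit_VA U_orbit_eq by auto
qed

lemma U_orbits_disjoint: "disjoint_family_on (U_orbit T n \<theta>) cores"
  unfolding disjoint_family_on_def
proof (intro ballI impI)
  fix B C assume B: "B \<in> cores" and C: "C \<in> cores" and ne: "B \<noteq> C"
  show "U_orbit T n \<theta> B \<inter> U_orbit T n \<theta> C = {}"
  proof (rule ccontr)
    assume "U_orbit T n \<theta> B \<inter> U_orbit T n \<theta> C \<noteq> {}"
    then obtain u v where u: "u \<in> carrier (Ugrp T n)" and v: "v \<in> carrier (Ugrp T n)"
      and "chr T n \<theta> (dot_act T n B u) = chr T n \<theta> (dot_act T n C v)" unfolding U_orbit_eq by auto
    then have e: "dot_act T n B u = dot_act T n C v"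
      using inj_onD[OF chr_inj, of "dot_act T n B u" "dot_act T n C v"] by simp
    have uu: "u \<in> unitriangular T n" and vu: "v \<in> unitriangular T n" using u v Ugrp_subset by auto
    note vi = GL_inv_unitriangular[OF vu]
    have w: "u * ginv v \<in> carrier (Ugrp T n)"
      using subgroup.m_closed[OF isometries_unitriangular_subgroup] u Ugrp_inv_closed[OF v]
      by (simp add: Ugrp_simps GL_simps)
    have BV: "B \<in> V" and CV: "C \<in> V" using B C by auto
    have "dot_act T n B (u * ginv v) = dot_act T n (dot_act T n C v) (ginv v)"
      using dot_act_mult[OF uu vi(1) BV] e by simp
    also have "\<dots> = dot_act T n C (1\<^sub>m N)"
      using dot_act_mult[OF vu vi(1) CV] vi(2) by simp
    also have "\<dots> = C" by (rule dot_act_one[OF CV])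
    finally have "dot_act T n B (u * ginv v) = C" .
    then show False using core_unique[OF B w] C ne by simp
  qed
qed

end

section \<open>A basis of mixed delta functions and characters\<close>

context monomial_setting
begin

text \<open>The bound \<open>j - 1\<close> keeps the main column itself among the character columns.
  For \<open>j > n\<close> the middle column of type B is a character column too, which accounts for
  the different bounds \<open>n\<close> and \<open>ntilde\<close> in
  \<open>varrho_set\<close>.\<close>

definition cut :: "nat \<Rightarrow> nat" where "cut j = min n (j - 1)"

text \<open>The characters of \<open>V\<close> with a prescribed verge are replaced by functions which, in row \<open>i\<close> with
  main condition \<open>(i, j)\<close>, are delta functions in the columns up to \<open>cut j\<close> and characters in the
  columns from \<open>cut j + 1\<close> to \<open>j\<close>. The group still acts on them monomially, but now the stabilisers
  are the groups from which the elementary characters are induced.\<close>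

definition row_fun :: "nat \<Rightarrow> nat \<Rightarrow> 'a mat \<Rightarrow> 'a mat \<Rightarrow> complex"
  where "row_fun i j C x = (if \<forall>k\<in>{i<..cut j}. ent x i k = ent C i k
    then \<theta> (- (\<Sum>k\<in>{cut j<..j}. ent C i k * ent x i k)) else 0)"

text \<open>The delta part moves like a row with an additional 1 in column \<open>i\<close>,
  multiplied by \<open>u\<close>; this 1 gives the term \<open>ent u i k\<close>. The character part
  moves like a column multiplied by u^-1. Both products are truncated to their blocks.\<close>

definition row_act :: "nat \<Rightarrow> nat \<Rightarrow> 'a mat \<Rightarrow> 'a mat \<Rightarrow> nat \<Rightarrow> 'a"
  where "row_act i j u C k =
    (if k \<in> {i<..cut j} then ent u i k + (\<Sum>l\<in>{i<..cut j}. ent C i l * ent u l k)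
     else if k \<in> {cut j<..j} then \<Sum>l\<in>{cut j<..j}. ent (ginv u) k l * ent C i l else 0)"

text \<open>What the character part contributes through the known entries of the row, namely the 1
  in column \<open>i\<close> and the delta columns, after multiplication by u^-1.\<close>

definition row_factor :: "nat \<Rightarrow> nat \<Rightarrow> 'a mat \<Rightarrow> 'a mat \<Rightarrow> complex"
  where "row_factor i j u C = \<theta> (- (\<Sum>l\<in>{cut j<..j}. ent C i l *
    (ent (ginv u) i l + (\<Sum>k\<in>{i<..cut j}. row_act i j u C k * ent (ginv u) k l))))"

lemma cut_bounds: "(i, j) \<in> Pos T n \<Longrightarrow> 1 \<le> i \<and> i \<le> cut j \<and> cut j < j \<and> j \<le> N"
proof -
  assume p: "(i, j) \<in> Pos T n"
  have "i \<le> n" using PosD[OF p] by (auto simp: bar_def dimN_def split: if_splits)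
  then show ?thesis using PosD[OF p] unfolding cut_def by auto
qed

text \<open>Terms outside \<open>l \<le> k \<le> p\<close> vanish, so blocks of consecutive indices
  of a triangular matrix and of its inverse are inverse to each other.\<close>

lemma ent_inverse_sum:
  fixes u v :: "'a mat"
  assumes u: "u \<in> unitriangular T n" "v \<in> unitriangular T n" "u * v = 1\<^sub>m N"
    and lp: "i \<le> l" "1 \<le> i" "l \<in> {1..N}" "p \<le> m" "m \<le> N" "p \<in> {1..N}"
  shows "(\<Sum>k\<in>{i..m}. ent u l k * ent v k p) = (if l = p then 1 else 0)"
proof -
  have "(\<Sum>k\<in>{i..m}. ent u l k * ent v k p) = (\<Sum>k=1..N. ent u l k * ent v k p)"
  proof (rule sum.mono_neutral_left)
    show "\<forall>k\<in>{1..N} - {i..m}. ent u l k * ent v k p = 0"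
    proof
      fix k assume k: "k \<in> {1..N} - {i..m}"
      then have "k < l \<or> p < k" using lp by auto
      then show "ent u l k * ent v k p = 0"
        using unitriangularD(2)[OF u(1) lp(3), of k] unitriangularD(2)[OF u(2), of k p] k lp by auto
    qed
  qed (use lp in auto)
  also have "\<dots> = ent (u * v) l p"
    by (rule ent_mult[OF unitriangularD(1)[OF u(1)] unitriangularD(1)[OF u(2)] lp(3,6), symmetric])
  finally show ?thesis using u(3) ent_one[OF lp(3,6)] by simp
qed

text \<open>A row is extended by a 1 in column \<open>i\<close> (\<open>a'\<close> and
  \<open>b'\<close>) and multiplied by a block of \<open>u\<close>, then by the inverse block. It is
  used for \<open>u\<close> and for its inverse, to transport the delta condition both ways.\<close>

lemma truncated_inverse:
  fixes u v :: "'a mat"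
  assumes u: "u \<in> unitriangular T n" "v \<in> unitriangular T n" "u * v = 1\<^sub>m N"
    and im: "1 \<le> i" "i \<le> m" "m \<le> N"
    and b: "\<And>k. k \<in> {i<..m} \<Longrightarrow> b k = ent u i k + (\<Sum>l\<in>{i<..m}. a l * ent u l k)"
    and p: "p \<in> {i<..m}"
  shows "a p = ent v i p + (\<Sum>l\<in>{i<..m}. b l * ent v l p)"
proof -
  define a' where "a' k = (if k = i then 1 else a k)" for k
  define b' where "b' k = (if k = i then 1 else b k)" for k
  have e: "b' k = (\<Sum>l\<in>{i..m}. a' l * ent u l k)" if k: "k \<in> {i..m}" for k
  proof (cases "k = i")
    case True
    have z: "(\<Sum>l\<in>{i<..m}. a' l * ent u l k) = 0"
      by (rule sum.neutral) (use unitriangularD(2)[OF u(1), of _ i] True im in auto)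
    have "(\<Sum>l\<in>{i..m}. a' l * ent u l k) = a' i * ent u i k + (\<Sum>l\<in>{i<..m}. a' l * ent u l k)"
      by (rule sum_head[OF im(2)])
    also have "\<dots> = 1"
      using z unitriangularD(3)[OF u(1), of i] im True by (simp only: z) (simp add: a'_def)
    finally show ?thesis using True by (simp add: b'_def)
  next
    case False
    have "(\<Sum>l\<in>{i<..m}. a' l * ent u l k) = (\<Sum>l\<in>{i<..m}. a l * ent u l k)"
      by (rule sum.cong) (auto simp: a'_def)
    moreover have "b k = ent u i k + (\<Sum>l\<in>{i<..m}. a l * ent u l k)" using b[of k] False k by auto
    ultimately show ?thesis unfolding sum_head[OF im(2)] using False by (simp only: a'_def b'_def if_False if_True mult_1_left simp_thms)
  qed
  have "(\<Sum>l\<in>{i..m}. b' l * ent v l p) = (\<Sum>l\<in>{i..m}. \<Sum>k\<in>{i..m}. a' k * (ent u k l * ent v l p))"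
    by (rule sum.cong[OF refl]) (simp only: e sum_distrib_right mult.assoc)
  also have "\<dots> = (\<Sum>k\<in>{i..m}. a' k * (\<Sum>l\<in>{i..m}. ent u k l * ent v l p))"
    unfolding sum_distrib_left by (rule sum.swap)
  also have "\<dots> = (\<Sum>k\<in>{i..m}. if k = p then a' p else 0)"
  proof (rule sum.cong[OF refl])
    fix k assume "k \<in> {i..m}"
    then show "a' k * (\<Sum>l\<in>{i..m}. ent u k l * ent v l p) = (if k = p then a' p else 0)"
      using ent_inverse_sum[OF u, of i k p m] p im by auto
  qed
  also have "\<dots> = a p" using p by (simp add: a'_def)
  finally have "a p = (\<Sum>l\<in>{i..m}. b' l * ent v l p)" by simp
  moreover have "(\<Sum>l\<in>{i<..m}. b' l * ent v l p) = (\<Sum>l\<in>{i<..m}. b l * ent v l p)"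
    by (rule sum.cong) (auto simp: b'_def)
  moreover have "b' i = 1" by (simp add: b'_def)
  ultimately show ?thesis unfolding sum_head[OF im(2)] by (simp only: mult_1_left)
qed

lemma ent_shift:
  assumes x: "x \<in> V" and u: "u \<in> unitriangular T n" and p: "(i, j) \<in> Pos T n" and k: "i < k" "k \<le> j"
  shows "ent (shift u x) i k = ent (ginv u) i k + (\<Sum>l\<in>{i<..j}. ent x i l * ent (ginv u) l k)"
proof -
  note w = GL_inv_unitriangular(1)[OF u] and x1 = unitriangular_add_Vsp[OF x]
  have pk: "(i, k) \<in> Pos T n" by (rule Pos_left[OF p k])
  note r = Pos_range[OF pk] and rj = Pos_range[OF p]
  have e: "ent (1\<^sub>m N + x) i l = (if i = l then 1 else 0) + ent x i l" if l: "l \<in> {1..N}" for l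
    unfolding ent_add[OF one_carrier_mat VspD(1)[OF x] r(1) l] ent_one[OF r(1) l] ..
  have "ent (shift u x) i k = (\<Sum>l=1..N. ent (1\<^sub>m N + x) i l * ent (ginv u) l k)"
    unfolding shift_def ent_proj_V[OF pk] by (rule ent_mult[OF unitriangularD(1)[OF x1] unitriangularD(1)[OF w] r])
  also have "\<dots> = (\<Sum>l\<in>{i..j}. ent (1\<^sub>m N + x) i l * ent (ginv u) l k)"
  proof (rule sum.mono_neutral_right)
    show "\<forall>l\<in>{1..N} - {i..j}. ent (1\<^sub>m N + x) i l * ent (ginv u) l k = 0"
    proof
      fix l assume l: "l \<in> {1..N} - {i..j}"
      then have "l < i \<or> k < l" using k by auto
      then show "ent (1\<^sub>m N + x) i l * ent (ginv u) l k = 0"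
        using unitriangularD(2)[OF x1 r(1), of l] unitriangularD(2)[OF w, of l k] l r by auto
    qed
  qed (use r rj in auto)
  also have "\<dots> = ent (1\<^sub>m N + x) i i * ent (ginv u) i k + (\<Sum>l\<in>{i<..j}. ent (1\<^sub>m N + x) i l * ent (ginv u) l k)"
    by (rule sum_head) (use k in simp)
  also have "\<dots> = ent (ginv u) i k + (\<Sum>l\<in>{i<..j}. ent x i l * ent (ginv u) l k)"
  proof -
    have "(\<Sum>l\<in>{i<..j}. ent (1\<^sub>m N + x) i l * ent (ginv u) l k) = (\<Sum>l\<in>{i<..j}. ent x i l * ent (ginv u) l k)"
      by (rule sum.cong[OF refl]) (use e r rj in auto)
    then show ?thesis using unitriangularD(3)[OF x1 r(1)] by simp
  qed
  finally show ?thesis .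
qed

text \<open>By triangularity the delta columns of the shifted row depend on delta columns only, so a
  delta condition goes to a delta condition. In the other columns the known entries give the scalar
  and the unknown ones transpose to a character. Only row \<open>i\<close> of \<open>M\<close>
  matters, so one matrix can serve several rows.\<close>

lemma row_fun_shift:
  assumes p: "(i, j) \<in> Pos T n" and x: "x \<in> V" and u: "u \<in> unitriangular T n"
    and M: "\<And>k. k \<in> {i<..j} \<Longrightarrow> ent M i k = row_act i j u C k"
  shows "row_fun i j C (shift u x) = row_factor i j u C * row_fun i j M x"
proof -
  note w = GL_inv_unitriangular[OF u]
  let ?m = "cut j" and ?w = "ent (ginv u)"
  have b: "1 \<le> i" "i \<le> ?m" "?m < j" "j \<le> N" using cut_bounds[OF p] by auto
  have split: "{i<..j} = {i<..?m} \<union> {?m<..j}" using b by auto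
  have y: "ent (shift u x) i k = ?w i k + (\<Sum>l\<in>{i<..?m}. ent x i l * ?w l k) + (\<Sum>l\<in>{?m<..j}. ent x i l * ?w l k)"
    if "k \<in> {i<..j}" for k
  proof -
    have "(\<Sum>l\<in>{i<..j}. ent x i l * ?w l k) = (\<Sum>l\<in>{i<..?m}. ent x i l * ?w l k) + (\<Sum>l\<in>{?m<..j}. ent x i l * ?w l k)"
      unfolding split by (rule sum.union_disjoint) auto
    then show ?thesis using ent_shift[OF x u p, of k] that by (simp add: add.assoc)
  qed
  have yd: "ent (shift u x) i k = ?w i k + (\<Sum>l\<in>{i<..?m}. ent x i l * ?w l k)" if k: "k \<in> {i<..?m}" for k
  proof -
    have "(\<Sum>l\<in>{?m<..j}. ent x i l * ?w l k) = 0"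
      by (rule sum.neutral) (use unitriangularD(2)[OF w(1), of _ k] k b in auto)
    then show ?thesis using y[of k] k b by simp
  qed
  have Md: "ent M i k = ent u i k + (\<Sum>l\<in>{i<..?m}. ent C i l * ent u l k)" if k: "k \<in> {i<..?m}" for k
    using M[of k] k b unfolding row_act_def by simp
  have iff: "(\<forall>k\<in>{i<..?m}. ent (shift u x) i k = ent C i k) \<longleftrightarrow> (\<forall>k\<in>{i<..?m}. ent x i k = ent M i k)"
  proof
    assume L: "\<forall>k\<in>{i<..?m}. ent (shift u x) i k = ent C i k"
    have "ent x i k = ent u i k + (\<Sum>l\<in>{i<..?m}. ent C i l * ent u l k)" if k: "k \<in> {i<..?m}" for k
      by (rule truncated_inverse[OF w(1) u w(3) _ _ _ _ k, where b = "ent C i"]) (use b L yd in auto)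
    then show "\<forall>k\<in>{i<..?m}. ent x i k = ent M i k" using Md by simp
  next
    assume R: "\<forall>k\<in>{i<..?m}. ent x i k = ent M i k"
    have "ent C i k = ?w i k + (\<Sum>l\<in>{i<..?m}. ent x i l * ?w l k)" if k: "k \<in> {i<..?m}" for k
      by (rule truncated_inverse[OF u w(1) w(2) _ _ _ _ k, where b = "ent x i"]) (use b R Md in auto)
    then show "\<forall>k\<in>{i<..?m}. ent (shift u x) i k = ent C i k" using yd by simp
  qed
  show ?thesis
  proof (cases "\<forall>k\<in>{i<..?m}. ent x i k = ent M i k")
    case False
    then show ?thesis using iff unfolding row_fun_def by (simp only: if_False mult_zero_right)
  next
    case True
    have Mt: "ent M i k = (\<Sum>l\<in>{?m<..j}. ?w k l * ent C i l)" if k: "k \<in> {?m<..j}" for k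
      using M[of k] k b unfolding row_act_def by simp
    have yt: "ent (shift u x) i l = (?w i l + (\<Sum>k\<in>{i<..?m}. row_act i j u C k * ?w k l)) + (\<Sum>k\<in>{?m<..j}. ent x i k * ?w k l)"
      if "l \<in> {?m<..j}" for l
    proof -
      have "(\<Sum>k\<in>{i<..?m}. ent x i k * ?w k l) = (\<Sum>k\<in>{i<..?m}. row_act i j u C k * ?w k l)"
        by (rule sum.cong[OF refl]) (use True M b in auto)
      then show ?thesis using y[of l] that b by simp
    qed
    have "(\<Sum>l\<in>{?m<..j}. ent C i l * (\<Sum>k\<in>{?m<..j}. ent x i k * ?w k l))
      = (\<Sum>l\<in>{?m<..j}. \<Sum>k\<in>{?m<..j}. ?w k l * ent C i l * ent x i k)"
      unfolding sum_distrib_left by (intro sum.cong refl) (simp only: mult_ac)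
    also have "\<dots> = (\<Sum>k\<in>{?m<..j}. \<Sum>l\<in>{?m<..j}. ?w k l * ent C i l * ent x i k)" by (rule sum.swap)
    also have "\<dots> = (\<Sum>k\<in>{?m<..j}. ent M i k * ent x i k)"
      unfolding sum_distrib_right[symmetric] by (intro sum.cong refl) (simp only: Mt)
    finally have s: "(\<Sum>l\<in>{?m<..j}. ent C i l * (\<Sum>k\<in>{?m<..j}. ent x i k * ?w k l)) = (\<Sum>k\<in>{?m<..j}. ent M i k * ent x i k)" .
    have "(\<Sum>l\<in>{?m<..j}. ent C i l * ent (shift u x) i l)
      = (\<Sum>l\<in>{?m<..j}. ent C i l * (?w i l + (\<Sum>k\<in>{i<..?m}. row_act i j u C k * ?w k l))
          + ent C i l * (\<Sum>k\<in>{?m<..j}. ent x i k * ?w k l))"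
      by (intro sum.cong refl) (simp only: yt distrib_left)
    also have "\<dots> = (\<Sum>l\<in>{?m<..j}. ent C i l * (?w i l + (\<Sum>k\<in>{i<..?m}. row_act i j u C k * ?w k l)))
       + (\<Sum>k\<in>{?m<..j}. ent M i k * ent x i k)"
      unfolding sum.distrib s ..
    finally have t: "\<theta> (- (\<Sum>l\<in>{?m<..j}. ent C i l * ent (shift u x) i l))
      = row_factor i j u C * \<theta> (- (\<Sum>k\<in>{?m<..j}. ent M i k * ent x i k))"
      unfolding row_factor_def theta_add[symmetric] by (simp only: minus_add_distrib)
    show ?thesis using True iff t unfolding row_fun_def by simp
  qed
qed

section \<open>Assembling the rows\<close>

definition row_set :: "(nat \<times> nat) set \<Rightarrow> bool"
  where "row_set S \<longleftrightarrow> S \<subseteq> Pos T n \<and> inj_on fst S"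

text \<open>For \<open>S\<close> from a basic set this is \<open>VA\<close> (see
  \<open>VA_shaped\<close>); singletons give the same theory for a single row, where the elementary
  characters live.\<close>

definition shaped :: "(nat \<times> nat) set \<Rightarrow> (nat \<times> nat \<Rightarrow> 'a) \<Rightarrow> 'a mat set"
  where "shaped S \<Phi> = {B \<in> V. (\<forall>(i, j)\<in>S. ent B i j = \<Phi> (i, j)) \<and>
    (\<forall>(i, k)\<in>Pos T n. ent B i k \<noteq> 0 \<longrightarrow> (\<exists>j\<ge>k. (i, j) \<in> S))}"

definition mixed :: "(nat \<times> nat) set \<Rightarrow> 'a mat \<Rightarrow> 'a mat \<Rightarrow> complex"
  where "mixed S C = (\<lambda>x. if x \<in> V then \<Prod>(i, j)\<in>S. row_fun i j C x else 0)"

definition glue :: "(nat \<times> nat) set \<Rightarrow> (nat \<Rightarrow> nat \<Rightarrow> nat \<Rightarrow> 'a) \<Rightarrow> 'a mat"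
  where "glue S r = mat_of N (\<lambda>i k. if \<exists>j. (i, j) \<in> S \<and> i < k \<and> k \<le> j then r i (THE j. (i, j) \<in> S) k else 0)"

definition mixed_act :: "(nat \<times> nat) set \<Rightarrow> 'a mat \<Rightarrow> 'a mat \<Rightarrow> 'a mat"
  where "mixed_act S u C = glue S (\<lambda>i j. row_act i j u C)"

definition mixed_factor :: "(nat \<times> nat) set \<Rightarrow> 'a mat \<Rightarrow> 'a mat \<Rightarrow> complex"
  where "mixed_factor S u C = (\<Prod>(i, j)\<in>S. row_factor i j u C)"

lemma row_setD:
  assumes "row_set S"
  shows "finite S" "(i, j) \<in> S \<Longrightarrow> (i, j) \<in> Pos T n" "(i, j) \<in> S \<Longrightarrow> (i, k) \<in> S \<Longrightarrow> j = k"
  using assms finite_subset[OF _ finite_Pos[of T n]] inj_onD[of fst S "(i, j)" "(i, k)"] unfolding row_set_def by auto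

lemma ent_glue:
  assumes S: "row_set S" and ij: "(i, j) \<in> S" and k: "k \<in> {i<..j}"
  shows "ent (glue S r) i k = r i j k"
proof -
  have "(THE j. (i, j) \<in> S) = j" using row_setD(3)[OF S ij] ij by blast
  moreover have "(i, k) \<in> Pos T n" using Pos_left[OF row_setD(2)[OF S ij]] k by simp
  ultimately show ?thesis unfolding glue_def by (subst ent_mat_of[OF Pos_range]) (use ij k in auto)
qed

lemma ent_glue_zero:
  assumes "i \<in> {1..N}" "k \<in> {1..N}" "\<And>j. (i, j) \<in> S \<Longrightarrow> k \<notin> {i<..j}"
  shows "ent (glue S r) i k = 0"
  unfolding glue_def ent_mat_of[OF assms(1,2)] using assms(3) by auto

lemma glue_Vsp:
  assumes S: "row_set S" shows "glue S r \<in> V"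
  unfolding Vsp_def
proof (intro CollectI conjI ballI impI)
  show "glue S r \<in> carrier_mat N N" unfolding glue_def by simp
  fix i k assume r: "i \<in> {1..N}" "k \<in> {1..N}" and np: "(i, k) \<notin> Pos T n"
  show "ent (glue S r) i k = 0"
    by (rule ent_glue_zero[OF r]) (use np Pos_left[OF row_setD(2)[OF S]] in auto)
qed

lemma glue_shaped:
  assumes S: "row_set S" and r: "\<And>i j. (i, j) \<in> S \<Longrightarrow> r i j j = \<Phi> (i, j)"
  shows "glue S r \<in> shaped S \<Phi>"
proof -
  have "ent (glue S r) i j = \<Phi> (i, j)" if ij: "(i, j) \<in> S" for i j
    using ent_glue[OF S ij, of j r] r[OF ij] PosD[OF row_setD(2)[OF S ij]] by simp
  moreover have "\<exists>j\<ge>k. (i, j) \<in> S" if p: "(i, k) \<in> Pos T n" and nz: "ent (glue S r) i k \<noteq> 0" for i k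
  proof -
    obtain j where "(i, j) \<in> S" "k \<in> {i<..j}" using ent_glue_zero[OF Pos_range[OF p], of S r] nz by blast
    then show ?thesis by auto
  qed
  ultimately show ?thesis using glue_Vsp[OF S] unfolding shaped_def by auto
qed

lemma shapedD:
  assumes "B \<in> shaped S \<Phi>"
  shows "B \<in> V" "(i, j) \<in> S \<Longrightarrow> ent B i j = \<Phi> (i, j)"
    "(i, k) \<in> Pos T n \<Longrightarrow> ent B i k \<noteq> 0 \<Longrightarrow> \<exists>j\<ge>k. (i, j) \<in> S"
  using assms unfolding shaped_def by auto

lemma shaped_eqI:
  assumes B: "B \<in> shaped S \<Phi>" and C: "C \<in> shaped S \<Phi>"
    and e: "\<And>i j k. (i, j) \<in> S \<Longrightarrow> k \<in> {i<..j} \<Longrightarrow> ent B i k = ent C i k"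
  shows "B = C"
proof (rule Vsp_eqI[OF shapedD(1)[OF B] shapedD(1)[OF C]])
  fix i k assume p: "(i, k) \<in> Pos T n"
  show "ent B i k = ent C i k"
  proof (cases "\<exists>j\<ge>k. (i, j) \<in> S")
    case True
    then show ?thesis using e PosD[OF p] by auto
  next
    case False
    then have "ent B i k = 0" "ent C i k = 0" using shapedD(3)[OF B p] shapedD(3)[OF C p] by blast+
    then show ?thesis by simp
  qed
qed

lemma finite_shaped: "finite (shaped S \<Phi>)"
  by (rule finite_subset[OF _ finite_Vsp[of T n]]) (auto simp: shaped_def)

lemma mixed_act_shaped:
  assumes S: "row_set S" and C: "C \<in> shaped S \<Phi>" and u: "u \<in> unitriangular T n"
  shows "mixed_act S u C \<in> shaped S \<Phi>"
  unfolding mixed_act_def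
proof (rule glue_shaped[OF S])
  fix i j assume ij: "(i, j) \<in> S"
  note p = row_setD(2)[OF S ij] and w = GL_inv_unitriangular(1)[OF u]
  note b = cut_bounds[OF p]
  have "(\<Sum>l\<in>{cut j<..j}. ent (ginv u) j l * ent C i l) = (\<Sum>l\<in>{j}. ent (ginv u) j l * ent C i l)"
    by (rule sum.mono_neutral_right) (use b unitriangularD(2)[OF w Pos_range(2)[OF p]] in auto)
  then show "row_act i j u C j = \<Phi> (i, j)"
    using unitriangularD(3)[OF w Pos_range(2)[OF p]] b shapedD(2)[OF C ij] unfolding row_act_def by simp
qed

lemma ent_mixed_act:
  assumes "row_set S" "(i, j) \<in> S" "k \<in> {i<..j}"
  shows "ent (mixed_act S u C) i k = row_act i j u C k"
  unfolding mixed_act_def by (rule ent_glue[OF assms])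

lemma translate_mixed:
  assumes S: "row_set S" and u: "u \<in> unitriangular T n"
  shows "translate u (mixed S C) = fscale (mixed_factor S u C) (mixed S (mixed_act S u C))"
proof
  fix x
  show "translate u (mixed S C) x = fscale (mixed_factor S u C) (mixed S (mixed_act S u C)) x"
  proof (cases "x \<in> V")
    case True
    have "(\<Prod>(i, j)\<in>S. row_fun i j C (shift u x))
      = (\<Prod>(i, j)\<in>S. row_factor i j u C * row_fun i j (mixed_act S u C) x)"
      by (rule prod.cong[OF refl])
        (use row_fun_shift[OF row_setD(2)[OF S] True u] ent_mixed_act[OF S] in auto)
    then show ?thesis using True
      unfolding translate_def mixed_def mixed_factor_def fscale_apply by (simp add: prod.distrib case_prod_beta)
  qed (simp add: translate_def mixed_def fscale_apply)
qed

lemma kappa_shaped: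
  assumes S: "row_set S" and B: "B \<in> shaped S \<Phi>" and x: "x \<in> V"
  shows "kappa B x = (\<Sum>(i, j)\<in>S. \<Sum>k\<in>{i<..j}. ent B i k * ent x i k)"
proof -
  let ?P = "SIGMA s:S. {fst s<..snd s}"
  have "kappa B x = (\<Sum>(i, k)\<in>Pos T n. ent B i k * ent x i k)"
    by (rule kappa_Pos[OF shapedD(1)[OF B] VspD(1)[OF x]])
  also have "\<dots> = (\<Sum>(i, k)\<in>(\<lambda>(s, k). (fst s, k)) ` ?P. ent B i k * ent x i k)"
  proof (rule sum.mono_neutral_right)
    show "(\<lambda>(s, k). (fst s, k)) ` ?P \<subseteq> Pos T n" using Pos_left[OF row_setD(2)[OF S]] by auto
    show "\<forall>p\<in>Pos T n - (\<lambda>(s, k). (fst s, k)) ` ?P. (case p of (i, k) \<Rightarrow> ent B i k * ent x i k) = 0"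
    proof
      fix p assume p: "p \<in> Pos T n - (\<lambda>(s, k). (fst s, k)) ` ?P"
      obtain i k where ik: "p = (i, k)" by (cases p)
      have "ent B i k = 0"
      proof (rule ccontr)
        assume "ent B i k \<noteq> 0"
        then obtain j where j: "j \<ge> k" "(i, j) \<in> S" using shapedD(3)[OF B, of i k] p ik by auto
        moreover have "i < k" using PosD[of i k T n] p ik by auto
        ultimately have "p \<in> (\<lambda>(s, k). (fst s, k)) ` ?P" using ik by (intro image_eqI[of _ _ "((i, j), k)"]) auto
        then show False using p by simp
      qed
      then show "(case p of (i, k) \<Rightarrow> ent B i k * ent x i k) = 0" using ik by simp
    qed
  qed (rule finite_Pos)
  also have "\<dots> = (\<Sum>(s, k)\<in>?P. ent B (fst s) k * ent x (fst s) k)"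
  proof (subst sum.reindex)
    show "inj_on (\<lambda>(s, k). (fst s, k)) ?P"
      by (rule inj_onI) (use S inj_onD[of fst S] in \<open>auto simp: row_set_def\<close>)
  qed (auto intro!: sum.cong)
  also have "\<dots> = (\<Sum>(i, j)\<in>S. \<Sum>k\<in>{i<..j}. ent B i k * ent x i k)"
    by (subst sum.Sigma[symmetric]) (use row_setD(1)[OF S] in \<open>auto intro!: sum.cong simp: case_prod_beta\<close>)
  finally show ?thesis .
qed

lemma chr_shaped:
  assumes S: "row_set S" and B: "B \<in> shaped S \<Phi>" and x: "x \<in> V"
  shows "chr T n \<theta> B x = (\<Prod>(i, j)\<in>S. \<theta> (- (\<Sum>k\<in>{i<..j}. ent B i k * ent x i k)))"
proof -
  have "\<theta> (- (\<Sum>s\<in>S. f s)) = (\<Prod>s\<in>S. \<theta> (- f s))" for f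
    unfolding sum_negf[symmetric] by (rule theta_sum)
  then show ?thesis unfolding chr_apply[OF x] kappa_shaped[OF assms] by (simp add: case_prod_beta)
qed

text \<open>Fourier expansion in the delta columns: a character of these columns is the sum of delta
  functions weighted by its values.\<close>

lemma chr_in_mixed_span:
  assumes S: "row_set S" and B: "B \<in> shaped S \<Phi>"
  shows "chr T n \<theta> B \<in> cfun.span (mixed S ` shaped S \<Phi>)"
proof -
  define agree where "agree C \<longleftrightarrow> (\<forall>(i, j)\<in>S. \<forall>k\<in>{cut j<..j}. ent C i k = ent B i k)" for C
  define d where "d C = (if agree C
    then \<Prod>(i, j)\<in>S. \<theta> (- (\<Sum>k\<in>{i<..cut j}. ent B i k * ent C i k)) else 0)" for C
  have "chr T n \<theta> B = (\<Sum>C\<in>shaped S \<Phi>. fscale (d C) (mixed S C))"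
  proof
    fix x
    show "chr T n \<theta> B x = (\<Sum>C\<in>shaped S \<Phi>. fscale (d C) (mixed S C)) x"
    proof (cases "x \<in> V")
      case False
      then show ?thesis by (simp add: sum_fun_apply fscale_apply chr_outside mixed_def)
    next
      case x: True
      \<comment> \<open>The only label that contributes at \<open>x\<close>: it copies
        \<open>x\<close> in the delta columns and \<open>B\<close> in the character columns.\<close>
      define J where "J = glue S (\<lambda>i j k. if k \<le> cut j then ent x i k else ent B i k)"
      have J: "J \<in> shaped S \<Phi>" unfolding J_def
        by (rule glue_shaped[OF S]) (use shapedD(2)[OF B] cut_bounds[OF row_setD(2)[OF S]] in force)
      have eJ: "ent J i k = (if k \<le> cut j then ent x i k else ent B i k)" if "(i, j) \<in> S" "k \<in> {i<..j}" for i j k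
        unfolding J_def by (rule ent_glue[OF S that])
      have z: "d C * mixed S C x = 0" if C: "C \<in> shaped S \<Phi>" "C \<noteq> J" for C
      proof -
        obtain i j k where ij: "(i, j) \<in> S" and k: "k \<in> {i<..j}" and ne: "ent C i k \<noteq> ent J i k"
          using shaped_eqI[OF C(1) J] C(2) by blast
        show ?thesis
        proof (cases "k \<le> cut j")
          case True
          then have "row_fun i j C x = 0" using eJ[OF ij k] ne k unfolding row_fun_def by auto
          then have "\<exists>s\<in>S. (case s of (i, j) \<Rightarrow> row_fun i j C x) = 0" using ij by force
          then have "mixed S C x = 0" using x row_setD(1)[OF S] unfolding mixed_def by (simp add: prod_zero)
          then show ?thesis by simp
        next
          case False
          then have "k \<in> {cut j<..j}" "ent C i k \<noteq> ent B i k" using eJ[OF ij k] ne k by auto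
          then have "\<not> agree C" using ij unfolding agree_def by blast
          then show ?thesis by (simp add: d_def)
        qed
      qed
      have "(\<Sum>C\<in>shaped S \<Phi>. fscale (d C) (mixed S C)) x = (\<Sum>C\<in>{J}. d C * mixed S C x)"
        unfolding sum_fun_apply fscale_apply
        by (rule sum.mono_neutral_right) (use J z finite_shaped in auto)
      also have "\<dots> = d J * mixed S J x" by simp
      also have "\<dots> = (\<Prod>(i, j)\<in>S. \<theta> (- (\<Sum>k\<in>{i<..cut j}. ent B i k * ent J i k)) * row_fun i j J x)"
      proof -
        have "agree J" unfolding agree_def using eJ cut_bounds[OF row_setD(2)[OF S]] by force
        then show ?thesis using x unfolding d_def mixed_def by (simp add: prod.distrib case_prod_beta)
      qed
      also have "\<dots> = (\<Prod>(i, j)\<in>S. \<theta> (- (\<Sum>k\<in>{i<..j}. ent B i k * ent x i k)))"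
      proof (rule prod.cong[OF refl], clarify)
        fix i j assume ij: "(i, j) \<in> S"
        note b = cut_bounds[OF row_setD(2)[OF S ij]]
        have sp: "{i<..j} = {i<..cut j} \<union> {cut j<..j}" using b by auto
        have s1: "(\<Sum>k\<in>{i<..cut j}. ent B i k * ent J i k) = (\<Sum>k\<in>{i<..cut j}. ent B i k * ent x i k)"
          by (rule sum.cong[OF refl]) (use eJ[OF ij] b in auto)
        have s2: "(\<Sum>k\<in>{cut j<..j}. ent J i k * ent x i k) = (\<Sum>k\<in>{cut j<..j}. ent B i k * ent x i k)"
          by (rule sum.cong[OF refl]) (use eJ[OF ij] b in auto)
        have r: "row_fun i j J x = \<theta> (- (\<Sum>k\<in>{cut j<..j}. ent J i k * ent x i k))"
          using eJ[OF ij] b unfolding row_fun_def by auto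
        have s3: "(\<Sum>k\<in>{i<..j}. ent B i k * ent x i k)
          = (\<Sum>k\<in>{i<..cut j}. ent B i k * ent x i k) + (\<Sum>k\<in>{cut j<..j}. ent B i k * ent x i k)"
          unfolding sp by (rule sum.union_disjoint) auto
        show "\<theta> (- (\<Sum>k\<in>{i<..cut j}. ent B i k * ent J i k)) * row_fun i j J x
          = \<theta> (- (\<Sum>k\<in>{i<..j}. ent B i k * ent x i k))"
          unfolding r s1 s2 s3 theta_add[symmetric] minus_add_distrib ..
      qed
      finally show ?thesis using chr_shaped[OF S B x] by simp
    qed
  qed
  then show ?thesis unfolding span_family[OF finite_shaped] by blast
qed

lemma chr_shaped_indep: "indep_family (chr T n \<theta>) (shaped S \<Phi>)"
  by (rule indep_family_subset[OF chr_indep]) (auto simp: shaped_def)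

text \<open>Mixed functions and characters have the same index set, so
  \<open>chr_in_mixed_span\<close> settles both claims by counting.\<close>

lemma mixed_indep: "row_set S \<Longrightarrow> indep_family (mixed S) (shaped S \<Phi>)"
  and mixed_span: "row_set S \<Longrightarrow> cfun.span (mixed S ` shaped S \<Phi>) = cfun.span (chr T n \<theta> ` shaped S \<Phi>)"
  using indep_family_of_span[OF chr_shaped_indep finite_shaped refl chr_in_mixed_span] by blast+

lemma row_factor_nonzero: "row_factor i j u C \<noteq> 0"
  unfolding row_factor_def by (rule theta_nonzero)

lemma mixed_factor_nonzero: "row_set S \<Longrightarrow> mixed_factor S u C \<noteq> 0"
  unfolding mixed_factor_def using row_setD(1) row_factor_nonzero by (simp add: prod_zero_iff case_prod_beta)

lemma mixed_Vhat: "row_set S \<Longrightarrow> C \<in> shaped S \<Phi> \<Longrightarrow> mixed S C \<in> cfun.span (Vhat T n \<theta>)"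
proof -
  assume S: "row_set S" and C: "C \<in> shaped S \<Phi>"
  have "mixed S C \<in> cfun.span (chr T n \<theta> ` shaped S \<Phi>)"
    unfolding mixed_span[OF S, symmetric] using C by (intro cfun.span_base imageI)
  moreover have "chr T n \<theta> ` shaped S \<Phi> \<subseteq> Vhat T n \<theta>" unfolding Vhat_def shaped_def by auto
  ultimately show ?thesis using cfun.span_mono by blast
qed

lemma mixed_act_mult:
  assumes S: "row_set S" and C: "C \<in> shaped S \<Phi>" and u: "u \<in> unitriangular T n" and v: "v \<in> unitriangular T n"
  shows "mixed_act S (u * v) C = mixed_act S v (mixed_act S u C)"
    and "mixed_factor S (u * v) C = mixed_factor S u C * mixed_factor S v (mixed_act S u C)"
proof -
  interpret vp: vector_space_pair "fscale :: complex \<Rightarrow> ('a mat \<Rightarrow> complex) \<Rightarrow> _" "fscale :: complex \<Rightarrow> ('a mat \<Rightarrow> complex) \<Rightarrow> _"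
    by (intro vector_space_pair.intro cfun.vector_space_axioms)
  note uv = unitriangular_mult[OF u v]
  have t: "translate (u * v) (mixed S C) = translate v (translate u (mixed S C))"
    unfolding translate_def using shift_mult[OF u v] by (auto simp: fun_eq_iff)
  have e: "fscale (mixed_factor S (u * v) C) (mixed S (mixed_act S (u * v) C))
    = fscale (mixed_factor S u C * mixed_factor S v (mixed_act S u C)) (mixed S (mixed_act S v (mixed_act S u C)))"
    using t unfolding translate_mixed[OF S uv] translate_mixed[OF S u] vp.linear_scale[OF linear_translate]
      translate_mixed[OF S v] cfun.scale_scale .
  from indep_family_scaled_eq[OF mixed_indep[OF S] mixed_act_shaped[OF S C uv]
      mixed_act_shaped[OF S mixed_act_shaped[OF S C u] v] e mixed_factor_nonzero[OF S]]
  show "mixed_act S (u * v) C = mixed_act S v (mixed_act S u C)"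
    "mixed_factor S (u * v) C = mixed_factor S u C * mixed_factor S v (mixed_act S u C)" by auto
qed

lemma mixed_act_one:
  assumes S: "row_set S" and C: "C \<in> shaped S \<Phi>"
  shows "mixed_act S (1\<^sub>m N) C = C" and "mixed_factor S (1\<^sub>m N) C = 1"
proof -
  have "translate (1\<^sub>m N) (mixed S C) = fscale 1 (mixed S C)"
    unfolding translate_def by (auto simp: fun_eq_iff shift_one fscale_apply mixed_def)
  then have e: "fscale (mixed_factor S (1\<^sub>m N) C) (mixed S (mixed_act S (1\<^sub>m N) C)) = fscale 1 (mixed S C)"
    unfolding translate_mixed[OF S one_unitriangular] .
  from indep_family_scaled_eq[OF mixed_indep[OF S] mixed_act_shaped[OF S C one_unitriangular] C e mixed_factor_nonzero[OF S]]
  show "mixed_act S (1\<^sub>m N) C = C" "mixed_factor S (1\<^sub>m N) C = 1" by auto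
qed

lemma mixed_submodule:
  assumes S: "row_set S" and R: "R \<subseteq> shaped S \<Phi>"
    and stable: "\<And>u C. u \<in> carrier (Ugrp T n) \<Longrightarrow> C \<in> R \<Longrightarrow> mixed_act S u C \<in> R"
  shows "right_module (Ugrp T n) (cfun.span (mixed S ` R)) (mact T n \<theta>)"
proof (rule Ugrp_module)
  show "mixed S ` R \<subseteq> cfun.span (Vhat T n \<theta>)" using mixed_Vhat[OF S] R by blast
  fix u :: "'a mat" and f assume u: "u \<in> carrier (Ugrp T n)" and "f \<in> mixed S ` R"
  then obtain C where C: "C \<in> R" "f = mixed S C" by blast
  have uu: "u \<in> unitriangular T n" using u Ugrp_subset by blast
  show "translate u f \<in> cfun.span (mixed S ` R)"
    unfolding C(2) translate_mixed[OF S uu] by (intro cfun.span_scale cfun.span_base imageI stable[OF u C(1)])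
qed

lemma mixed_character:
  assumes S: "row_set S" and R: "R \<subseteq> shaped S \<Phi>"
    and stable: "\<And>u C. u \<in> carrier (Ugrp T n) \<Longrightarrow> C \<in> R \<Longrightarrow> mixed_act S u C \<in> R"
    and g: "g \<in> carrier (Ugrp T n)"
  shows "module_character (cfun.span (mixed S ` R)) (mact T n \<theta>) g
    = (\<Sum>C\<in>{C \<in> R. mixed_act S g C = C}. mixed_factor S g C)"
proof (rule module_character_monomial[OF mixed_submodule[OF S R stable] g indep_family_subset[OF mixed_indep[OF S] R] refl])
  fix C assume C: "C \<in> R"
  have gu: "g \<in> unitriangular T n" using g Ugrp_subset by blast
  show "mixed_act S g C \<in> R \<and> mact T n \<theta> g (mixed S C) = fscale (mixed_factor S g C) (mixed S (mixed_act S g C))"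
    using stable[OF g C] mact_translate[OF mixed_Vhat[OF S] gu] translate_mixed[OF S gu] C R by auto
qed

section \<open>Elementary characters as sums over fixed points\<close>

lemma ent_unit: "a \<in> {1..N} \<Longrightarrow> k \<in> {1..N} \<Longrightarrow> ent (t \<cdot>\<^sub>m eunit N i j) a k = (if a = i \<and> k = j then t else 0)"
  for t :: 'a
  by (simp add: ent_smult[OF eunit_carrier] ent_eunit del: atLeastAtMost_iff)

lemma row_set_single: "(i, j) \<in> Pos T n \<Longrightarrow> row_set {(i, j)}"
  unfolding row_set_def by simp

lemma unit_shaped:
  assumes p: "(i, j) \<in> Pos T n"
  shows "\<Phi> (i, j) \<cdot>\<^sub>m eunit N i j \<in> shaped {(i, j)} \<Phi>"
proof -
  have "\<Phi> (i, j) \<cdot>\<^sub>m eunit N i j \<in> V"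
    unfolding Vsp_def using p by (auto simp: ent_unit simp del: atLeastAtMost_iff)
  then show ?thesis unfolding shaped_def using ent_unit Pos_range p by (auto simp del: atLeastAtMost_iff split: if_splits)
qed

lemma row_act_unit:
  assumes p: "(i, j) \<in> Pos T n" and k: "k \<in> {i<..j}"
  shows "row_act i j u (t \<cdot>\<^sub>m eunit N i j) k = (if k \<le> cut j then ent u i k else ent (ginv u) k j * t)"
proof -
  note b = cut_bounds[OF p] and r = Pos_range[OF p]
  have e: "ent (t \<cdot>\<^sub>m eunit N i j) i l = (if l = j then t else 0)" if "l \<in> {i<..j}" for l
    using ent_unit[OF r(1), of l t i j] that b by auto
  have "(\<Sum>l\<in>{i<..cut j}. ent (t \<cdot>\<^sub>m eunit N i j) i l * ent u l k) = 0"
    by (rule sum.neutral) (use e b in auto)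
  moreover have "(\<Sum>l\<in>{cut j<..j}. ent (ginv u) k l * ent (t \<cdot>\<^sub>m eunit N i j) i l)
    = (\<Sum>l\<in>{cut j<..j}. if l = j then ent (ginv u) k j * t else 0)"
    by (rule sum.cong[OF refl]) (use e b in auto)
  ultimately show ?thesis unfolding row_act_def using k b by simp
qed

lemma row_factor_unit:
  assumes p: "(i, j) \<in> Pos T n"
  shows "row_factor i j u (t \<cdot>\<^sub>m eunit N i j)
    = \<theta> (- (t * (ent (ginv u) i j + (\<Sum>k\<in>{i<..cut j}. ent u i k * ent (ginv u) k j))))"
proof -
  note b = cut_bounds[OF p] and r = Pos_range[OF p]
  have e: "ent (t \<cdot>\<^sub>m eunit N i j) i l = (if l = j then t else 0)" if "l \<in> {i<..j}" for l
    using ent_unit[OF r(1), of l t i j] that b by auto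
  let ?f = "\<lambda>l. ent (ginv u) i l + (\<Sum>k\<in>{i<..cut j}. row_act i j u (t \<cdot>\<^sub>m eunit N i j) k * ent (ginv u) k l)"
  have "(\<Sum>l\<in>{cut j<..j}. ent (t \<cdot>\<^sub>m eunit N i j) i l * ?f l) = (\<Sum>l\<in>{cut j<..j}. if l = j then t * ?f j else 0)"
    by (rule sum.cong[OF refl]) (use e b in auto)
  also have "\<dots> = t * ?f j" using b by simp
  also have "?f j = ent (ginv u) i j + (\<Sum>k\<in>{i<..cut j}. ent u i k * ent (ginv u) k j)"
    by (intro arg_cong2[where f = "(+)"] refl sum.cong) (use row_act_unit[OF p] b in auto)
  finally show ?thesis unfolding row_factor_def by simp
qed

lemma stabiliser_iff:
  assumes p: "(i, j) \<in> Pos T n" and nz: "\<Phi> (i, j) \<noteq> 0" and u: "u \<in> unitriangular T n"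
  shows "mixed_act {(i, j)} u (\<Phi> (i, j) \<cdot>\<^sub>m eunit N i j) = \<Phi> (i, j) \<cdot>\<^sub>m eunit N i j \<longleftrightarrow>
    (\<forall>k\<in>{i<..cut j}. ent u i k = 0) \<and> (\<forall>k\<in>{cut j<..<j}. ent (ginv u) k j = 0)" (is "?M = ?E \<longleftrightarrow> ?R")
proof -
  note S = row_set_single[OF p] and b = cut_bounds[OF p] and r = Pos_range[OF p]
  note w = GL_inv_unitriangular(1)[OF u]
  have M: "ent ?M i k = (if k \<le> cut j then ent u i k else ent (ginv u) k j * \<Phi> (i, j))" if "k \<in> {i<..j}" for k
    using ent_mixed_act[OF S _ that] row_act_unit[OF p that] by simp
  have E: "ent ?E i k = (if k = j then \<Phi> (i, j) else 0)" if "k \<in> {i<..j}" for k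
    using ent_unit[OF r(1), of k] that b by auto
  have "?M = ?E \<longleftrightarrow> (\<forall>k\<in>{i<..j}. ent ?M i k = ent ?E i k)"
    using shaped_eqI[OF mixed_act_shaped[OF S unit_shaped[OF p] u] unit_shaped[OF p]] by auto
  also have "\<dots> \<longleftrightarrow> (\<forall>k\<in>{i<..j}. (if k \<le> cut j then ent u i k else ent (ginv u) k j * \<Phi> (i, j)) = (if k = j then \<Phi> (i, j) else 0))"
    using M E by simp
  also have "\<dots> \<longleftrightarrow> ?R"
  proof
    assume L: "\<forall>k\<in>{i<..j}. (if k \<le> cut j then ent u i k else ent (ginv u) k j * \<Phi> (i, j)) = (if k = j then \<Phi> (i, j) else 0)"
    show ?R
    proof (intro conjI ballI)
      fix k assume "k \<in> {i<..cut j}"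
      then show "ent u i k = 0" using L[rule_format, of k] b by auto
    next
      fix k assume "k \<in> {cut j<..<j}"
      then show "ent (ginv u) k j = 0" using L[rule_format, of k] b nz by auto
    qed
  next
    assume R: ?R
    show "\<forall>k\<in>{i<..j}. (if k \<le> cut j then ent u i k else ent (ginv u) k j * \<Phi> (i, j)) = (if k = j then \<Phi> (i, j) else 0)"
    proof
      fix k assume k: "k \<in> {i<..j}"
      consider "k \<le> cut j" | "k = j" | "k \<in> {cut j<..<j}" using k by fastforce
      then show "(if k \<le> cut j then ent u i k else ent (ginv u) k j * \<Phi> (i, j)) = (if k = j then \<Phi> (i, j) else 0)"
        by cases (use R k b unitriangularD(3)[OF w r(2)] in auto)
    qed
  qed
  finally show ?thesis .
qed

text \<open>In entry \<open>(i, j)\<close> of u u^-1 = 1 the stabiliser conditions kill every inner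
  term, so the entry of the inverse is minus that of \<open>u\<close>; this cancels the sign in
  \<open>row_factor\<close>.\<close>

lemma stabiliser_factor:
  assumes p: "(i, j) \<in> Pos T n" and nz: "\<Phi> (i, j) \<noteq> 0" and u: "u \<in> unitriangular T n"
    and st: "mixed_act {(i, j)} u (\<Phi> (i, j) \<cdot>\<^sub>m eunit N i j) = \<Phi> (i, j) \<cdot>\<^sub>m eunit N i j"
  shows "row_factor i j u (\<Phi> (i, j) \<cdot>\<^sub>m eunit N i j) = \<theta> (\<Phi> (i, j) * ent u i j)"
proof -
  note b = cut_bounds[OF p] and r = Pos_range[OF p] and w = GL_inv_unitriangular[OF u]
  from st have z: "\<And>k. k \<in> {i<..cut j} \<Longrightarrow> ent u i k = 0" "\<And>k. k \<in> {cut j<..<j} \<Longrightarrow> ent (ginv u) k j = 0"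
    unfolding stabiliser_iff[of i j \<Phi> u, OF p nz u] by auto
  have "0 = (\<Sum>k\<in>{i..j}. ent u i k * ent (ginv u) k j)"
    using ent_inverse_sum[OF u w(1,2), of i i j j] b r by auto
  also have "\<dots> = (\<Sum>k\<in>{i, j}. ent u i k * ent (ginv u) k j)"
  proof (rule sum.mono_neutral_right)
    show "\<forall>k\<in>{i..j} - {i, j}. ent u i k * ent (ginv u) k j = 0"
    proof
      fix k assume "k \<in> {i..j} - {i, j}"
      then consider "k \<in> {i<..cut j}" | "k \<in> {cut j<..<j}" by fastforce
      then show "ent u i k * ent (ginv u) k j = 0" by cases (use z in auto)
    qed
  qed (use b in auto)
  also have "\<dots> = ent (ginv u) i j + ent u i j"
    using b unitriangularD(3)[OF u r(1)] unitriangularD(3)[OF w(1) r(2)] by simp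
  finally have "ent (ginv u) i j = - ent u i j" by (simp add: eq_neg_iff_add_eq_0)
  moreover have "(\<Sum>k\<in>{i<..cut j}. ent u i k * ent (ginv u) k j) = 0" by (rule sum.neutral) (use z in simp)
  ultimately show ?thesis unfolding row_factor_unit[OF p] by simp
qed

text \<open>Here the shape of \<open>varrho_set\<close> is explained: \<open>ginv_mirror\<close>
  converts zeros in column \<open>j\<close> of the inverse, in rows beyond \<open>cut j\<close>,
  into zeros in row \<open>br j\<close> of \<open>u\<close>, in columns up to
  \<open>ntilde\<close>.\<close>

lemma varrho_iff:
  assumes p: "(i, j) \<in> Pos T n" and u: "u \<in> carrier (Ugrp T n)"
  shows "(\<forall>k\<in>{i<..cut j}. ent u i k = 0) \<and> (\<forall>k\<in>{cut j<..<j}. ent (ginv u) k j = 0) \<longleftrightarrow>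
    (\<forall>(a, b)\<in>varrho_set T n (i, j). ent u a b = 0)" (is "?L1 \<and> ?L2 \<longleftrightarrow> ?R")
proof (cases "j \<le> ntilde T n")
  case True
  have "cut j = j - 1" using True by (auto simp: cut_def ntilde_def split: if_splits)
  then have c: "{i<..cut j} = {i<..<j}" "{cut j<..<j} = {}" using PosD[OF p] by auto
  have "varrho_set T n (i, j) = {(i, k) |k. k \<in> {i<..<j}}"
    unfolding varrho_set_def using True Pos_left[OF p] by auto
  then show ?thesis unfolding c by auto
next
  case False
  note r = Pos_range[OF p]
  have nj: "n < j" using False by (auto simp: ntilde_def split: if_splits)
  then have c: "cut j = n" by (simp add: cut_def)
  let ?A = "{(i, k) |k. k \<in> {i<..n}}" and ?B = "{(br j, l) |l. l \<in> {br j<..ntilde T n}}"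
  have "(i, k) \<in> Pos T n" if "k \<in> {i<..n}" for k using Pos_left[OF p] that nj by simp
  moreover have "(br j, l) \<in> Pos T n" if "l \<in> {br j<..ntilde T n}" for l
    using that False r(2) bar_bar[OF r(2)] bar_range[OF r(2)] by (auto simp: Pos_def)
  ultimately have rho: "varrho_set T n (i, j) = ?A \<union> ?B"
    unfolding varrho_set_def using False by auto
  have "?L2 \<longleftrightarrow> (\<forall>l\<in>{br j<..ntilde T n}. ent u (br j) l = 0)"
  proof
    assume L: ?L2
    show "\<forall>l\<in>{br j<..ntilde T n}. ent u (br j) l = 0"
    proof
      fix l assume l: "l \<in> {br j<..ntilde T n}"
      then have lr: "l \<in> {1..N}" using bar_range[OF r(2)] by (auto simp: ntilde_def dimN_def split: if_splits)
      have "br l \<in> {cut j<..<j}" using l r unfolding c by (auto simp: bar_def ntilde_def dimN_def split: if_splits)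
      then have "ent (ginv u) (br l) j = 0" using L by blast
      then have "sgn_at (br (br l)) * sgn_at (br j) * ent u (br j) (br (br l)) = 0"
        unfolding ginv_mirror[OF u bar_range[OF lr] r(2)] .
      then show "ent u (br j) l = 0" unfolding bar_bar[OF lr] by (auto simp: sgn_at_def split: if_splits)
    qed
  next
    assume R: "\<forall>l\<in>{br j<..ntilde T n}. ent u (br j) l = 0"
    show ?L2
    proof
      fix k assume k: "k \<in> {cut j<..<j}"
      then have kr: "k \<in> {1..N}" using r unfolding c by auto
      have "br k \<in> {br j<..ntilde T n}" using k r unfolding c by (auto simp: bar_def ntilde_def dimN_def split: if_splits)
      then show "ent (ginv u) k j = 0" unfolding ginv_mirror[OF u kr r(2)] using R by simp
    qed
  qed
  then show ?thesis unfolding rho unfolding c by auto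
qed

section \<open>Root elements as generators of the stabiliser\<close>

lemma ent_root_elem:
  assumes p: "(a, b) \<in> Pos T n"
  obtains \<beta> \<gamma> where
    "root_elem T n a b \<alpha> \<in> carrier_mat N N"
    "\<And>k l. k \<in> {1..N} \<Longrightarrow> l \<in> {1..N} \<Longrightarrow> ent (root_elem T n a b \<alpha>) k l = (if k = l then 1 else 0) +
      (if k = a \<and> l = b then \<alpha> else 0) + (if k = br b \<and> l = br a then \<beta> else 0) + (if k = a \<and> l = br a then \<gamma> else 0)"
    "\<beta> = (if b = br a then 0 else - sgn_at b * \<alpha>)" "\<gamma> = (if b = br b then - (1 / 2 * \<alpha>\<^sup>2) else (0::'a))"
proof -
  \<comment> \<open>One formula for all types: \<open>\<beta>\<close> is the mirrored entry, absent
    on the antidiagonal, and \<open>\<gamma>\<close> the quadratic correction of the middle column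
    in type B.\<close>
  let ?\<beta> = "if b = br a then 0 else - sgn_at b * \<alpha>" and ?\<gamma> = "if b = br b then - (1 / 2 * \<alpha>\<^sup>2) else 0"
  note r = Pos_range[OF p] and b = PosD[OF p]
  have bb: "b = br b \<longleftrightarrow> T = TypeB \<and> b = n + 1" 
  proof (cases "T = TypeB")
    case True
    then show ?thesis using r unfolding bar_def dimN_def by auto
  next
    case False
    then have "b \<le> 2 * n" "br b = 2 * n + 1 - b" using r unfolding bar_def dimN_def by auto
    then have "b \<noteq> br b" by presburger
    then show ?thesis using False by simp
  qed
  have ba: "T \<noteq> TypeC \<Longrightarrow> b \<noteq> br a" using p by (auto simp: Pos_def)
  have an: "a \<le> n" using b by (auto simp: bar_def dimN_def split: if_splits)
  have bn: "b \<le> n \<Longrightarrow> b \<noteq> br a" using r an by (auto simp: bar_def dimN_def split: if_splits)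
  have car: "root_elem T n a b \<alpha> \<in> carrier_mat N N"
    unfolding root_elem_def Let_def by (cases T) (auto intro!: add_carrier_mat minus_carrier_mat)
  have "ent (root_elem T n a b \<alpha>) k l = (if k = l then 1 else 0) +
      (if k = a \<and> l = b then \<alpha> else 0) + (if k = br b \<and> l = br a then ?\<beta> else 0) + (if k = a \<and> l = br a then ?\<gamma> else 0)"
    if kl: "k \<in> {1..N}" "l \<in> {1..N}" for k l
  proof -
    note e = ent_add[OF _ _ kl] ent_minus[OF _ _ kl] ent_one[OF kl] ent_unit[OF kl] add_carrier_mat minus_carrier_mat
    have s: "sgn_at b = (if T = TypeC \<and> n < b then - 1 else 1)" unfolding sgn_at_def by auto
    consider (B) "T = TypeB" "b = n + 1" | (C) "T = TypeC" "n < b" "b < br a" | (Ca) "T = TypeC" "b = br a"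
      | (D) "b \<noteq> br b" "b \<noteq> br a" "\<not> (T = TypeC \<and> n < b)" "T = TypeB \<longrightarrow> b \<noteq> n + 1"
      using bb ba bn b by (cases "T = TypeC"; cases "b = br a"; cases "n < b"; cases "T = TypeB \<and> b = n + 1") auto
    then show ?thesis
    proof cases
      case B
      have R: "root_elem T n a b \<alpha> = 1\<^sub>m N + \<alpha> \<cdot>\<^sub>m eunit N a b - \<alpha> \<cdot>\<^sub>m eunit N (br b) (br a) - (1 / 2 * \<alpha>\<^sup>2) \<cdot>\<^sub>m eunit N a (br a)"
        using B by (simp add: root_elem_def Let_def bar_def dimN_def)
      have "b = br b" "b \<noteq> br a" "sgn_at b = 1" using bb ba B s by auto
      then show ?thesis unfolding R by (auto simp: e simp del: atLeastAtMost_iff)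
    next
      case C
      have R: "root_elem T n a b \<alpha> = 1\<^sub>m N + \<alpha> \<cdot>\<^sub>m eunit N a b + \<alpha> \<cdot>\<^sub>m eunit N (br b) (br a)"
        using C by (simp add: root_elem_def Let_def)
      have "b \<noteq> br b" "b \<noteq> br a" "sgn_at b = - 1" using bb C s by auto
      then show ?thesis unfolding R by (auto simp: e simp del: atLeastAtMost_iff)
    next
      case Ca
      have nb: "n < b" using bn Ca(2) by (cases "b \<le> n") auto
      have R: "root_elem T n a b \<alpha> = 1\<^sub>m N + \<alpha> \<cdot>\<^sub>m eunit N a (br a)"
        using Ca nb by (simp add: root_elem_def Let_def)
      have "b \<noteq> br b" using bb Ca by auto
      then show ?thesis unfolding R using Ca(2) by (auto simp: e simp del: atLeastAtMost_iff)
    next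
      case D
      have R: "root_elem T n a b \<alpha> = 1\<^sub>m N + \<alpha> \<cdot>\<^sub>m eunit N a b - \<alpha> \<cdot>\<^sub>m eunit N (br b) (br a)"
        using D(3,4) by (cases T) (simp_all add: root_elem_def Let_def)
      have "sgn_at b = 1" unfolding s if_not_P[OF D(3)] ..
      then show ?thesis unfolding R using D(1,2) by (auto simp: e simp del: atLeastAtMost_iff)
    qed
  qed
  with car show ?thesis using that by blast
qed

lemma root_elem_unitriangular:
  assumes p: "(a, b) \<in> Pos T n"
  shows "root_elem T n a b (\<alpha> :: 'a) \<in> unitriangular T n"
proof -
  obtain \<beta> \<gamma> where car: "root_elem T n a b \<alpha> \<in> carrier_mat N N"
    and e: "\<And>k l. k \<in> {1..N} \<Longrightarrow> l \<in> {1..N} \<Longrightarrow> ent (root_elem T n a b \<alpha>) k l = (if k = l then 1 else 0) +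
      (if k = a \<and> l = b then \<alpha> else 0) + (if k = br b \<and> l = br a then \<beta> else 0) + (if k = a \<and> l = br a then \<gamma> else 0)"
    by (rule ent_root_elem[OF p, of \<alpha>]) (rule that; assumption)
  note b = PosD[OF p] and r = Pos_range[OF p]
  have "a < br a" "br b < br a" using b r by (auto simp: bar_def)
  then show ?thesis using b by (intro unitriangularI[OF car]) (auto simp: e simp del: atLeastAtMost_iff)
qed

lemma root_elem_Ugrp:
  assumes two: "(2::'a) \<noteq> 0" and p: "(a, b) \<in> Pos T n"
  shows "root_elem T n a b (\<alpha> :: 'a) \<in> carrier (Ugrp T n)"
  unfolding isometry_iff[OF root_elem_unitriangular[OF p]]
proof (intro ballI)
  let ?x = "ent (root_elem T n a b \<alpha>)"
  obtain \<beta> \<gamma> where e: "\<And>k l. k \<in> {1..N} \<Longrightarrow> l \<in> {1..N} \<Longrightarrow> ?x k l = (if k = l then 1 else 0) +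
      (if k = a \<and> l = b then \<alpha> else 0) + (if k = br b \<and> l = br a then \<beta> else 0) + (if k = a \<and> l = br a then \<gamma> else 0)"
    and be: "\<beta> = (if b = br a then 0 else - sgn_at b * \<alpha>)" and ga: "\<gamma> = (if b = br b then - (1 / 2 * \<alpha>\<^sup>2) else 0)"
    by (rule ent_root_elem[OF p, of \<alpha>]) (rule that; assumption)
  note bd = PosD[OF p] and r = Pos_range[OF p]
  let ?a = "br a" and ?b = "br b"
  have r': "?a \<in> {1..N}" "?b \<in> {1..N}" "br ?a = a" "br ?b = b" using bar_range bar_bar r by auto
  have an: "a \<le> n" using bd by (auto simp: bar_def dimN_def split: if_splits)
  have sa: "sgn_at a = 1" unfolding sgn_at_def using an by simp
  define \<epsilon> :: 'a where "\<epsilon> = (if T = TypeC then - 1 else 1)"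
  have s: "sgn_at ?a = \<epsilon>" "sgn_at ?b = \<epsilon> * sgn_at b"
    unfolding \<epsilon>_def using sgn_at_br[OF r(1)] sgn_at_br[OF r(2)] sa by simp_all
  have ab: "?a \<noteq> a" using bd by (auto simp: bar_def)
  have aeb: "?b = a \<longleftrightarrow> b = ?a" using r' by metis
  have CbB: "b = ?a \<Longrightarrow> \<epsilon> = - 1" using p unfolding \<epsilon>_def by (auto simp: Pos_def)
  have BbB: "b = ?b \<Longrightarrow> \<epsilon> = 1" using r unfolding \<epsilon>_def by (auto simp: bar_def dimN_def) presburger
  \<comment> \<open>Column \<open>c\<close> of the root element as a combination of unit vectors,
    which reduces the forms to single entries.\<close>
  define w where "w c = (\<lambda>k. basis_vec c k + (basis_vec c b * \<alpha> + basis_vec c ?a * \<gamma>) * basis_vec a k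
    + (basis_vec c ?a * \<beta>) * basis_vec ?b k)" for c
  fix c d assume c: "c \<in> {1..N}" and d: "d \<in> {1..N}"
  have col: "?x k l = w l k" if "k \<in> {1..N}" "l \<in> {1..N}" for k l
    unfolding e[OF that] w_def basis_vec_def by (auto simp: algebra_simps)
  have wsum: "w c = basis_vec c + (\<lambda>k. (basis_vec c b * \<alpha> + basis_vec c ?a * \<gamma>) * basis_vec a k)
    + (\<lambda>k. (basis_vec c ?a * \<beta>) * basis_vec ?b k)" for c
    unfolding w_def by (simp add: fun_eq_iff)
  have fw: "form (w c) y = form (basis_vec c) y + (basis_vec c b * \<alpha> + basis_vec c ?a * \<gamma>) * y ?a
    + (basis_vec c ?a * \<beta>) * (\<epsilon> * sgn_at b * y b)" for y
    unfolding wsum form_add form_scale form_basis_left[OF r(1)] form_basis_left[OF r'(2)] s sa r' by simp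
  have fw': "form y (w d) = form y (basis_vec d) + (basis_vec d b * \<alpha> + basis_vec d ?a * \<gamma>) * (y ?a * \<epsilon>)
    + (basis_vec d ?a * \<beta>) * (y b * sgn_at b)" for y
    unfolding wsum form_add form_scale form_basis_right[OF r(1)] form_basis_right[OF r'(2)] s r' by simp
  define vb va wb wa where "vb = basis_vec c b" and "va = basis_vec c ?a" and "wb = basis_vec d b" and "wa = basis_vec d ?a"
  have wc: "w c ?a = va" "w c b = vb + (if b = ?b then va * \<beta> else 0)"
    unfolding w_def va_def vb_def using ab bd aeb r' by (auto simp: basis_vec_def)
  have "form (w c) (w d) = form (basis_vec c) (basis_vec d) + ((vb * \<alpha> + va * \<gamma>) * wa + va * \<beta> * (\<epsilon> * sgn_at b * wb)
    + (wb * \<alpha> + wa * \<gamma>) * (va * \<epsilon>) + wa * \<beta> * ((vb + (if b = ?b then va * \<beta> else 0)) * sgn_at b))"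
    unfolding fw'[of "w c"] fw[of "basis_vec d"] wc unfolding va_def vb_def wa_def wb_def by (simp only: add.assoc)
  also have "(vb * \<alpha> + va * \<gamma>) * wa + va * \<beta> * (\<epsilon> * sgn_at b * wb)
    + (wb * \<alpha> + wa * \<gamma>) * (va * \<epsilon>) + wa * \<beta> * ((vb + (if b = ?b then va * \<beta> else 0)) * sgn_at b) = 0"
  proof (cases "b = ?a")
    case True
    then have "\<beta> = 0" "\<gamma> = 0" "va = vb" "wa = wb" "\<epsilon> = - 1"
      using be ga CbB aeb bd unfolding va_def vb_def wa_def wb_def by auto
    then show ?thesis by simp
  next
    case False
    then have b: "\<beta> = - (sgn_at b * \<alpha>)" using be by simp
    show ?thesis
    proof (cases "b = ?b")
      case True
      then have e1: "\<epsilon> = 1" by (rule BbB)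
      then have "T \<noteq> TypeC" unfolding \<epsilon>_def using two by (auto simp: eq_neg_iff_add_eq_0 one_add_one split: if_splits)
      then have sb: "sgn_at b = 1" unfolding sgn_at_def by simp
      \<comment> \<open>The norm of column \<open>br a\<close> is
        \<open>2 * \<gamma> + \<alpha>\<^sup>2\<close>, and \<open>\<gamma>\<close> is chosen to
        make it vanish.\<close>
      have "\<gamma> + \<gamma> = - (\<alpha> * \<alpha>)" using ga True two by (simp add: power2_eq_square field_simps)
      then have g: "va * wa * \<gamma> + va * wa * \<gamma> = - (va * wa * (\<alpha> * \<alpha>))" by (metis distrib_left mult_minus_right)
      show ?thesis using g unfolding if_P[OF True] b sb e1 by (simp add: algebra_simps)
    next
      case F: False
      then have "\<gamma> = 0" using ga by simp
      then show ?thesis unfolding if_not_P[OF F] b by (simp add: algebra_simps)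
    qed
  qed
  finally have "form (w c) (w d) = form (basis_vec c) (basis_vec d)" by simp
  moreover have "form (\<lambda>k. ?x k c) (\<lambda>k. ?x k d) = form (w c) (w d)"
    by (rule form_cong) (use col c d in auto)
  ultimately show "form (\<lambda>k. ?x k c) (\<lambda>k. ?x k d) = form (basis_vec c) (basis_vec d)" by simp
qed

text \<open>By \<open>ginv_mirror\<close> the inverse vanishes strictly beyond the antidiagonal. In
  u u^-1 = 1 each inner product then has a zero factor, so the inverse is minus \<open>u\<close>
  above the diagonal. In types B and D an antidiagonal entry is its own reflection, hence equal to
  its negative.\<close>

lemma Ugrp_eq_one:
  fixes u :: "'a mat"
  assumes two: "(2::'a) \<noteq> 0" and u: "u \<in> carrier (Ugrp T n)"
    and z: "\<And>i j. (i, j) \<in> Pos T n \<Longrightarrow> ent u i j = 0"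
  shows "u = 1\<^sub>m N"
proof -
  have uu: "u \<in> unitriangular T n" using u Ugrp_subset by blast
  note w = GL_inv_unitriangular[OF uu] and U = unitriangularD[OF uu]
  have wz: "ent (ginv u) k l = 0" if kl: "k \<in> {1..N}" "l \<in> {1..N}" "k < l" "br k < l" for k l
  proof -
    have "(br l, br k) \<in> Pos T n" using kl by (auto simp: Pos_def bar_def)
    then show ?thesis unfolding ginv_mirror[OF u kl(1,2)] by (simp add: z)
  qed
  have uz: "ent u k l = 0" if kl: "k \<in> {1..N}" "l \<in> {1..N}" "k < l" "l < br k" for k l
    by (rule z) (use kl in \<open>auto simp: Pos_def\<close>)
  have neg: "ent (ginv u) k m = - ent u k m" if km: "k \<in> {1..N}" "m \<in> {1..N}" "k < m" for k m
  proof -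
    have "0 = (\<Sum>l\<in>{k..m}. ent u k l * ent (ginv u) l m)"
      using ent_inverse_sum[OF uu w(1,2), of k k m m] km by auto
    also have "\<dots> = (\<Sum>l\<in>{k, m}. ent u k l * ent (ginv u) l m)"
    proof (rule sum.mono_neutral_right)
      show "\<forall>l\<in>{k..m} - {k, m}. ent u k l * ent (ginv u) l m = 0"
      proof
        fix l assume "l \<in> {k..m} - {k, m}"
        then have l: "k < l" "l < m" "l \<in> {1..N}" using km by auto
        show "ent u k l * ent (ginv u) l m = 0"
        proof (cases "l < br k")
          case True
          then show ?thesis using uz[OF km(1) l(3,1)] by simp
        next
          case False
          then have "br l < m" using l km by (auto simp: bar_def)
          then show ?thesis using wz[OF l(3) km(2) l(2)] by simp
        qed
      qed
    qed (use km in auto)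
    also have "\<dots> = ent (ginv u) k m + ent u k m"
      using km U(3)[OF km(1)] unitriangularD(3)[OF w(1) km(2)] by simp
    finally show ?thesis by (simp add: eq_neg_iff_add_eq_0)
  qed
  show ?thesis
  proof (rule ent_eqI[OF U(1) one_carrier_mat])
    fix k l assume k: "k \<in> {1..N}" and l: "l \<in> {1..N}"
    have "ent u k l = 0" if kl: "k < l"
    proof -
      consider "(k, l) \<in> Pos T n" | "br k < l" | "l = br k" "T \<noteq> TypeC" using k kl by (cases "T = TypeC"; cases l "br k" rule: linorder_cases) (auto simp: Pos_def)
      then show ?thesis
      proof cases
        case 2
        then show ?thesis using wz[OF k l kl] neg[OF k l kl] by simp
      next
        case 3
        then have s: "sgn_at i = 1" for i by (simp add: sgn_at_def)
        have "ent (ginv u) k l = ent u k l" unfolding ginv_mirror[OF u k l] s using 3 bar_bar[OF k] by simp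
        then have "2 * ent u k l = 0" using neg[OF k l kl] by simp
        then show ?thesis using two by simp
      qed (rule z)
    qed
    then show "ent u k l = ent (1\<^sub>m N) k l"
      using U(2)[OF k l] U(3)[OF k] ent_one[OF k l] by (cases k l rule: linorder_cases) auto
  qed
qed

text \<open>The column operations on columns \<open>b\<close> and \<open>br a\<close> pick up
  entries of \<open>u\<close> in columns \<open>a\<close> and \<open>br b\<close>. In rows above
  \<open>a\<close> these vanish by assumption. In row \<open>a\<close> the position
  \<open>(a, br a)\<close> is excluded unless it is the root position itself.\<close>

lemma ent_mult_root:
  fixes u :: "'a mat"
  assumes p: "(a, b) \<in> Pos T n" and u: "u \<in> unitriangular T n" and rc: "(r, c) \<in> Pos T n"
    and z: "\<And>r c. (r, c) \<in> Pos T n \<Longrightarrow> r < a \<Longrightarrow> ent u r c = 0"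
  shows "c \<noteq> br a \<or> r \<noteq> a \<or> b = br a \<Longrightarrow> ent (u * root_elem T n a b \<alpha>) r c = ent u r c + (if r = a \<and> c = b then \<alpha> else 0)"
proof -
  assume not_end: "c \<noteq> br a \<or> r \<noteq> a \<or> b = br a"
  obtain \<beta> \<gamma> where car: "root_elem T n a b \<alpha> \<in> carrier_mat N N"
    and e: "\<And>k l. k \<in> {1..N} \<Longrightarrow> l \<in> {1..N} \<Longrightarrow> ent (root_elem T n a b \<alpha>) k l = (if k = l then 1 else 0) +
      (if k = a \<and> l = b then \<alpha> else 0) + (if k = br b \<and> l = br a then \<beta> else 0) + (if k = a \<and> l = br a then \<gamma> else 0)"
    and be: "\<beta> = (if b = br a then 0 else - sgn_at b * \<alpha>)" and ga: "\<gamma> = (if b = br b then - (1 / 2 * \<alpha>\<^sup>2) else 0)"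
    by (rule ent_root_elem[OF p, of \<alpha>]) (rule that; assumption)
  note bd = PosD[OF p] and rr = Pos_range[OF p] and rcr = Pos_range[OF rc] and rcd = PosD[OF rc]
  note U = unitriangularD[OF u]
  have b': "br b \<in> {1..N}" by (rule bar_range[OF rr(2)])
  have exp: "ent (u * root_elem T n a b \<alpha>) r c = ent u r c + (if c = b then ent u r a * \<alpha> else 0)
    + (if c = br a then ent u r (br b) * \<beta> else 0) + (if c = br a then ent u r a * \<gamma> else 0)"
  proof -
    have "ent (u * root_elem T n a b \<alpha>) r c = (\<Sum>k=1..N. ent u r k * ent (root_elem T n a b \<alpha>) k c)"
      by (rule ent_mult[OF U(1) car rcr])
    also have "\<dots> = (\<Sum>k=1..N. (if k = c then ent u r c else 0) + (if k = a then (if c = b then ent u r a * \<alpha> else 0) else 0)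
      + (if k = br b then (if c = br a then ent u r (br b) * \<beta> else 0) else 0) + (if k = a then (if c = br a then ent u r a * \<gamma> else 0) else 0))"
    proof (rule sum.cong[OF refl])
      fix k assume k: "k \<in> {1..N}"
      show "ent u r k * ent (root_elem T n a b \<alpha>) k c = (if k = c then ent u r c else 0) + (if k = a then (if c = b then ent u r a * \<alpha> else 0) else 0)
      + (if k = br b then (if c = br a then ent u r (br b) * \<beta> else 0) else 0) + (if k = a then (if c = br a then ent u r a * \<gamma> else 0) else 0)"
        unfolding e[OF k rcr(2)] distrib_left by (intro arg_cong2[where f = "(+)"]) auto
    qed
    also have "\<dots> = ent u r c + (if c = b then ent u r a * \<alpha> else 0)
      + (if c = br a then ent u r (br b) * \<beta> else 0) + (if c = br a then ent u r a * \<gamma> else 0)"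
      unfolding sum.distrib using rcr rr b' by (simp only: sum.delta finite_atLeastAtMost if_True)
    finally show ?thesis .
  qed
  have ca: "ent u r a = (if r = a then 1 else 0)" if "c = b \<or> c = br a"
  proof (cases r a rule: linorder_cases)
    case less
    then have "(r, a) \<in> Pos T n" by (intro Pos_left[OF rc]) (use that bd in auto)
    then show ?thesis using z less by simp
  qed (use U(2)[OF rcr(1) rr(1)] U(3)[OF rr(1)] in auto)
  show ?thesis
  proof (cases "c = br a")
    case False
    then show ?thesis unfolding exp using ca by auto
  next
    case True
    have ra: "r \<le> a" using rcd True rcr rr by (auto simp: bar_def)
    show ?thesis
    proof (cases "r = a")
      case True
      then have bb: "b = br a" using not_end \<open>c = br a\<close> by simp
      then have "\<beta> = 0" "\<gamma> = 0" using be ga bd bar_bar[OF rr(1)] by auto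
      then show ?thesis unfolding exp using ca \<open>c = br a\<close> True bb by simp
    next
      case False
      then have lt: "r < a" using ra by simp
      have "a \<le> br b" "br b \<le> c" using bd rr True by (auto simp: bar_def)
      then have "(r, br b) \<in> Pos T n" using lt by (intro Pos_left[OF rc]) auto
      then have "ent u r (br b) = 0" "ent u r a = 0" using z lt ca True by auto
      then show ?thesis unfolding exp using lt by simp
    qed
  qed
qed

text \<open>The second claim keeps the position excluded in \<open>ent_mult_root\<close> away from
  the zeros to be preserved.\<close>

lemma varrho_subset:
  assumes p: "(i, j) \<in> Pos T n" and ab: "(a, b) \<in> varrho_set T n (i, j)"
  shows "(a, b) \<in> Pos T n" "b \<noteq> br a"
proof -
  show pa: "(a, b) \<in> Pos T n" using ab unfolding varrho_set_def by (auto split: if_splits)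
  have "b \<le> ntilde T n" using ab unfolding varrho_set_def by (auto split: if_splits simp: ntilde_def)
  then show "b \<noteq> br a" using PosD[OF pa] pa by (auto simp: Pos_def bar_def ntilde_def dimN_def split: if_splits)
qed

text \<open>Right multiplication with a root element clears the lexicographically first nonzero entry in
  \<open>\<P>\<close>; the only other entry in \<open>\<P>\<close> that can change is \<open>(a, br a)\<close> in type C, which comes later and does not
  lie in \<open>varrho_set\<close>.\<close>

lemma clearing:
  fixes u :: "'a mat"
  assumes two: "(2::'a) \<noteq> 0" and p: "(i, j) \<in> Pos T n"
    and m: "m \<le> (N + 1) * (N + 1)"
  shows "u \<in> carrier (Ugrp T n) \<Longrightarrow> (\<And>a b. (a, b) \<in> varrho_set T n (i, j) \<Longrightarrow> ent u a b = 0) \<Longrightarrow>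
    (\<And>a b. (a, b) \<in> Pos T n \<Longrightarrow> a * (N + 1) + b < m \<Longrightarrow> ent u a b = 0) \<Longrightarrow> u \<in> U_sub T n (i, j)"
  using m
\<comment> \<open>The key \<open>a * (N + 1) + b\<close> encodes the lexicographic order, as columns
  are at most \<open>N\<close>. All keys lie below the bound at which this downward induction
  starts, and there \<open>Ugrp_eq_one\<close> applies.\<close>
proof (induction m arbitrary: u rule: inc_induct)
  case base
  have "ent u a b = 0" if ab: "(a, b) \<in> Pos T n" for a b
  proof (rule base(3)[OF ab])
    have "a * (N + 1) \<le> N * (N + 1)" using Pos_range[OF ab] by (intro mult_le_mono1) auto
    then show "a * (N + 1) + b < (N + 1) * (N + 1)" using Pos_range[OF ab] by simp
  qed
  then have "u = \<one>\<^bsub>Ugrp T n\<^esub>" using Ugrp_eq_one[OF two base(1)] by (simp add: Ugrp_simps)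
  then show ?case unfolding U_sub_def by (simp add: generate.one)
next
  case (step m)
  show ?case
  proof (cases "\<exists>a b. (a, b) \<in> Pos T n \<and> a * (N + 1) + b = m \<and> ent u a b \<noteq> 0")
    case False
    have "ent u a b = 0" if "(a, b) \<in> Pos T n" "a * (N + 1) + b < Suc m" for a b
      using step.prems(3)[OF that(1)] that False by (cases "a * (N + 1) + b = m") auto
    then show ?thesis using step.IH step.prems by blast
  next
    case True
    then obtain a b where ab: "(a, b) \<in> Pos T n" and key: "a * (N + 1) + b = m" and nz: "ent u a b \<noteq> 0" by blast
    let ?x = "root_elem T n a b" and ?U = "Ugrp T n :: 'a mat monoid"
    interpret U: Group.group ?U by (rule Ugrp_group)
    have uu: "u \<in> unitriangular T n" using step.prems(1) Ugrp_subset by blast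
    have notrho: "(a, b) \<notin> varrho_set T n (i, j)" using step.prems(2) nz by blast
    have gens: "(\<Union>ab\<in>Pos T n - varrho_set T n (i, j). root_subgroup T n ab) \<subseteq> carrier ?U"
      using root_elem_Ugrp[OF two] unfolding root_subgroup_def by auto
    have xU: "?x t \<in> U_sub T n (i, j)" for t :: 'a
      unfolding U_sub_def by (rule generate.incl) (use ab notrho in \<open>auto simp: root_subgroup_def intro!: bexI[of _ "(a, b)"]\<close>)
    have xG: "?x t \<in> carrier ?U" for t :: 'a by (rule root_elem_Ugrp[OF two ab])
    define v where "v = u * ?x (- ent u a b)"
    have vG: "v \<in> carrier ?U" unfolding v_def using U.m_closed[OF step.prems(1) xG] by (simp add: Ugrp_simps)
    have kN: "c * (N + 1) + d < a * (N + 1) + b" if "c < a" "d \<le> N" for c d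
    proof -
      have "(c + 1) * (N + 1) \<le> a * (N + 1)" by (rule mult_le_mono1) (use that in simp)
      then show ?thesis using that by simp
    qed
    have rows: "ent u r c = 0" if "(r, c) \<in> Pos T n" "r < a" for r c
      using step.prems(3)[OF that(1)] kN[OF that(2), of c] Pos_range[OF that(1)] key by auto
    have em: "ent (u * ?x t) r c = ent u r c + (if r = a \<and> c = b then t else 0)"
      if "(r, c) \<in> Pos T n" "c \<noteq> br a \<or> r \<noteq> a \<or> b = br a" for r c t
      by (rule ent_mult_root[OF ab uu that(1) _ that(2)]) (rule rows)
    have "v \<in> U_sub T n (i, j)"
    proof (rule step.IH[OF vG])
      fix r c assume rho: "(r, c) \<in> varrho_set T n (i, j)"
      have "c \<noteq> br a \<or> r \<noteq> a \<or> b = br a" using varrho_subset(2)[OF p rho] by auto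
      note e = em[OF varrho_subset(1)[OF p rho] this, of "- ent u a b"]
      have "\<not> (r = a \<and> c = b)" using rho notrho by auto
      then show "ent v r c = 0" unfolding v_def e using step.prems(2)[OF rho] by auto
    next
      fix r c assume rc: "(r, c) \<in> Pos T n" and k: "r * (N + 1) + c < Suc m"
      have ra: "r \<le> a"
      proof (rule ccontr)
        assume "\<not> r \<le> a"
        then have "(a + 1) * (N + 1) \<le> r * (N + 1)" by (intro mult_le_mono1) simp
        then show False using k key Pos_range[OF ab] Pos_range[OF rc] by simp
      qed
      have "c \<noteq> br a \<or> r \<noteq> a \<or> b = br a" using k key PosD[OF ab] by auto
      note e = em[OF rc this, of "- ent u a b"]
      show "ent v r c = 0"
      proof (cases "r = a \<and> c = b")
        case False
        then have "r * (N + 1) + c < m" using k key kN[of r c] ra Pos_range[OF rc] by (cases "r = a") auto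
        then show ?thesis unfolding v_def e using step.prems(3)[OF rc] False by auto
      next
        case True
        then have "ent v r c = ent u r c + - ent u a b" unfolding v_def e by (simp only: if_True simp_thms)
        then show ?thesis using True by simp
      qed
    qed
    then have "v \<otimes>\<^bsub>?U\<^esub> inv\<^bsub>?U\<^esub> ?x (- ent u a b) \<in> U_sub T n (i, j)"
      using xU[of "- ent u a b"] U.generate_m_inv_closed[OF gens] generate.eng[of _ ?U] unfolding U_sub_def by blast
    moreover have "v = u \<otimes>\<^bsub>?U\<^esub> ?x (- ent u a b)" unfolding v_def by (simp add: Ugrp_simps)
    ultimately show ?thesis using step.prems(1) xG by (simp add: U.m_assoc)
  qed
qed

definition row_orbit :: "nat \<Rightarrow> nat \<Rightarrow> 'a \<Rightarrow> 'a mat set"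
  where "row_orbit i j t = (\<lambda>u. mixed_act {(i, j)} u (t \<cdot>\<^sub>m eunit N i j)) ` carrier (Ugrp T n)"

lemma row_orbit_shaped: "(i, j) \<in> Pos T n \<Longrightarrow> row_orbit i j (\<Phi> (i, j)) \<subseteq> shaped {(i, j)} \<Phi>"
  unfolding row_orbit_def using mixed_act_shaped[OF row_set_single unit_shaped] Ugrp_subset by blast

text \<open>The zeros on \<open>varrho_set\<close> cut out a subgroup because they describe a
  stabiliser, and the permitted root elements have these zeros; conversely, \<open>clearing\<close>
  writes every solution as a product of such root elements.\<close>

lemma U_sub_stabiliser:
  assumes two: "(2::'a) \<noteq> 0" and p: "(i, j) \<in> Pos T n" and nz: "\<Phi> (i, j) \<noteq> 0"
  shows "U_sub T n (i, j) = {u \<in> carrier (Ugrp T n).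
    mixed_act {(i, j)} u (\<Phi> (i, j) \<cdot>\<^sub>m eunit N i j) = \<Phi> (i, j) \<cdot>\<^sub>m eunit N i j}" (is "_ = ?H")
proof -
  let ?U = "Ugrp T n :: 'a mat monoid"
  interpret U: Group.group ?U by (rule Ugrp_group)
  note S = row_set_single[OF p] and E = unit_shaped[OF p, of \<Phi>]
  have H: "u \<in> ?H \<longleftrightarrow> u \<in> carrier ?U \<and> (\<forall>(a, b)\<in>varrho_set T n (i, j). ent u a b = 0)" for u
    using stabiliser_iff[of i j \<Phi> u, OF p nz] varrho_iff[OF p, of u] Ugrp_subset by blast
  have "subgroup ?H ?U"
  proof (rule finite_subset_subgroup[OF Ugrp_group])
    show "finite ?H" by (rule finite_subset[OF _ Ugrp_finite[of T n]]) auto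
    show "\<one>\<^bsub>?U\<^esub> \<in> ?H" using U.one_closed mixed_act_one(1)[OF S E] by (simp add: Ugrp_simps)
    fix x y assume x: "x \<in> ?H" and y: "y \<in> ?H"
    then have "x \<in> unitriangular T n" "y \<in> unitriangular T n" using Ugrp_subset by blast+
    then have "mixed_act {(i, j)} (x * y) (\<Phi> (i, j) \<cdot>\<^sub>m eunit N i j) = \<Phi> (i, j) \<cdot>\<^sub>m eunit N i j"
      using mixed_act_mult(1)[OF S E, of x y] x y by simp
    moreover have "x \<otimes>\<^bsub>?U\<^esub> y \<in> carrier ?U" using x y by (intro U.m_closed) auto
    ultimately show "x \<otimes>\<^bsub>?U\<^esub> y \<in> ?H" by (simp add: Ugrp_simps(2))
  qed auto
  moreover have "(\<Union>ab\<in>Pos T n - varrho_set T n (i, j). root_subgroup T n ab) \<subseteq> ?H"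
  proof
    fix x :: "'a mat" assume "x \<in> (\<Union>ab\<in>Pos T n - varrho_set T n (i, j). root_subgroup T n ab)"
    then obtain a b t where ab: "(a, b) \<in> Pos T n" "(a, b) \<notin> varrho_set T n (i, j)" and x: "x = root_elem T n a b t"
      unfolding root_subgroup_def by auto
    have "ent x r c = 0" if rho: "(r, c) \<in> varrho_set T n (i, j)" for r c
    proof -
      note rc = varrho_subset[OF p rho]
      note b = PosD[OF rc(1)] and rr = Pos_range[OF rc(1)]
      have "ent (1\<^sub>m N * root_elem T n a b t) r c = ent (1\<^sub>m N) r c + (if r = a \<and> c = b then t else 0)"
      proof (rule ent_mult_root[OF ab(1) one_unitriangular rc(1)])
        fix r c assume rc: "(r, c) \<in> Pos T n"
        show "ent (1\<^sub>m N) r c = (0::'a)" using ent_one[OF Pos_range[OF rc]] PosD[OF rc] by simp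
      qed (use rc in auto)
      moreover have "1\<^sub>m N * root_elem T n a b t = x"
        unfolding x by (rule left_mult_one_mat[OF unitriangularD(1)[OF root_elem_unitriangular[OF ab(1)]]])
      ultimately show ?thesis using rho ab(2) b ent_one[OF rr] by auto
    qed
    then show "x \<in> ?H" unfolding H using root_elem_Ugrp[OF two ab(1)] x by auto
  qed
  ultimately have "U_sub T n (i, j) \<subseteq> ?H" unfolding U_sub_def by (rule U.generate_subgroup_incl[rotated])
  moreover have "?H \<subseteq> U_sub T n (i, j)"
  proof
    fix u assume "u \<in> ?H"
    then show "u \<in> U_sub T n (i, j)"
      unfolding H using clearing[OF two p, of 0 u] by auto
  qed
  ultimately show ?thesis by (rule equalityI)
qed

text \<open>\<open>induced_character_orbit\<close> for the orbit of the main matrix unit, with the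
  subgroup identified by \<open>U_sub_stabiliser\<close> and the inducing character by
  \<open>stabiliser_factor\<close>.\<close>

lemma elementary_character_orbit:
  assumes two: "(2::'a) \<noteq> 0" and p: "(i, j) \<in> Pos T n" and t: "t \<noteq> 0" and g: "g \<in> carrier (Ugrp T n)"
  shows "elementary_character T n \<theta> (i, j) t g
    = (\<Sum>C\<in>{C \<in> row_orbit i j t. mixed_act {(i, j)} g C = C}. row_factor i j g C)"
proof -
  let ?U = "Ugrp T n :: 'a mat monoid" and ?\<Phi> = "\<lambda>_::nat \<times> nat. t" and ?E = "t \<cdot>\<^sub>m eunit N i j"
  note S = row_set_single[OF p] and E = unit_shaped[OF p, of ?\<Phi>]
  have sub: "u \<in> unitriangular T n" if "u \<in> carrier ?U" for u using that Ugrp_subset by blast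
  have f: "mixed_factor {(i, j)} u C = row_factor i j u C" for u C by (simp add: mixed_factor_def)
  have "(\<Sum>C\<in>{C \<in> (\<lambda>u. mixed_act {(i, j)} u ?E) ` carrier ?U. mixed_act {(i, j)} g C = C}. row_factor i j g C)
    = induced_character ?U (U_sub T n (i, j)) (\<lambda>u. \<theta> (t * ent u i j)) g"
  proof (rule induced_character_orbit[OF Ugrp_group Ugrp_finite g E])
    fix x C assume "x \<in> carrier ?U" "C \<in> shaped {(i, j)} ?\<Phi>"
    then show "mixed_act {(i, j)} x C \<in> shaped {(i, j)} ?\<Phi>" using mixed_act_shaped[OF S] sub by blast
  next
    fix x y C assume x: "x \<in> carrier ?U" "y \<in> carrier ?U" and C: "C \<in> shaped {(i, j)} ?\<Phi>"
    show "mixed_act {(i, j)} (x \<otimes>\<^bsub>?U\<^esub> y) C = mixed_act {(i, j)} y (mixed_act {(i, j)} x C)"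
      "row_factor i j (x \<otimes>\<^bsub>?U\<^esub> y) C = row_factor i j x C * row_factor i j y (mixed_act {(i, j)} x C)"
      using mixed_act_mult[OF S C sub[OF x(1)] sub[OF x(2)]] unfolding f Ugrp_simps(2) by auto
  next
    fix C assume C: "C \<in> shaped {(i, j)} ?\<Phi>"
    show "mixed_act {(i, j)} \<one>\<^bsub>?U\<^esub> C = C" "row_factor i j \<one>\<^bsub>?U\<^esub> C = 1"
      using mixed_act_one[OF S C] unfolding f Ugrp_simps(3) by auto
  next
    show st: "U_sub T n (i, j) = {h \<in> carrier ?U. mixed_act {(i, j)} h ?E = ?E}"
      by (rule U_sub_stabiliser[OF two p, of ?\<Phi>, OF t])
    fix h :: "'a mat" assume "h \<in> U_sub T n (i, j)"
    then show "\<theta> (t * ent h i j) = row_factor i j h ?E"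
      using stabiliser_factor[of i j ?\<Phi> h, OF p t] sub unfolding st by auto
  qed
  then show ?thesis unfolding elementary_character_def row_orbit_def by simp
qed

end

section \<open>Row orbits away from the antidiagonal\<close>

context odd_setting
begin

text \<open>\<open>witt\<close> with the unit vectors as sources. Under \<open>free\<close> each
  pair to be compared is orthogonal or has \<open>c = br d\<close>, where the leading entries
  determine the form, so no compatibility remains to be checked.\<close>

lemma prescribed_columns:
  assumes v: "\<And>c. c \<in> {1..N} \<Longrightarrow> leads c (v c)" and f: "\<And>c. c \<in> {1..N} \<Longrightarrow> f c < c"
    and free: "\<And>c d. c \<in> {1..N} \<Longrightarrow> d \<in> {1..N} \<Longrightarrow> f c < br d \<Longrightarrow> f d < br c \<Longrightarrow> c \<le> br d"
  shows "\<exists>w\<in>carrier (Ugrp T n). \<forall>c\<in>{1..N}. \<forall>k\<in>{1..N}. f c < k \<longrightarrow> ent w k c = v c k"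
proof -
  have lb: "leads c (basis_vec c)" for c by (simp add: leads_def basis_vec_def)
  have "\<exists>w\<in>carrier (Ugrp T n). \<forall>c\<in>{1..N}. \<forall>k\<in>{1..N}. f c < k \<longrightarrow> mat_vec w (basis_vec c) k = v c k"
  proof (rule witt[OF v lb f])
    fix c d assume c: "c \<in> {1..N}" and d: "d \<in> {1..N}" and l: "f c < br d" "f d < br c"
    have z: "x k = 0" if "leads e x" "e < k" for e x k using that unfolding leads_def by blast
    have g: "form x y = form (basis_vec c) (basis_vec d)" if x: "leads c x" and y: "leads d y" for x y
    proof (cases "c = br d")
      case True
      have "form a b = sgn_at (br d)" if "leads c a" "leads d b" for a b
        using form_leading[of d a b, OF z[OF that(1)] z[OF that(2)] d] that True unfolding leads_def by simp
      then show ?thesis using x y lb by metis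
    next
      case False
      then have "c < br d" using free[OF c d l] by simp
      then have "form a b = 0" if "leads c a" "leads d b" for a b
        by (intro form_eq_0[of c _ d]) (use z that d in auto)
      then show ?thesis using x y lb by metis
    qed
    show "form (v c) (v d) = form (basis_vec c) (basis_vec d)" by (rule g[OF v[OF c] v[OF d]])
  qed
  then show ?thesis using mat_vec_basis by metis
qed

text \<open>Column \<open>j\<close> of the inverse \<open>w\<close> has to show the character part
  of \<open>C\<close>, and by \<open>ginv_mirror\<close> its column \<open>br i\<close> has to show
  the delta part. For \<open>j \<noteq> br i\<close> these are different columns and can be
  prescribed independently.\<close>

lemma row_orbit_full:
  assumes p: "(i, j) \<in> Pos T n" and ne: "j \<noteq> br i" and nz: "\<Phi> (i, j) \<noteq> 0"
  shows "row_orbit i j (\<Phi> (i, j)) = shaped {(i, j)} \<Phi>"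
proof (rule equalityI[OF row_orbit_shaped[OF p] subsetI])
  fix C assume C: "C \<in> shaped {(i, j)} \<Phi>"
  note b = cut_bounds[OF p] and r = Pos_range[OF p] and pd = PosD[OF p]
  note bi = bar_range[OF r(1)]
  have cn: "cut j \<le> n" unfolding cut_def by simp
  then have m: "cut j \<in> {1..N}" using b r by auto
  have bm: "n < br (cut j)" "br (cut j) \<le> br i" using cn m b by (auto simp: bar_def dimN_def)
  \<comment> \<open>Rows beyond \<open>cut j\<close> are prescribed in column \<open>j\<close>, and
    rows from \<open>br (cut j)\<close> on in column \<open>br i\<close>, the reflections of the
    delta columns; elsewhere only the leading entry. The signs in \<open>v\<close> are those of
    \<open>ginv_mirror\<close>.\<close>
  define f where "f c = (if c = j then cut j else if c = br i then br (cut j) - 1 else c - 1)" for c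
  define v where "v c = (if c = j then (\<lambda>k. if cut j < k \<and> k \<le> j then ent C i k / \<Phi> (i, j) else 0)
    else if c = br i then (\<lambda>k. if k = br i then 1 else if br (cut j) \<le> k \<and> k < br i then sgn_at k * sgn_at (br i) * ent C i (br k) else 0)
    else basis_vec c)" for c
  have "\<exists>w\<in>carrier (Ugrp T n). \<forall>c\<in>{1..N}. \<forall>k\<in>{1..N}. f c < k \<longrightarrow> ent w k c = v c k"
  proof (rule prescribed_columns)
    fix c assume c: "c \<in> {1..N}"
    show "leads c (v c)" using shapedD(2)[OF C, of i j] nz b ne unfolding leads_def v_def basis_vec_def by auto
    show "f c < c" using c b bm unfolding f_def by auto
  next
    fix c d assume c: "c \<in> {1..N}" and d: "d \<in> {1..N}" and l: "f c < br d" "f d < br c"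
    note bbi = bar_bar[OF r(1)]
    show "c \<le> br d"
    proof (cases "c = j")
      case cj: True
      then have lc: "cut j < br d" using l(1) unfolding f_def by simp
      have dbi: "d \<noteq> br i" using lc b bbi by auto
      show ?thesis
      proof (cases "d = j")
        case True
        then show ?thesis using lc cj r unfolding cut_def by (auto simp: bar_def dimN_def split: if_splits)
      next
        case False
        then have "d - 1 < br j" using l(2) dbi cj unfolding f_def by simp
        then show ?thesis using cj d r by (auto simp: bar_def)
      qed
    next
      case cj: False
      show ?thesis
      proof (cases "c = br i")
        case ci: True
        have "d \<noteq> j" using l(2) ci bbi b unfolding f_def by auto
        moreover have "d \<noteq> br i" using l(1) ci cj bbi bm b cn unfolding f_def by auto
        ultimately have "d - 1 < i" using l(2) ci bbi unfolding f_def by simp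
        then show ?thesis using ci d r by (auto simp: bar_def)
      next
        case False
        then show ?thesis using l(1) cj c unfolding f_def by auto
      qed
    qed
  qed
  then obtain w where w: "w \<in> carrier (Ugrp T n)" and e: "\<And>c k. c \<in> {1..N} \<Longrightarrow> k \<in> {1..N} \<Longrightarrow> f c < k \<Longrightarrow> ent w k c = v c k"
    by blast
  have wu: "w \<in> unitriangular T n" using w Ugrp_subset by blast
  define u where "u = ginv w"
  have u: "u \<in> carrier (Ugrp T n)" unfolding u_def by (rule Ugrp_inv_closed[OF w])
  have uu: "u \<in> unitriangular T n" using u Ugrp_subset by blast
  have wg: "ginv u = w" unfolding u_def by (rule GL_inv_inv[OF wu])
  note S = row_set_single[OF p] and E = unit_shaped[OF p, of \<Phi>]
  have "mixed_act {(i, j)} u (\<Phi> (i, j) \<cdot>\<^sub>m eunit N i j) = C"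
  proof (rule shaped_eqI[OF mixed_act_shaped[OF S E uu] C])
    fix a b k assume "(a, b) \<in> {(i, j)}" "k \<in> {a<..b}"
    then have ab: "a = i" "b = j" and k: "k \<in> {i<..j}" by auto
    have kN: "k \<in> {1..N}" using k r by auto
    have bk: "br k \<in> {1..N}" by (rule bar_range[OF kN])
    have "(if k \<le> cut j then ent u i k else ent (ginv u) k j * \<Phi> (i, j)) = ent C i k"
    proof (cases "k \<le> cut j")
      case True
      have "br (cut j) \<le> br k" "br k < br i" using True k kN r m by (auto simp: bar_def)
      then have "ent w (br k) (br i) = sgn_at (br k) * sgn_at (br i) * ent C i k"
        using e[OF bi bk] bm ne bar_bar[OF kN] unfolding f_def v_def by auto
      then show ?thesis using ginv_mirror[OF w r(1) kN] True unfolding u_def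
        by (simp add: mult_ac)
    next
      case False
      then show ?thesis using e[OF r(2) kN] k nz unfolding wg f_def v_def by auto
    qed
    then show "ent (mixed_act {(i, j)} u (\<Phi> (i, j) \<cdot>\<^sub>m eunit N i j)) a k = ent C a k"
      using ent_mixed_act[OF S _ k] row_act_unit[OF p k] unfolding ab by simp
  qed
  then show "C \<in> row_orbit i j (\<Phi> (i, j))" unfolding row_orbit_def using u by blast
qed

end

section \<open>Supercharacters\<close>

context monomial_setting
begin

definition row_part :: "nat \<Rightarrow> 'a mat \<Rightarrow> 'a mat"
  where "row_part i B = mat_of N (\<lambda>a k. if a = i then ent B a k else 0)"

lemma ent_row_part: "a \<in> {1..N} \<Longrightarrow> k \<in> {1..N} \<Longrightarrow> ent (row_part i B) a k = (if a = i then ent B a k else 0)"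
  unfolding row_part_def by (rule ent_mat_of)

lemma row_part_shaped:
  assumes S: "row_set S" and B: "B \<in> shaped S \<Phi>" and ij: "(i, j) \<in> S"
  shows "row_part i B \<in> shaped {(i, j)} \<Phi>"
proof -
  note p = row_setD(2)[OF S ij]
  have "row_part i B \<in> V"
    unfolding Vsp_def
  proof (intro CollectI conjI ballI impI)
    show "row_part i B \<in> carrier_mat N N" by (simp add: row_part_def)
    fix a k assume "a \<in> {1..N}" "k \<in> {1..N}" "(a, k) \<notin> Pos T n"
    then show "ent (row_part i B) a k = 0"
      using VspD(2)[OF shapedD(1)[OF B]] by (cases "a = i") (simp_all add: ent_row_part del: atLeastAtMost_iff)
  qed
  moreover have "ent (row_part i B) i j = \<Phi> (i, j)"
    using ent_row_part[OF Pos_range[OF p]] shapedD(2)[OF B ij] by simp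
  moreover have "\<exists>j'\<ge>k. (a, j') \<in> {(i, j)}" if ak: "(a, k) \<in> Pos T n" "ent (row_part i B) a k \<noteq> 0" for a k
  proof -
    have a: "a = i" "ent B a k \<noteq> 0" using ent_row_part[OF Pos_range[OF ak(1)]] ak(2) by (auto split: if_splits)
    then obtain j' where "j' \<ge> k" "(i, j') \<in> S" using shapedD(3)[OF B ak(1)] by auto
    then show ?thesis using row_setD(3)[OF S ij] a by auto
  qed
  ultimately show ?thesis unfolding shaped_def by auto
qed

lemma row_act_cong:
  assumes "\<And>l. l \<in> {i<..j} \<Longrightarrow> ent B i l = ent C i l" and "(i, j) \<in> Pos T n"
  shows "row_act i j u B = row_act i j u C" "row_factor i j u B = row_factor i j u C"
proof -
  note b = cut_bounds[OF assms(2)]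
  have s: "(\<Sum>l\<in>{i<..cut j}. ent B i l * ent u l k) = (\<Sum>l\<in>{i<..cut j}. ent C i l * ent u l k)"
    "(\<Sum>l\<in>{cut j<..j}. ent (ginv u) k l * ent B i l) = (\<Sum>l\<in>{cut j<..j}. ent (ginv u) k l * ent C i l)" for k
    using assms(1) b by (auto intro!: sum.cong)
  show r: "row_act i j u B = row_act i j u C" unfolding row_act_def s ..
  show "row_factor i j u B = row_factor i j u C"
    unfolding row_factor_def r using assms(1) b by (auto intro!: arg_cong[where f = \<theta>] sum.cong)
qed

text \<open>Row \<open>i\<close> of the image depends on row \<open>i\<close> of the label only
  (\<open>row_act_cong\<close>), so passing to one row commutes with the action.\<close>

lemma row_part_act:
  assumes S: "row_set S" and B: "B \<in> shaped S \<Phi>" and ij: "(i, j) \<in> S" and u: "u \<in> unitriangular T n"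
  shows "row_factor i j u (row_part i B) = row_factor i j u B"
    and "mixed_act {(i, j)} u (row_part i B) = row_part i (mixed_act S u B)"
proof -
  note p = row_setD(2)[OF S ij] and r = Pos_range[OF row_setD(2)[OF S ij]]
  have e: "ent (row_part i C) i l = ent C i l" if "l \<in> {i<..j}" for C l
    using ent_row_part[of i l i C] that r by auto
  show "row_factor i j u (row_part i B) = row_factor i j u B"
    by (rule row_act_cong(2)[OF e p])
  show "mixed_act {(i, j)} u (row_part i B) = row_part i (mixed_act S u B)"
  proof (rule shaped_eqI)
    show "mixed_act {(i, j)} u (row_part i B) \<in> shaped {(i, j)} \<Phi>"
      by (rule mixed_act_shaped[OF row_set_single[OF p] row_part_shaped[OF S B ij] u])
    show "row_part i (mixed_act S u B) \<in> shaped {(i, j)} \<Phi>"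
      by (rule row_part_shaped[OF S mixed_act_shaped[OF S B u] ij])
    fix a b k assume "(a, b) \<in> {(i, j)}" "k \<in> {a<..b}"
    then have ab: "a = i" "b = j" and k: "k \<in> {i<..j}" by auto
    show "ent (mixed_act {(i, j)} u (row_part i B)) a k = ent (row_part i (mixed_act S u B)) a k"
      using ent_mixed_act[OF row_set_single[OF p] _ k, of u "row_part i B"] ent_mixed_act[OF S ij k, of u B]
        e[OF k] row_act_cong(1)[OF e p, of u] unfolding ab by simp
  qed
qed

text \<open>Rows can be chosen independently of each other. This turns sums over labels into
  products over rows, and later identifies the labels of the tensor product.\<close>

lemma row_parts_bij:
  assumes S: "row_set S"
  shows "bij_betw (\<lambda>B. \<lambda>(i, j)\<in>S. row_part i B) (shaped S \<Phi>) (\<Pi>\<^sub>E s\<in>S. shaped {s} \<Phi>)"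
proof (rule bij_betwI[where g = "\<lambda>w. glue S (\<lambda>i j k. ent (w (i, j)) i k)"])
  let ?g = "\<lambda>w. glue S (\<lambda>i j k. ent (w (i, j)) i k)"
  have e: "ent (row_part i B) i k = ent B i k" if "(i, j) \<in> S" "k \<in> {i<..j}" for i j k B
    using ent_row_part[of i k i B] that Pos_range[OF row_setD(2)[OF S that(1)]] by auto
  show "(\<lambda>B. \<lambda>(i, j)\<in>S. row_part i B) \<in> shaped S \<Phi> \<rightarrow> (\<Pi>\<^sub>E s\<in>S. shaped {s} \<Phi>)"
    using row_part_shaped[OF S] by auto
  have g: "?g w \<in> shaped S \<Phi>" if w: "w \<in> (\<Pi>\<^sub>E s\<in>S. shaped {s} \<Phi>)" for w
  proof (rule glue_shaped[OF S])
    fix i j assume ij: "(i, j) \<in> S"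
    then have "w (i, j) \<in> shaped {(i, j)} \<Phi>" using w by auto
    then show "ent (w (i, j)) i j = \<Phi> (i, j)" using shapedD(2) by blast
  qed
  show "?g \<in> (\<Pi>\<^sub>E s\<in>S. shaped {s} \<Phi>) \<rightarrow> shaped S \<Phi>" using g by blast
  fix B assume B: "B \<in> shaped S \<Phi>"
  have wB: "(\<lambda>(i, j)\<in>S. row_part i B) \<in> (\<Pi>\<^sub>E s\<in>S. shaped {s} \<Phi>)" using row_part_shaped[OF S B] by auto
  show "?g (\<lambda>(i, j)\<in>S. row_part i B) = B"
  proof (rule shaped_eqI[OF g[OF wB] B])
    fix i j k assume ij: "(i, j) \<in> S" and k: "k \<in> {i<..j}"
    show "ent (?g (\<lambda>(i, j)\<in>S. row_part i B)) i k = ent B i k"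
      using ent_glue[OF S ij k] e[OF ij k] ij by simp
  qed
next
  fix w assume w: "w \<in> (\<Pi>\<^sub>E s\<in>S. shaped {s} \<Phi>)"
  let ?g = "glue S (\<lambda>i j k. ent (w (i, j)) i k)"
  show "(\<lambda>(i, j)\<in>S. row_part i ?g) = w"
  proof
    fix s
    show "(\<lambda>(i, j)\<in>S. row_part i ?g) s = w s"
    proof (cases "s \<in> S")
      case True
      then obtain i j where s: "s = (i, j)" and ij: "(i, j) \<in> S" by (cases s) auto
      have ws: "w (i, j) \<in> shaped {(i, j)} \<Phi>" using w ij by auto
      have g: "?g \<in> shaped S \<Phi>"
        by (rule glue_shaped[OF S]) (use w shapedD(2) in fastforce)
      have "row_part i ?g = w (i, j)"
      proof (rule shaped_eqI[OF row_part_shaped[OF S g ij] ws])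
        fix a b k assume "(a, b) \<in> {(i, j)}" "k \<in> {a<..b}"
        then have ab: "a = i" "b = j" and k: "k \<in> {i<..j}" by auto
        show "ent (row_part i ?g) a k = ent (w (i, j)) a k"
          unfolding ab using ent_glue[OF S ij k] ent_row_part[of i k i ?g] k Pos_range[OF row_setD(2)[OF S ij]] by auto
      qed
      then show ?thesis using s ij by simp
    qed (use w in auto)
  qed
qed

text \<open>Each row may be reached by a group element of its own, so this is in general not one
  orbit, yet it is stable because every row orbit is.\<close>

definition row_orbits :: "(nat \<times> nat) set \<Rightarrow> (nat \<times> nat \<Rightarrow> 'a) \<Rightarrow> 'a mat set"
  where "row_orbits S \<Phi> = {C \<in> shaped S \<Phi>. \<forall>(i, j)\<in>S. row_part i C \<in> row_orbit i j (\<Phi> (i, j))}"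

lemma row_orbit_act:
  assumes p: "(i, j) \<in> Pos T n" and C: "C \<in> row_orbit i j t" and u: "u \<in> carrier (Ugrp T n)"
  shows "mixed_act {(i, j)} u C \<in> row_orbit i j t"
proof -
  let ?U = "Ugrp T n :: 'a mat monoid"
  interpret U: Group.group ?U by (rule Ugrp_group)
  from C obtain v where v: "v \<in> carrier ?U" and Cv: "C = mixed_act {(i, j)} v (t \<cdot>\<^sub>m eunit N i j)"
    unfolding row_orbit_def by blast
  have "mixed_act {(i, j)} (v * u) (t \<cdot>\<^sub>m eunit N i j) = mixed_act {(i, j)} u C"
    unfolding Cv by (rule mixed_act_mult(1)[OF row_set_single[OF p] unit_shaped[OF p, of "\<lambda>_. t"]])
      (use u v Ugrp_subset in blast)+
  moreover have "v * u \<in> carrier ?U" using U.m_closed[OF v u] by (simp add: Ugrp_simps(2))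
  ultimately show ?thesis unfolding row_orbit_def by (metis image_eqI)
qed

lemma row_orbits_act:
  assumes S: "row_set S" and u: "u \<in> carrier (Ugrp T n)" and C: "C \<in> row_orbits S \<Phi>"
  shows "mixed_act S u C \<in> row_orbits S \<Phi>"
proof -
  have uu: "u \<in> unitriangular T n" using u Ugrp_subset by blast
  have CS: "C \<in> shaped S \<Phi>" using C unfolding row_orbits_def by blast
  have "row_part i (mixed_act S u C) \<in> row_orbit i j (\<Phi> (i, j))" if ij: "(i, j) \<in> S" for i j
    unfolding row_part_act(2)[OF S CS ij uu, symmetric]
    by (rule row_orbit_act[OF row_setD(2)[OF S ij] _ u]) (use C ij in \<open>auto simp: row_orbits_def\<close>)
  then show ?thesis using mixed_act_shaped[OF S CS uu] unfolding row_orbits_def by auto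
qed

text \<open>Stability of the complement is what makes the span of \<open>row_orbits\<close> a direct
  summand.\<close>

lemma row_orbits_complement_act:
  assumes S: "row_set S" and u: "u \<in> carrier (Ugrp T n)" and C: "C \<in> shaped S \<Phi> - row_orbits S \<Phi>"
  shows "mixed_act S u C \<in> shaped S \<Phi> - row_orbits S \<Phi>"
proof -
  have uu: "u \<in> unitriangular T n" using u Ugrp_subset by blast
  have CS: "C \<in> shaped S \<Phi>" using C by blast
  note w = GL_inv_unitriangular[OF uu]
  have "mixed_act S (ginv u) (mixed_act S u C) = C"
    using mixed_act_mult(1)[OF S CS uu w(1)] mixed_act_one(1)[OF S CS] w(2) by simp
  then show ?thesis using row_orbits_act[OF S Ugrp_inv_closed[OF u], of "mixed_act S u C" \<Phi>] C
      mixed_act_shaped[OF S CS uu] by auto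
qed

text \<open>A fixed label is a tuple of fixed rows and the multiplier is a product over rows, so the
  trace factors into the traces of single rows, each an elementary character.\<close>

lemma row_orbits_character:
  assumes S: "row_set S" and two: "(2::'a) \<noteq> 0" and nz: "\<forall>s\<in>S. \<Phi> s \<noteq> 0" and g: "g \<in> carrier (Ugrp T n)"
  shows "module_character (cfun.span (mixed S ` row_orbits S \<Phi>)) (mact T n \<theta>) g
    = (\<Prod>s\<in>S. elementary_character T n \<theta> s (\<Phi> s) g)"
proof -
  let ?R = "row_orbits S \<Phi>" and ?h = "\<lambda>B. \<lambda>(i, j)\<in>S. row_part i B"
  have gu: "g \<in> unitriangular T n" using g Ugrp_subset by blast
  define F where "F s = (case s of (i, j) \<Rightarrow> {C \<in> row_orbit i j (\<Phi> s). mixed_act {s} g C = C})" for s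
  define c where "c s C = (case s of (i, j) \<Rightarrow> row_factor i j g C)" for s C
  have RS: "?R \<subseteq> shaped S \<Phi>" unfolding row_orbits_def by blast
  have bij: "bij_betw ?h {C \<in> ?R. mixed_act S g C = C} (\<Pi>\<^sub>E s\<in>S. F s)"
  proof (rule bij_betw_subset[OF row_parts_bij[OF S, of \<Phi>]])
    note hb = row_parts_bij[OF S, of \<Phi>]
    show "{C \<in> ?R. mixed_act S g C = C} \<subseteq> shaped S \<Phi>" using RS by blast
    show "?h ` {C \<in> ?R. mixed_act S g C = C} = (\<Pi>\<^sub>E s\<in>S. F s)"
    proof (intro equalityI subsetI)
      fix w assume "w \<in> ?h ` {C \<in> ?R. mixed_act S g C = C}"
      then obtain C where C: "C \<in> ?R" "mixed_act S g C = C" and w: "w = ?h C" by blast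
      have "row_part i C \<in> F (i, j)" if ij: "(i, j) \<in> S" for i j
        using C row_part_act(2)[OF S _ ij gu, of C \<Phi>] ij RS unfolding F_def row_orbits_def by auto
      then show "w \<in> (\<Pi>\<^sub>E s\<in>S. F s)" unfolding w by auto
    next
      fix w assume w: "w \<in> (\<Pi>\<^sub>E s\<in>S. F s)"
      have FS: "F s \<subseteq> shaped {s} \<Phi>" if "s \<in> S" for s
        using row_orbit_shaped[OF row_setD(2)[OF S]] that unfolding F_def by (cases s) auto
      have "w \<in> (\<Pi>\<^sub>E s\<in>S. shaped {s} \<Phi>)" by (rule subsetD[OF PiE_mono[OF FS] w])
      then obtain C where C: "C \<in> shaped S \<Phi>" and hC: "w = ?h C"
        using bij_betw_imp_surj_on[OF hb] by blast
      have rp: "row_part i C \<in> F (i, j)" if ij: "(i, j) \<in> S" for i j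
        using PiE_mem[OF w ij] ij unfolding hC by simp
      have CR: "C \<in> ?R" unfolding row_orbits_def using C rp unfolding F_def by auto
      have "?h (mixed_act S g C) = ?h C"
      proof (rule restrict_ext, clarify)
        fix i j assume ij: "(i, j) \<in> S"
        show "row_part i (mixed_act S g C) = row_part i C"
          using rp[OF ij] row_part_act(2)[OF S C ij gu] unfolding F_def by simp
      qed
      then have "mixed_act S g C = C"
        using inj_onD[OF bij_betw_imp_inj_on[OF hb]] mixed_act_shaped[OF S C gu] C by blast
      then show "w \<in> ?h ` {C \<in> ?R. mixed_act S g C = C}" using CR hC by blast
    qed
  qed
  have finF: "finite (F s)" for s unfolding F_def row_orbit_def by (cases s) (simp add: Ugrp_finite)
  have "module_character (cfun.span (mixed S ` ?R)) (mact T n \<theta>) g = (\<Sum>C\<in>{C \<in> ?R. mixed_act S g C = C}. mixed_factor S g C)"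
    by (rule mixed_character[OF S RS row_orbits_act[OF S] g])
  also have "\<dots> = (\<Sum>C\<in>{C \<in> ?R. mixed_act S g C = C}. \<Prod>s\<in>S. c s (?h C s))"
  proof (rule sum.cong[OF refl])
    fix C assume "C \<in> {C \<in> ?R. mixed_act S g C = C}"
    then have C: "C \<in> shaped S \<Phi>" using RS by blast
    show "mixed_factor S g C = (\<Prod>s\<in>S. c s (?h C s))" unfolding mixed_factor_def
    proof (rule prod.cong[OF refl])
      fix s assume s: "s \<in> S"
      obtain i j where ij: "s = (i, j)" by (cases s)
      show "(case s of (i, j) \<Rightarrow> row_factor i j g C) = c s (?h C s)"
        using row_part_act(1)[OF S C _ gu, of i j] s unfolding c_def ij by simp
    qed
  qed
  also have "\<dots> = (\<Sum>w\<in>(\<Pi>\<^sub>E s\<in>S. F s). \<Prod>s\<in>S. c s (w s))"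
    by (rule sum.reindex_bij_betw[OF bij])
  also have "\<dots> = (\<Prod>s\<in>S. \<Sum>C\<in>F s. c s C)"
    by (rule prod_sum_PiE[symmetric]) (use finF row_setD(1)[OF S] in auto)
  also have "\<dots> = (\<Prod>s\<in>S. elementary_character T n \<theta> s (\<Phi> s) g)"
  proof (rule prod.cong[OF refl])
    fix s assume s: "s \<in> S"
    obtain i j where ij: "s = (i, j)" by (cases s)
    show "(\<Sum>C\<in>F s. c s C) = elementary_character T n \<theta> s (\<Phi> s) g"
      using elementary_character_orbit[OF two row_setD(2)[OF S], of i j "\<Phi> (i, j)" g] s nz g unfolding F_def c_def ij by simp
  qed
  finally show ?thesis .
qed

end

context basic_setting
begin

lemma row_set_S: "row_set S"
  unfolding row_set_def using basic unfolding basic_set_def by (auto intro: inj_on_subset)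

lemma VA_shaped: "VA = shaped S \<Phi>"
proof (intro equalityI subsetI)
  fix B assume "B \<in> VA"
  then show "B \<in> shaped S \<Phi>" using VAD(1,2)[of B] unfolding shaped_def shape_def by auto
next
  fix B assume "B \<in> shaped S \<Phi>"
  then show "B \<in> VA" using verge_iff[of B] unfolding shaped_def shape_def by auto
qed

lemma Ut_orbit_module_mixed: "Ut_orbit_module T n \<theta> A0 = cfun.span (mixed S ` shaped S \<Phi>)"
  unfolding Ut_orbit_module_def Ut_orbit_VA VA_shaped mixed_span[OF row_set_S] ..

lemma supercharacter_afforded:
  "affords (Ugrp T n) (cfun.span (mixed S ` row_orbits S \<Phi>)) (mact T n \<theta>) (supercharacter T n \<theta> D \<Phi>)"
proof -
  have "row_orbits S \<Phi> \<subseteq> shaped S \<Phi>" unfolding row_orbits_def by blast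
  then have "right_module (Ugrp T n) (cfun.span (mixed S ` row_orbits S \<Phi>)) (mact T n \<theta>)"
    by (rule mixed_submodule[OF row_set_S _ row_orbits_act[OF row_set_S]])
  then show ?thesis
    unfolding affords_def supercharacter_def using row_orbits_character[OF row_set_S two Phi] by blast
qed

lemma row_orbits_summand:
  "direct_summand (Ugrp T n) (cfun.span (mixed S ` row_orbits S \<Phi>)) (Ut_orbit_module T n \<theta> A0) (mact T n \<theta>)"
  unfolding Ut_orbit_module_mixed
proof (rule direct_summand_span[OF mixed_indep[OF row_set_S]])
  show R: "row_orbits S \<Phi> \<subseteq> shaped S \<Phi>" unfolding row_orbits_def by blast
  show "right_module (Ugrp T n) (cfun.span (mixed S ` row_orbits S \<Phi>)) (mact T n \<theta>)"
    by (rule mixed_submodule[OF row_set_S R row_orbits_act[OF row_set_S]])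
  show "right_module (Ugrp T n) (cfun.span (mixed S ` (shaped S \<Phi> - row_orbits S \<Phi>))) (mact T n \<theta>)"
    by (rule mixed_submodule[OF row_set_S Diff_subset row_orbits_complement_act[OF row_set_S]])
qed

lemma row_orbits_full:
  assumes "\<forall>(i, j)\<in>S. j \<noteq> br i"
  shows "row_orbits S \<Phi> = shaped S \<Phi>"
proof -
  have "row_part i C \<in> row_orbit i j (\<Phi> (i, j))" if "C \<in> shaped S \<Phi>" and ij: "(i, j) \<in> S" for C i j
    using row_part_shaped[OF row_set_S that] row_orbit_full[OF S_Pos[OF ij], of \<Phi>] S_Phi[OF ij] assms ij by auto
  then show ?thesis unfolding row_orbits_def by auto
qed

lemma chr_span_module:
  assumes "X \<subseteq> VA" "\<And>u B. u \<in> carrier (Ugrp T n) \<Longrightarrow> B \<in> X \<Longrightarrow> dot_act T n B u \<in> X"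
  shows "right_module (Ugrp T n) (cfun.span (chr T n \<theta> ` X)) (mact T n \<theta>)"
proof (rule Ugrp_module)
  show "chr T n \<theta> ` X \<subseteq> cfun.span (Vhat T n \<theta>)"
    unfolding Vhat_def using assms(1) by (auto intro: cfun.span_base)
  fix u :: "'a mat" and f assume u: "u \<in> carrier (Ugrp T n)" and "f \<in> chr T n \<theta> ` X"
  then obtain B where B: "B \<in> X" "f = chr T n \<theta> B" by blast
  have uu: "u \<in> unitriangular T n" and BV: "B \<in> V" using u Ugrp_subset B assms(1) by blast+
  show "translate u f \<in> cfun.span (chr T n \<theta> ` X)"
    unfolding B(2) translate_chr[OF BV uu] by (intro cfun.span_scale cfun.span_base imageI assms(2)[OF u B(1)])
qed

lemma orbit_decomposition:
  "direct_sum_decomposition (Ugrp T n) (verge_module T n \<theta> A0) (mact T n \<theta>) cores (U_orbit_module T n \<theta>)"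
proof -
  let ?J = "\<lambda>B. dot_act T n B ` carrier (Ugrp T n)"
  have UVA: "dot_act T n B u \<in> VA" if "B \<in> VA" "u \<in> carrier (Ugrp T n)" for B u
    by (rule dot_act_VA[OF that(1)]) (use that(2) Ugrp_subset in blast)
  have J: "?J B \<subseteq> VA" if "B \<in> cores" for B using UVA that by blast
  have U: "U_orbit_module T n \<theta> = (\<lambda>B. cfun.span (chr T n \<theta> ` ?J B))"
    unfolding U_orbit_module_def U_orbit_eq ..
  have "verge_module T n \<theta> A0 = cfun.span (chr T n \<theta> ` VA)"
    using A0_VA unfolding verge_module_def by simp
  moreover have "direct_sum_decomposition (Ugrp T n) (cfun.span (chr T n \<theta> ` VA)) (mact T n \<theta>) cores (\<lambda>B. cfun.span (chr T n \<theta> ` ?J B))"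
  proof (rule direct_sum_span[OF VA_chr_indep])
    show "finite cores" by (rule finite_subset[OF _ finite_Vsp[of T n]]) auto
    show "VA \<subseteq> (\<Union>B\<in>cores. ?J B)"
    proof
      fix B assume B: "B \<in> VA"
      then have "chr T n \<theta> B \<in> (\<Union>B\<in>cores. chr T n \<theta> ` ?J B)"
        using Ut_orbit_union unfolding Ut_orbit_VA U_orbit_eq by blast
      then obtain C v where C: "C \<in> cores" "v \<in> carrier (Ugrp T n)" and e: "chr T n \<theta> B = chr T n \<theta> (dot_act T n C v)" by blast
      have "B = dot_act T n C v" by (rule inj_onD[OF chr_inj e]) (use B in auto)
      then show "B \<in> (\<Union>B\<in>cores. ?J B)" using C by blast
    qed
    show "disjoint_family_on ?J cores"
      using U_orbits_disjoint unfolding disjoint_family_on_def U_orbit_eq by blast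
    show "right_module (Ugrp T n) (cfun.span (chr T n \<theta> ` VA)) (mact T n \<theta>)"
      by (rule chr_span_module) (use UVA in auto)
    fix B assume B: "B \<in> cores"
    show "?J B \<subseteq> VA" by (rule J[OF B])
    show "right_module (Ugrp T n) (cfun.span (chr T n \<theta> ` ?J B)) (mact T n \<theta>)"
    proof (rule chr_span_module[OF J[OF B]])
      fix u :: "'a mat" and C assume u: "u \<in> carrier (Ugrp T n)" and "C \<in> ?J B"
      then obtain v where v: "v \<in> carrier (Ugrp T n)" "C = dot_act T n B v" by blast
      have "dot_act T n C u = dot_act T n B (v * u)"
        unfolding v(2) by (rule dot_act_mult[symmetric]) (use u v Ugrp_subset B in blast)+
      moreover have "v * u \<in> carrier (Ugrp T n)"
        using subgroup.m_closed[OF isometries_unitriangular_subgroup] u v by (simp add: Ugrp_simps GL_simps)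
      ultimately show "dot_act T n C u \<in> ?J B" by blast
    qed
  qed
  ultimately show ?thesis unfolding U by simp
qed

end

section \<open>Tensor products of orbit modules\<close>

text \<open>Coefficients can be read off after applying \<open>F\<close>, because the images are
  independent.\<close>

lemma linear_family_bij:
  assumes lin: "Vector_Spaces.linear fscale fscale F" and J: "finite J"
    and F: "\<And>w. w \<in> J \<Longrightarrow> F (P w) = Q w" and Q: "indep_family Q J"
  shows "bij_betw F (cfun.span (P ` J)) (cfun.span (Q ` J))"
proof -
  interpret vp: vector_space_pair "fscale :: complex \<Rightarrow> ('a \<Rightarrow> complex) \<Rightarrow> _" "fscale :: complex \<Rightarrow> ('b \<Rightarrow> complex) \<Rightarrow> _"
    by (intro vector_space_pair.intro cfun.vector_space_axioms)
  have FS: "F (\<Sum>w\<in>J. fscale (c w) (P w)) = (\<Sum>w\<in>J. fscale (c w) (Q w))" for c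
    unfolding vp.linear_sum[OF lin] vp.linear_scale[OF lin] by (rule sum.cong[OF refl]) (simp only: F)
  show ?thesis
  proof (rule bij_betw_imageI)
    show "inj_on F (cfun.span (P ` J))"
    proof (rule inj_onI)
      fix x y assume "x \<in> cfun.span (P ` J)" "y \<in> cfun.span (P ` J)" and e: "F x = F y"
      then obtain c d where x: "x = (\<Sum>w\<in>J. fscale (c w) (P w))" and y: "y = (\<Sum>w\<in>J. fscale (d w) (P w))"
        unfolding span_family[OF J] by blast
      have "(\<Sum>w\<in>J. fscale (c w - d w) (Q w)) = 0"
        using e unfolding x y FS by (simp add: cfun.scale_left_diff_distrib sum_subtractf)
      then have "c w = d w" if "w \<in> J" for w
        using indep_familyD[OF Q _ that, of "\<lambda>w. c w - d w"] by simp
      then show "x = y" unfolding x y by (intro sum.cong refl) simp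
    qed
    show "F ` cfun.span (P ` J) = cfun.span (Q ` J)"
    proof (intro equalityI subsetI)
      fix y assume "y \<in> cfun.span (Q ` J)"
      then obtain c where "y = F (\<Sum>w\<in>J. fscale (c w) (P w))" unfolding span_family[OF J] FS by blast
      moreover have "(\<Sum>w\<in>J. fscale (c w) (P w)) \<in> cfun.span (P ` J)" unfolding span_family[OF J] by blast
      ultimately show "y \<in> F ` cfun.span (P ` J)" by blast
    next
      fix y assume "y \<in> F ` cfun.span (P ` J)"
      then obtain x where x: "x \<in> cfun.span (P ` J)" "y = F x" by blast
      from x(1) obtain c where "x = (\<Sum>w\<in>J. fscale (c w) (P w))" unfolding span_family[OF J] by blast
      with x(2) have "y = F (\<Sum>w\<in>J. fscale (c w) (P w))" by (simp only:)
      then show "y \<in> cfun.span (Q ` J)" unfolding span_family[OF J] FS by blast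
    qed
  qed
qed

lemma pure_tensor_cong: "(\<And>s. s \<in> S \<Longrightarrow> t s (x s) = t' s (y s)) \<Longrightarrow> pure_tensor S t x = pure_tensor S t' y"
  unfolding pure_tensor_def by (rule prod.cong[OF refl])

lemma pure_tensor_zero: "finite S \<Longrightarrow> s \<in> S \<Longrightarrow> t s (x s) = 0 \<Longrightarrow> pure_tensor S t x = 0"
  unfolding pure_tensor_def by (rule prod_zero) auto

lemma pure_tensor_expand:
  assumes S: "finite S" and J: "\<And>s. s \<in> S \<Longrightarrow> finite (J s)"
    and t: "\<And>s. s \<in> S \<Longrightarrow> t s = (\<Sum>w\<in>J s. fscale (a s w) (f s w))"
  shows "pure_tensor S t = (\<Sum>w\<in>(\<Pi>\<^sub>E s\<in>S. J s). fscale (\<Prod>s\<in>S. a s (w s)) (pure_tensor S (\<lambda>s. f s (w s))))"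
proof
  fix x
  have "pure_tensor S t x = (\<Prod>s\<in>S. \<Sum>w\<in>J s. a s w * f s w (x s))"
    unfolding pure_tensor_def by (rule prod.cong[OF refl]) (simp add: t sum_fun_apply fscale_apply)
  also have "\<dots> = (\<Sum>w\<in>(\<Pi>\<^sub>E s\<in>S. J s). \<Prod>s\<in>S. a s (w s) * f s (w s) (x s))"
    by (rule prod_sum_PiE[OF S J])
  also have "\<dots> = (\<Sum>w\<in>(\<Pi>\<^sub>E s\<in>S. J s). fscale (\<Prod>s\<in>S. a s (w s)) (pure_tensor S (\<lambda>s. f s (w s)))) x"
    by (simp add: sum_fun_apply fscale_apply pure_tensor_def prod.distrib)
  finally show "pure_tensor S t x = \<dots>" .
qed

lemma tensor_space_span:
  assumes S: "finite S" and J: "\<And>s. s \<in> S \<Longrightarrow> finite (J s)"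
    and W: "\<And>s. s \<in> S \<Longrightarrow> W s = cfun.span (f ` J s)"
  shows "tensor_space S W = cfun.span ((\<lambda>w. pure_tensor S (\<lambda>s. f (w s))) ` (\<Pi>\<^sub>E s\<in>S. J s))"
  unfolding tensor_space_def
proof (rule equalityI; rule cfun.span_minimal[OF _ cfun.subspace_span]; rule image_subsetI)
  fix t assume t: "t \<in> (\<Pi>\<^sub>E s\<in>S. W s)"
  have "\<exists>a. t s = (\<Sum>w\<in>J s. fscale (a w) (f w))" if s: "s \<in> S" for s
    using PiE_mem[OF t s] unfolding W[OF s] span_family[OF J[OF s]] .
  then obtain a where a: "\<And>s. s \<in> S \<Longrightarrow> t s = (\<Sum>w\<in>J s. fscale (a s w) (f w))" by metis
  have "pure_tensor S t = (\<Sum>w\<in>(\<Pi>\<^sub>E s\<in>S. J s). fscale (\<Prod>s\<in>S. a s (w s)) (pure_tensor S (\<lambda>s. f (w s))))"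
    by (rule pure_tensor_expand[OF S J a])
  also have "\<dots> \<in> cfun.span ((\<lambda>w. pure_tensor S (\<lambda>s. f (w s))) ` (\<Pi>\<^sub>E s\<in>S. J s))"
    by (intro cfun.span_sum cfun.span_scale cfun.span_base imageI)
  finally show "pure_tensor S t \<in> cfun.span ((\<lambda>w. pure_tensor S (\<lambda>s. f (w s))) ` (\<Pi>\<^sub>E s\<in>S. J s))" .
next
  fix w assume w: "w \<in> (\<Pi>\<^sub>E s\<in>S. J s)"
  have "(\<lambda>s\<in>S. f (w s)) \<in> (\<Pi>\<^sub>E s\<in>S. W s)"
    using PiE_mem[OF w] by (auto simp: W intro!: cfun.span_base)
  moreover have "pure_tensor S (\<lambda>s. f (w s)) = pure_tensor S (\<lambda>s\<in>S. f (w s))"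
    unfolding pure_tensor_def by (intro ext prod.cong) auto
  ultimately show "pure_tensor S (\<lambda>s. f (w s)) \<in> cfun.span (pure_tensor S ` (\<Pi>\<^sub>E s\<in>S. W s))"
    by (auto intro: cfun.span_base)
qed

context basic_setting
begin

text \<open>A position and its mirror image form a basic set of their own which meets
  \<open>Pos\<close> in that position alone, so the orbit description applies to each tensor factor
  by a second interpretation of the locale.\<close>

lemma single_basic:
  assumes ij: "(i, j) \<in> S"
  shows "Ut_orbit_module T n \<theta> (\<Phi> (i, j) \<cdot>\<^sub>m eunit N i j) = cfun.span (chr T n \<theta> ` shaped {(i, j)} \<Phi>)"
proof -
  note r = S_range[OF ij] and p = S_Pos[OF ij]
  note rb = bar_range[OF r(1)] bar_range[OF r(2)]
  let ?D = "{(i, j), (br j, br i)}"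
  have lt: "br j < br i" using r by (auto simp: bar_def)
  have eq: "br j = i \<longleftrightarrow> br i = j" using bar_bar[OF r(1)] bar_bar[OF r(2)] by metis
  have inj: "br a = br b \<Longrightarrow> a = b" if "a \<in> {1..N}" "b \<in> {1..N}" for a b
    using bar_bar[OF that(1)] bar_bar[OF that(2)] by metis
  have "basic_set T n ?D"
    unfolding basic_set_def
  proof (intro conjI ballI)
    show "?D \<subseteq> {(i, j). 1 \<le> i \<and> i < j \<and> j \<le> N}" using r rb lt by auto
    show "inj_on fst ?D" "inj_on snd ?D" using eq by (auto simp: inj_on_def)
    fix a b assume a: "a \<in> {1..N}" and b: "b \<in> {1..N}"
    show "(a, b) \<in> ?D \<longleftrightarrow> (br b, br a) \<in> ?D"
    proof -
      have flip: "br x = y \<longleftrightarrow> x = br y" if "x \<in> {1..N}" "y \<in> {1..N}" for x y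
        using bar_bar[OF that(1)] bar_bar[OF that(2)] by metis
      have "br b = i \<longleftrightarrow> b = br i" "br a = j \<longleftrightarrow> a = br j" "br b = br j \<longleftrightarrow> b = j" "br a = br i \<longleftrightarrow> a = i"
        using flip[OF b r(1)] flip[OF a r(2)] inj[OF b r(2)] inj[OF a r(1)] by blast+
      then show ?thesis by auto
    qed
  qed
  moreover have S1: "?D \<inter> Pos T n = {(i, j)}"
  proof -
    have "j = br i" if "(br j, br i) \<in> Pos T n"
      using PosD[OF that] PosD[OF p] bar_bar[OF r(2)] by simp
    then show ?thesis using p bar_bar[OF r(1)] by auto
  qed
  ultimately interpret one: basic_setting T n \<theta> ?D \<Phi>
    by unfold_locales (use S_Phi[OF ij] in auto)
  have "one.A0 = \<Phi> (i, j) \<cdot>\<^sub>m eunit N i j"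
    by (rule ent_eqI[OF VspD(1)[OF one.A0_Vsp]])
      (auto simp: one.ent_A0 S1 ent_unit simp del: atLeastAtMost_iff)
  then show ?thesis
    using one.Ut_orbit_VA one.VA_shaped unfolding Ut_orbit_module_def S1 by simp
qed

text \<open>An explicit form of the diagonal action, all coordinates being moved by the same
  \<open>h\<close>; the default 0 fits factors that vanish off \<open>V\<close>.\<close>

definition diagonal :: "('a mat \<Rightarrow> 'a mat) \<Rightarrow> ((nat \<times> nat \<Rightarrow> 'a mat) \<Rightarrow> complex) \<Rightarrow> (nat \<times> nat \<Rightarrow> 'a mat) \<Rightarrow> complex"
  where "diagonal h f = (\<lambda>x. if \<forall>s\<in>S. x s \<in> V then f (\<lambda>s\<in>S. h (x s)) else 0)"

text \<open>Restriction of a function of tuples to the diagonal. It turns pure tensors into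
  pointwise products, and a character of the given shape is the product of the characters of its
  rows.\<close>

definition merge :: "((nat \<times> nat \<Rightarrow> 'a mat) \<Rightarrow> complex) \<Rightarrow> 'a mat \<Rightarrow> complex"
  where "merge f = (\<lambda>x. if x \<in> V then f (\<lambda>s\<in>S. x) else 0)"

lemma linear_diagonal: "Vector_Spaces.linear fscale fscale (diagonal h)"
  and linear_merge: "Vector_Spaces.linear fscale fscale merge"
  by (auto simp: Vector_Spaces.linear_iff diagonal_def merge_def fun_eq_iff fscale_apply
      intro: cfun.vector_space_axioms)

abbreviation "factor \<equiv> \<lambda>(i, j). Ut_orbit_module T n \<theta> (\<Phi> (i, j) \<cdot>\<^sub>m eunit N i j)"

lemma factor_span: "s \<in> S \<Longrightarrow> factor s = cfun.span (chr T n \<theta> ` shaped {s} \<Phi>)"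
proof -
  assume s: "s \<in> S"
  obtain i j where ij: "s = (i, j)" by (cases s)
  show ?thesis using single_basic[of i j] s unfolding ij by simp
qed

text \<open>Verified on mixed functions, which have the same span and are already known to be
  permuted up to scalars by all unitriangular matrices.\<close>

lemma chr_span_Utilde_module:
  assumes S: "row_set S'"
  shows "right_module (Utilde_grp T n) (cfun.span (chr T n \<theta> ` shaped S' \<Psi>)) (mact T n \<theta>)"
  unfolding mixed_span[OF S, symmetric]
proof (rule Utilde_module)
  show "mixed S' ` shaped S' \<Psi> \<subseteq> cfun.span (Vhat T n \<theta>)" using mixed_Vhat[OF S] by blast
  fix u :: "'a mat" and f assume "u \<in> carrier (Utilde_grp T n)" and "f \<in> mixed S' ` shaped S' \<Psi>"
  then obtain C where u: "u \<in> unitriangular T n" and C: "C \<in> shaped S' \<Psi>" "f = mixed S' C" unfolding Utilde_simps by blast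
  show "translate u f \<in> cfun.span (mixed S' ` shaped S' \<Psi>)"
    unfolding C(2) translate_mixed[OF S u] by (intro cfun.span_scale cfun.span_base imageI mixed_act_shaped[OF S C(1) u])
qed

lemma factor_module: "s \<in> S \<Longrightarrow> right_module (Utilde_grp T n) (factor s) (mact T n \<theta>)"
proof -
  assume s: "s \<in> S"
  then have "row_set {s}" unfolding row_set_def by auto
  then show ?thesis unfolding factor_span[OF s] by (rule chr_span_Utilde_module)
qed

lemma factor_Vhat: "s \<in> S \<Longrightarrow> f \<in> factor s \<Longrightarrow> f \<in> cfun.span (Vhat T n \<theta>)"
  unfolding factor_span using cfun.span_mono[of "chr T n \<theta> ` shaped {s} \<Phi>" "Vhat T n \<theta>"]
  unfolding Vhat_def shaped_def by blast

lemma diagonal_pure: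
  assumes u: "u \<in> unitriangular T n" and t: "t \<in> (\<Pi>\<^sub>E s\<in>S. factor s)"
  shows "diagonal (shift u) (pure_tensor S t) = pure_tensor S (\<lambda>s. mact T n \<theta> u (t s))"
proof
  fix x
  have m: "mact T n \<theta> u (t s) y = (if y \<in> V then t s (shift u y) else 0)" if "s \<in> S" for s y
    using mact_translate[OF factor_Vhat[OF that PiE_mem[OF t that]] u] unfolding translate_def by simp
  show "diagonal (shift u) (pure_tensor S t) x = pure_tensor S (\<lambda>s. mact T n \<theta> u (t s)) x"
  proof (cases "\<forall>s\<in>S. x s \<in> V")
    case True
    then show ?thesis unfolding diagonal_def by (auto intro!: pure_tensor_cong simp: m)
  next
    case False
    then obtain s where s: "s \<in> S" "x s \<notin> V" by blast
    then have "mact T n \<theta> u (t s) (x s) = 0" using m by simp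
    then have "pure_tensor S (\<lambda>s. mact T n \<theta> u (t s)) x = 0"
      by (rule pure_tensor_zero[OF finite_S s(1)])
    then show ?thesis unfolding diagonal_def if_not_P[OF False] by simp
  qed
qed

text \<open>Linear maps that agree on pure tensors agree on their span, which determines the choice
  made by \<open>SOME\<close> there.\<close>

lemma tensor_act_diagonal:
  assumes u: "u \<in> unitriangular T n" and f: "f \<in> tensor_space S factor"
  shows "tensor_act S factor (mact T n \<theta>) u f = diagonal (shift u) f"
proof -
  interpret vp: vector_space_pair "fscale :: complex \<Rightarrow> ((nat \<times> nat \<Rightarrow> 'a mat) \<Rightarrow> complex) \<Rightarrow> _" "fscale :: complex \<Rightarrow> ((nat \<times> nat \<Rightarrow> 'a mat) \<Rightarrow> complex) \<Rightarrow> _"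
    by (intro vector_space_pair.intro cfun.vector_space_axioms)
  let ?P = "\<lambda>L. Vector_Spaces.linear fscale fscale L \<and>
      (\<forall>t\<in>(\<Pi>\<^sub>E s\<in>S. factor s). L (pure_tensor S t) = pure_tensor S (\<lambda>s. mact T n \<theta> u (t s)))"
  have "?P (diagonal (shift u))" using linear_diagonal diagonal_pure[OF u] by blast
  then have P: "?P (tensor_act S factor (mact T n \<theta>) u)" unfolding tensor_act_def by (rule someI[of ?P])
  show ?thesis
  proof (rule vp.linear_eq_on[OF conjunct1[OF P] linear_diagonal f[unfolded tensor_space_def]])
    fix b assume "b \<in> pure_tensor S ` (\<Pi>\<^sub>E s\<in>S. factor s)"
    then show "tensor_act S factor (mact T n \<theta>) u b = diagonal (shift u) b"
      using P diagonal_pure[OF u] by auto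
  qed
qed

lemma tensor_module: "right_module (Utilde_grp T n) (tensor_space S factor) (tensor_act S factor (mact T n \<theta>))"
  unfolding tensor_space_def
proof (rule right_module_spanI[of _ "\<lambda>u. diagonal (shift u)", OF linear_diagonal _ Group.group.is_monoid[OF Utilde_group]])
  fix u :: "'a mat" and f assume "u \<in> carrier (Utilde_grp T n)" "f \<in> cfun.span (pure_tensor S ` (\<Pi>\<^sub>E s\<in>S. factor s))"
  then show "tensor_act S factor (mact T n \<theta>) u f = diagonal (shift u) f"
    using tensor_act_diagonal unfolding tensor_space_def Utilde_simps by blast
next
  fix u :: "'a mat" and f assume u: "u \<in> carrier (Utilde_grp T n)" and "f \<in> pure_tensor S ` (\<Pi>\<^sub>E s\<in>S. factor s)"
  then obtain t where t: "t \<in> (\<Pi>\<^sub>E s\<in>S. factor s)" and f: "f = pure_tensor S t" by blast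
  have "(\<lambda>s\<in>S. mact T n \<theta> u (t s)) \<in> (\<Pi>\<^sub>E s\<in>S. factor s)"
    using right_moduleD(2)[OF factor_module u] PiE_mem[OF t] by (intro restrict_PiE_iff[THEN iffD2]) blast
  moreover have "diagonal (shift u) f = pure_tensor S (\<lambda>s\<in>S. mact T n \<theta> u (t s))"
    unfolding f using diagonal_pure[OF _ t, of u] u unfolding Utilde_simps
    by (auto intro!: ext pure_tensor_cong)
  ultimately show "diagonal (shift u) f \<in> cfun.span (pure_tensor S ` (\<Pi>\<^sub>E s\<in>S. factor s))"
    by (auto intro: cfun.span_base)
next
  fix f assume "f \<in> pure_tensor S ` (\<Pi>\<^sub>E s\<in>S. factor s)"
  then obtain t where t: "t \<in> (\<Pi>\<^sub>E s\<in>S. factor s)" and f: "f = pure_tensor S t" by blast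
  show "diagonal (shift \<one>\<^bsub>Utilde_grp T n\<^esub>) f = f"
  proof
    fix x
    show "diagonal (shift \<one>\<^bsub>Utilde_grp T n\<^esub>) f x = f x"
    proof (cases "\<forall>s\<in>S. x s \<in> V")
      case True
      then show ?thesis unfolding diagonal_def f Utilde_simps by (auto intro!: pure_tensor_cong simp: shift_one)
    next
      case False
      then obtain s where s: "s \<in> S" "x s \<notin> V" by blast
      then have "t s (x s) = 0" using span_Vhat_outside[OF factor_Vhat[OF s(1) PiE_mem[OF t s(1)]]] by simp
      then have "pure_tensor S t x = 0" by (rule pure_tensor_zero[OF finite_S s(1)])
      then show ?thesis unfolding diagonal_def f if_not_P[OF False] by simp
    qed
  qed
next
  fix g h :: "'a mat" and f :: "(nat \<times> nat \<Rightarrow> 'a mat) \<Rightarrow> complex"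
  assume gh: "g \<in> carrier (Utilde_grp T n)" "h \<in> carrier (Utilde_grp T n)"
  show "diagonal (shift (g \<otimes>\<^bsub>Utilde_grp T n\<^esub> h)) f = diagonal (shift h) (diagonal (shift g) f)"
  proof
    fix x
    have "(\<lambda>s\<in>S. shift (g * h) (x s)) = (\<lambda>s\<in>S. shift g ((\<lambda>s\<in>S. shift h (x s)) s))" if "\<forall>s\<in>S. x s \<in> V"
      using shift_mult[of g h] gh that unfolding Utilde_simps by (intro restrict_ext) simp
    then show "diagonal (shift (g \<otimes>\<^bsub>Utilde_grp T n\<^esub> h)) f x = diagonal (shift h) (diagonal (shift g) f) x"
      unfolding diagonal_def Utilde_simps by simp
  qed
qed

text \<open>\<open>merge\<close> carries the tensor products of row characters to the characters of
  the given shape, and it is equivariant because moving all coordinates by one \<open>shift\<close>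
  preserves the diagonal.\<close>

lemma tensor_iso:
  "right_module_iso (Utilde_grp T n) (tensor_space S factor) (tensor_act S factor (mact T n \<theta>))
    (Ut_orbit_module T n \<theta> A0) (mact T n \<theta>)"
proof -
  interpret vp: vector_space_pair "fscale :: complex \<Rightarrow> ((nat \<times> nat \<Rightarrow> 'a mat) \<Rightarrow> complex) \<Rightarrow> _" "fscale :: complex \<Rightarrow> ('a mat \<Rightarrow> complex) \<Rightarrow> _"
    by (intro vector_space_pair.intro cfun.vector_space_axioms)
  let ?h = "\<lambda>B. \<lambda>(i, j)\<in>S. row_part i B" and ?P = "\<lambda>w. pure_tensor S (\<lambda>s. chr T n \<theta> (w s))"
  have O: "Ut_orbit_module T n \<theta> A0 = cfun.span (chr T n \<theta> ` shaped S \<Phi>)"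
    unfolding Ut_orbit_module_def Ut_orbit_VA VA_shaped ..
  have "tensor_space S factor = cfun.span (?P ` (\<Pi>\<^sub>E s\<in>S. shaped {s} \<Phi>))"
    by (rule tensor_space_span[OF finite_S finite_shaped factor_span])
  also have "?P ` (\<Pi>\<^sub>E s\<in>S. shaped {s} \<Phi>) = (\<lambda>B. ?P (?h B)) ` shaped S \<Phi>"
    unfolding bij_betw_imp_surj_on[OF row_parts_bij[OF row_set_S, of \<Phi>], symmetric] image_image ..
  finally have X: "tensor_space S factor = cfun.span ((\<lambda>B. ?P (?h B)) ` shaped S \<Phi>)" .
  have mP: "merge (?P (?h B)) = chr T n \<theta> B" if B: "B \<in> shaped S \<Phi>" for B
  proof
    fix x
    show "merge (?P (?h B)) x = chr T n \<theta> B x"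
    proof (cases "x \<in> V")
      case True
      have "merge (?P (?h B)) x = (\<Prod>(i, j)\<in>S. chr T n \<theta> (row_part i B) x)"
        using True unfolding merge_def pure_tensor_def by (auto intro!: prod.cong)
      also have "\<dots> = (\<Prod>(i, j)\<in>S. \<theta> (- (\<Sum>k\<in>{i<..j}. ent B i k * ent x i k)))"
      proof (rule prod.cong[OF refl], clarify)
        fix i j assume ij: "(i, j) \<in> D" "(i, j) \<in> Pos T n"
        then have S: "(i, j) \<in> S" by simp
        have "chr T n \<theta> (row_part i B) x = \<theta> (- (\<Sum>k\<in>{i<..j}. ent (row_part i B) i k * ent x i k))"
          using chr_shaped[OF row_set_single[OF ij(2)] row_part_shaped[OF row_set_S B S] True] by simp
        also have "(\<Sum>k\<in>{i<..j}. ent (row_part i B) i k * ent x i k) = (\<Sum>k\<in>{i<..j}. ent B i k * ent x i k)"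
          by (rule sum.cong[OF refl]) (use S_range[OF S] ent_row_part[of i _ i B] in auto)
        finally show "chr T n \<theta> (row_part i B) x = \<theta> (- (\<Sum>k\<in>{i<..j}. ent B i k * ent x i k))" .
      qed
      also have "\<dots> = chr T n \<theta> B x" by (rule chr_shaped[OF row_set_S B True, symmetric])
      finally show ?thesis .
    qed (simp add: merge_def chr_outside)
  qed
  have bij: "bij_betw merge (tensor_space S factor) (Ut_orbit_module T n \<theta> A0)"
    unfolding X O by (rule linear_family_bij[OF linear_merge finite_shaped _ chr_shaped_indep]) (rule mP)
  have act: "merge (tensor_act S factor (mact T n \<theta>) u f) = mact T n \<theta> u (merge f)"
    if u: "u \<in> carrier (Utilde_grp T n)" and f: "f \<in> tensor_space S factor" for u f
  proof -
    have uu: "u \<in> unitriangular T n" using u unfolding Utilde_simps .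
    have "merge f \<in> cfun.span (chr T n \<theta> ` shaped S \<Phi>)"
      using bij_betw_imp_surj_on[OF bij] f unfolding O by blast
    then have "merge f \<in> cfun.span (Vhat T n \<theta>)"
      using cfun.span_mono[of "chr T n \<theta> ` shaped S \<Phi>" "Vhat T n \<theta>"] unfolding Vhat_def shaped_def by blast
    then have "mact T n \<theta> u (merge f) = translate u (merge f)" by (rule mact_translate[OF _ uu])
    also have "\<dots> = merge (diagonal (shift u) f)"
    proof
      fix x
      have "(\<lambda>s\<in>S. shift u ((\<lambda>s\<in>S. x) s)) = (\<lambda>s\<in>S. shift u x)" by (rule restrict_ext) simp
      then show "translate u (merge f) x = merge (diagonal (shift u) f) x"
        unfolding translate_def merge_def diagonal_def by auto
    qed
    finally show ?thesis unfolding tensor_act_diagonal[OF uu f] by simp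
  qed
  show ?thesis unfolding right_module_iso_def
  proof (intro conjI exI[of _ merge] ballI allI bij act)
    show "right_module (Utilde_grp T n) (Ut_orbit_module T n \<theta> A0) (mact T n \<theta>)"
      unfolding O by (rule chr_span_Utilde_module[OF row_set_S])
  qed (auto simp: vp.linear_add[OF linear_merge] vp.linear_scale[OF linear_merge] intro: tensor_module)
qed

end

text \<open>Translating the sum of all elements by 1 shows that the cardinality is 0 in the field;
  with 2 = 0 an odd cardinality would be 1.\<close>

lemma odd_card_two_nonzero:
  assumes "odd (card (UNIV :: 'a::{field, finite} set))"
  shows "(2::'a) \<noteq> 0"
proof
  assume two: "(2::'a) = 0"
  have "(\<Sum>x\<in>UNIV. x) = (\<Sum>x\<in>UNIV. x + 1 :: 'a)"
    by (rule sum.reindex_bij_witness[of _ "\<lambda>x. x + 1" "\<lambda>x. x - 1"]) auto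
  then have z: "of_nat (card (UNIV :: 'a set)) = (0::'a)" by (simp add: sum.distrib)
  obtain k where "card (UNIV :: 'a set) = 2 * k + 1" using assms by (elim oddE)
  then show False using z two by simp
qed

theorem theorem7p20:
  fixes p q e n :: nat
    and T :: classical_type
    and \<theta> :: "'a::{field, finite} \<Rightarrow> complex"
    and D :: "(nat \<times> nat) set"
    and \<Phi> :: "nat \<times> nat \<Rightarrow> 'a"
    and A :: "'a mat"
  assumes "prime p" and "odd p" and "q = p ^ e" and "card (UNIV :: 'a set) = q"
    and "nontrivial_linear_character \<theta>"
    and "basic_set T n D" and "D \<noteq> {}"
    and "\<forall>ij\<in>D \<inter> Pos T n. \<Phi> ij \<noteq> 0"
    and "A = A_of T n D \<Phi>"
  shows
    "((\<forall>(i, j)\<in>D \<inter> Pos T n. j \<noteq> bar T n i) \<longrightarrow>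
        affords (Ugrp T n) (Ut_orbit_module T n \<theta> A) (mact T n \<theta>) (supercharacter T n \<theta> D \<Phi>)) \<and>
     ((\<exists>i\<in>{1..n}. (i, bar T n i) \<in> D) \<longrightarrow>
        (\<exists>W. direct_summand (Ugrp T n) W (Ut_orbit_module T n \<theta> A) (mact T n \<theta>) \<and>
             affords (Ugrp T n) W (mact T n \<theta>) (supercharacter T n \<theta> D \<Phi>))) \<and>
     main_separated T n A \<and> verge_character T n A \<and>
     Ut_orbit T n \<theta> A =
       (\<Union>B\<in>{B \<in> Vsp T n. main_separated T n B \<and> core_character T n B \<and> verge T n B = A}. U_orbit T n \<theta> B) \<and>
     disjoint_family_on (U_orbit T n \<theta>)
       {B \<in> Vsp T n. main_separated T n B \<and> core_character T n B \<and> verge T n B = A} \<and>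
     Ut_orbit_module T n \<theta> A = verge_module T n \<theta> A \<and>
     direct_sum_decomposition (Ugrp T n) (verge_module T n \<theta> A) (mact T n \<theta>)
       {B \<in> Vsp T n. core_character T n B \<and> verge T n B = A} (U_orbit_module T n \<theta>) \<and>
     right_module_iso (Utilde_grp T n)
       (tensor_space (D \<inter> Pos T n) (\<lambda>(i, j). Ut_orbit_module T n \<theta> (\<Phi> (i, j) \<cdot>\<^sub>m eunit (dimN T n) i j)))
       (tensor_act (D \<inter> Pos T n) (\<lambda>(i, j). Ut_orbit_module T n \<theta> (\<Phi> (i, j) \<cdot>\<^sub>m eunit (dimN T n) i j))
          (mact T n \<theta>))
       (Ut_orbit_module T n \<theta> A) (mact T n \<theta>)"
proof -
  have "(2::'a) \<noteq> 0"
    by (rule odd_card_two_nonzero) (use assms(2-4) in simp)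
  then interpret basic_setting T n \<theta> D \<Phi>
    by unfold_locales (use assms(5,6,8) in auto)
  have cores: "{B \<in> Vsp T n. main_separated T n B \<and> core_character T n B \<and> verge T n B = A} = cores"
    using VA_main_separated assms(9) by auto
  have "affords (Ugrp T n) (Ut_orbit_module T n \<theta> A) (mact T n \<theta>) (supercharacter T n \<theta> D \<Phi>)"
    if "\<forall>(i, j)\<in>D \<inter> Pos T n. j \<noteq> bar T n i"
    using supercharacter_afforded unfolding row_orbits_full[OF that] Ut_orbit_module_mixed assms(9) .
  moreover have "\<exists>W. direct_summand (Ugrp T n) W (Ut_orbit_module T n \<theta> A) (mact T n \<theta>) \<and>
      affords (Ugrp T n) W (mact T n \<theta>) (supercharacter T n \<theta> D \<Phi>)"
    using row_orbits_summand supercharacter_afforded assms(9) by blast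
  moreover have "main_separated T n A" "verge_character T n A"
    using VA_main_separated[OF A0_VA] A0_verge_character assms(9) by auto
  ultimately show ?thesis
    using Ut_orbit_union U_orbits_disjoint Ut_orbit_module_verge orbit_decomposition tensor_iso
    unfolding cores unfolding assms(9) by blast
qed

end
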